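(* Let $F(z,u)=G(uH(z))M(z)$ be a critical degenerate extended composition scheme with $0<\lambda_H<1$ (terms and standing assumptions as in the context), and let $X_n$ be the associated core size, $\mathbb P\{X_n=k\}=\frac{[z^nu^k]F(z,u)}{[z^n]F(z,1)}$. Then, for every fixed integer $k\ge0$, as $n\to\infty$: (a) If $0<\lambda_G<1$ and $\lambda_M<\lambda_G\lambda_H$, then $X_n$ converges to the Boltzmann distribution $\mathcal B_G(\rho_G)$: $$\mathbb P\{X_n=k\}\to\frac{g_k\rho_G^k}{G(\rho_G)}.$$ (b) If $\lambda_G>1$, then: - for $\lambda_M<\lambda_H$: $\displaystyle \mathbb P\{X_n=k\}\to\frac{g_k\rho_G^k}{G(\rho_G)}$; - for $\lambda_M=\lambda_H$: $X_n$ converges to a convex combination of two discrete distributions, $$\mathbb P\{X_n=k\}\to p\,\frac{g_k\rho_G^k}{G(\rho_G)}+(1-p)\,\frac{k\,g_k\rho_G^{k-1}}{G'(\rho_G)},\qquad p=\frac{c_MG(\rho_G)}{c_MG(\rho_G)+c_H\tau_MG'(\rho_G)};$$ that is, the limit law is that of $I\cdot A+(1-I)\cdot A'$, where $I$ is Bernoulli with parameter $p$, $A$ has law $\mathbb P\{A=k\}=g_k\rho_G^k/G(\rho_G)$, $A'$ has law $\mathbb P\{A'=k\}=kg_k\rho_G^{k-1}/G'(\rho_G)$, and $I,A,A'$ are independent; - for $\lambda_M>\lambda_H$: $\displaystyle \mathbb P\{X_n=k\}\to\frac{k\,g_k\rho_G^{k-1}}{G'(\rho_G)}$.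
   Context: Standing assumptions. $G(z)=\sum_n g_nz^n$, $H(z)$, $M(z)$ are power series with nonnegative coefficients, analytic at $0$, with $H(0)=0$ and $M\not\equiv0$; $\rho_G,\rho_H$ (finite) and $\rho_M\in(0,\infty]$ are their radii of convergence. For $f\in\{G,H\}$: $z=\rho_f$ is the only singularity of $f$ on $|z|\le\rho_f$, $f$ is analytic in a domain $\{|z|<\rho_f+\varepsilon,\ |\arg(z-\rho_f)|>\theta\}$ for some $\varepsilon>0$, $0<\theta<\pi/2$, and there, as $z\to\rho_f$, $$f(z)=P_f(1-z/\rho_f)+c_f(1-z/\rho_f)^{\lambda_f}(1+o(1)),$$ with $c_f\ne0$, singular exponent $\lambda_f\in\mathbb R\setminus\{0,1,2,\dots\}$ and $P_f$ a polynomial ($P_f=0$ if $\lambda_f<0$, $P_f$ constant if $0<\lambda_f<1$, $1\le\deg P_f\le\lfloor\lambda_f\rfloor$ if $\lambda_f>1$). For $\lambda_f>0$, $\tau_f:=f(\rho_f)$. If $\rho_M=\rho_H$, the same is assumed for $M$ (with $c_M,\lambda_M,\tau_M$); if $\rho_M>\rho_H$ (e.g. $M=1$) one sets $\lambda_M=+\infty$ and $\tau_M=M(\rho_H)$. Critical: $H(\rho_H)=\rho_G$ and $\rho_M\ge\rho_H$. Degenerate (for $0<\lambda_H<1$): either $\lambda_G>1$, or $0<\lambda_G<1$ and $\lambda_M<\min(\lambda_G\lambda_H,\lambda_H)$. Boltzmann distribution $\mathcal B_G(x)$ associated with $G$: $\mathbb P\{A=k\}=g_kx^k/G(x)$, $k\ge0$;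 here used at $x=\rho_G$, where $G(\rho_G)<\infty$. *)

theory Defs
  imports
    "HOL-Analysis.Analysis"
    "HOL-Analysis.FPS_Convergence"
    "HOL-Computational_Algebra.Computational_Algebra"
    "HOL-Library.Landau_Symbols"
    "HOL-Probability.Probability"
begin

text \<open>
  Since \<^term>\<open>Arg 0 = 0\<close>, the point \<open>\<rho>\<close> itself is excluded when \<open>\<theta> > 0\<close>. For \<open>0 < \<theta> < pi / 2\<close>
  and \<open>\<epsilon> > 0\<close> the domain contains every other point of the closed disc of radius \<open>\<rho>\<close>.
\<close>
definition delta_domain :: "real \<Rightarrow> real \<Rightarrow> real \<Rightarrow> complex set" where
  "delta_domain \<rho> \<epsilon> \<theta> =
     {z. norm z < \<rho> + \<epsilon> \<and> \<bar>Arg (z - complex_of_real \<rho>)\<bar> > \<theta>}"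

text \<open>
  The series \<open>f\<close> has radius of convergence \<open>\<rho>\<close>, a single singularity (at \<open>\<rho>\<close>) on the closed disc
  of radius \<open>\<rho>\<close>, and the singular expansion
  \<open>f(z) = P(1 - z/\<rho>) + c (1 - z/\<rho>)^lam (1 + o(1))\<close> as \<open>z \<rightarrow> \<rho>\<close> in a delta-domain.
  The function \<open>\<phi>\<close> is the analytic continuation of \<open>f\<close>. That there is no singularity on the
  circle other than \<open>\<rho>\<close> is contained in the analyticity of \<open>\<phi>\<close> on the delta-domain, and
  \<open>\<rho>\<close> is then singular because \<open>\<rho>\<close> is the radius of convergence. The power is the
  principal branch: \<open>1 - z/\<rho>\<close> avoids the nonpositive real axis on the delta-domain.
\<close>
definition singular_expansion :: "real fps \<Rightarrow> real \<Rightarrow> real \<Rightarrow> real \<Rightarrow> bool" where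
  "singular_expansion f \<rho> c lam \<longleftrightarrow>
     0 < \<rho> \<and> fps_conv_radius f = ereal \<rho> \<and> c \<noteq> 0 \<and> lam \<notin> \<nat> \<and>
     (\<exists>\<epsilon> \<theta> (\<phi> :: complex \<Rightarrow> complex) (P :: complex poly).
        0 < \<epsilon> \<and> 0 < \<theta> \<and> \<theta> < pi / 2 \<and>
        \<phi> analytic_on delta_domain \<rho> \<epsilon> \<theta> \<and>
        (\<forall>z. norm z < \<rho> \<longrightarrow> (\<lambda>n. complex_of_real (fps_nth f n) * z ^ n) sums \<phi> z) \<and>
        (lam < 0 \<longrightarrow> P = 0) \<and>
        (0 < lam \<and> lam < 1 \<longrightarrow> degree P = 0) \<and>
        (1 < lam \<longrightarrow> 1 \<le> degree P \<and> int (degree P) \<le> \<lfloor>lam\<rfloor>) \<and>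
        (\<lambda>z. \<phi> z - poly P (1 - z / complex_of_real \<rho>))
          \<sim>[at (complex_of_real \<rho>) within delta_domain \<rho> \<epsilon> \<theta>]
        (\<lambda>z. complex_of_real c * (1 - z / complex_of_real \<rho>) powr complex_of_real lam))"

text \<open>
  The exponent of \<open>M\<close> is an extended real, so that it can be \<open>\<infinity>\<close> when \<open>M\<close> has a larger radius of
  convergence than \<open>H\<close>; the parameter \<open>c\<^sub>M\<close> is then unconstrained.
\<close>
definition extended_composition_scheme ::
    "real fps \<Rightarrow> real fps \<Rightarrow> real fps \<Rightarrow> real \<Rightarrow> real \<Rightarrow>
     real \<Rightarrow> real \<Rightarrow> real \<Rightarrow> real \<Rightarrow> real \<Rightarrow> ereal \<Rightarrow> bool" where
  "extended_composition_scheme G H M \<rho>\<^sub>G \<rho>\<^sub>H c\<^sub>G lam\<^sub>G c\<^sub>H lam\<^sub>H c\<^sub>M lam\<^sub>M \<longleftrightarrow>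
     (\<forall>n. 0 \<le> fps_nth G n) \<and> (\<forall>n. 0 \<le> fps_nth H n) \<and> (\<forall>n. 0 \<le> fps_nth M n) \<and>
     fps_nth H 0 = 0 \<and> M \<noteq> 0 \<and> 0 < fps_conv_radius M \<and>
     singular_expansion G \<rho>\<^sub>G c\<^sub>G lam\<^sub>G \<and>
     singular_expansion H \<rho>\<^sub>H c\<^sub>H lam\<^sub>H \<and>
     (fps_conv_radius M = ereal \<rho>\<^sub>H \<longrightarrow>
        (\<exists>l. lam\<^sub>M = ereal l \<and> singular_expansion M \<rho>\<^sub>H c\<^sub>M l)) \<and>
     (fps_conv_radius M > ereal \<rho>\<^sub>H \<longrightarrow> lam\<^sub>M = \<infinity>)"

definition critical_scheme :: "real fps \<Rightarrow> real fps \<Rightarrow> real \<Rightarrow> real \<Rightarrow> bool" where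
  "critical_scheme H M \<rho>\<^sub>G \<rho>\<^sub>H \<longleftrightarrow>
     eval_fps H \<rho>\<^sub>H = \<rho>\<^sub>G \<and> fps_conv_radius M \<ge> ereal \<rho>\<^sub>H"

definition degenerate_scheme :: "real \<Rightarrow> real \<Rightarrow> ereal \<Rightarrow> bool" where
  "degenerate_scheme lam\<^sub>G lam\<^sub>H lam\<^sub>M \<longleftrightarrow>
     1 < lam\<^sub>G \<or>
     (0 < lam\<^sub>G \<and> lam\<^sub>G < 1 \<and> lam\<^sub>M < min (ereal (lam\<^sub>G * lam\<^sub>H)) (ereal lam\<^sub>H))"

definition fps_lift_poly :: "real fps \<Rightarrow> real poly fps" where
  "fps_lift_poly f = Abs_fps (\<lambda>n. [:fps_nth f n:])"

text \<open>
  \<open>F(z,u) = G(u H(z)) M(z)\<close> as a power series in \<open>z\<close> whose coefficients are polynomials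
  in \<open>u\<close>, which is the case since \<open>H(0) = 0\<close>.
\<close>
definition composition_gf :: "real fps \<Rightarrow> real fps \<Rightarrow> real fps \<Rightarrow> real poly fps" where
  "composition_gf G H M =
     (fps_lift_poly G oo (fps_const [:0, 1:] * fps_lift_poly H)) * fps_lift_poly M"

definition core_size_prob :: "real fps \<Rightarrow> real fps \<Rightarrow> real fps \<Rightarrow> nat \<Rightarrow> nat \<Rightarrow> real" where
  "core_size_prob G H M n k =
     coeff (fps_nth (composition_gf G H M) n) k / poly (fps_nth (composition_gf G H M) n) 1"

definition boltzmann_pmf :: "real fps \<Rightarrow> real \<Rightarrow> nat pmf" where
  "boltzmann_pmf G x = embed_pmf (\<lambda>k. fps_nth G k * x ^ k / eval_fps G x)"

end

theory Submission
  imports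
    Defs
    "HOL-Complex_Analysis.Complex_Analysis"
    "HOL-Real_Asymp.Real_Asymp"
begin

text \<open>
  All singular exponents that matter are less than \<open>1\<close>, which allows a transfer theorem without
  Hankel contours: if \<open>g = o(|1 - z| powr a)\<close> on a slightly dented disc around the unit disc, then
  Cauchy's inequality gives \<open>g'' = o(|1 - z| powr (a - 2))\<close> inside the unit disc, and integrating
  \<open>g''\<close> over the circle of radius \<open>1 - 1/n\<close> shows that the coefficients are \<open>o(n powr (- a - 1))\<close>.

  The inner series has a negative constant \<open>c\<^sub>H\<close> and \<open>0 < \<lambda>\<^sub>H < 1\<close>, so close to its singularity it
  takes values in the half plane \<open>Re w < \<rho>\<^sub>G\<close>; elsewhere on the closed disc its modulus is less than
  \<open>\<rho>\<^sub>G\<close>. Hence \<open>G(H(z))\<close> is analytic on a dented disc, with expansion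
  \<open>G(\<rho>\<^sub>G) + G'(\<rho>\<^sub>G) c\<^sub>H (1 - z/\<rho>\<^sub>H) powr \<lambda>\<^sub>H\<close> if \<open>\<lambda>\<^sub>G > 1\<close> and error
  \<open>O(|1 - z/\<rho>\<^sub>H| powr (\<lambda>\<^sub>G \<lambda>\<^sub>H))\<close> if \<open>\<lambda>\<^sub>G < 1\<close>. Multiplying by \<open>M\<close> and comparing the leading singular
  terms of \<open>G(H) M\<close> and \<open>H ^ k M\<close> gives the limit laws.
\<close>

section \<open>Transfer of singular expansions to coefficients\<close>

text \<open>Two obstacles shape the argument. The integral of \<open>norm (1 - z) powr s\<close>
  over the circle of radius \<open>1 - 1/n\<close> is governed by the neighbourhood of 1 only if
  \<open>s < -1\<close>. Two derivatives move every exponent \<open>a < 1\<close> to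
  \<open>a - 2 < -1\<close>, and the factor \<open>n * (n - 1)\<close> gained in the coefficient
  pays for them. The other obstacle is that the outer function is only known on a delta-domain whose
  angle is merely below \<open>pi / 2\<close>, so the values of the inner one must be located. A
  power with exponent in \<open>(0,1)\<close> narrows angles: an opening slightly wider than a half
  plane becomes a sector narrower than one. Nonnegative coefficients and
  \<open>rGamma (- a) < 0\<close> force the sign of the constant that turns this sector to the
  correct side. Exponents below 1 also make polynomial parts collapse to constants, since a linear
  term is of smaller order than the singular one. The exception is the linear coefficient of the
  outer series for an exponent above 1: it becomes the derivative at the singularity, and through it
  the singular term of the inner series enters, which produces the size-biased law.\<close>

text \<open>
  A metric substitute for a delta-domain at \<open>1\<close>: it contains with each point \<open>z\<close> of the unit disc
  the ball of radius \<open>\<kappa> * norm (1 - z)\<close>, as needed for Cauchy's inequality.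
\<close>
definition dented_disc :: "real \<Rightarrow> complex set" where
  "dented_disc \<kappa> = (\<Union>z\<in>ball 0 1. ball z (\<kappa> * norm (1 - z)))"

lemma open_dented_disc [simp]: "open (dented_disc \<kappa>)"
  by (auto simp: dented_disc_def)

lemma dented_disc_mono: "\<kappa>' \<le> \<kappa> \<Longrightarrow> dented_disc \<kappa>' \<subseteq> dented_disc \<kappa>"
  unfolding dented_disc_def
  by (intro UN_mono order_refl subset_ball mult_right_mono) auto

lemma cball_in_dented_disc:
  assumes "norm z < 1" "0 < r" "r < \<kappa>"
  shows "cball z (r * norm (1 - z)) \<subseteq> dented_disc \<kappa>"
proof -
  have "1 - z \<noteq> 0" using assms by auto
  then have "cball z (r * norm (1 - z)) \<subseteq> ball z (\<kappa> * norm (1 - z))"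
    using assms by (intro subsetI) (auto intro: le_less_trans mult_strict_right_mono)
  then show ?thesis using assms by (force simp: dented_disc_def)
qed

text \<open>The centre \<open>t * z\<close> serves for \<open>t\<close> close to 1: as
  \<open>t\<close> tends to 1 from the left, its distance to \<open>z\<close> tends to 0, while the
  radius of its ball tends to \<open>\<kappa> * norm (1 - z)\<close>, which is positive.\<close>

lemma dented_disc_closed_disc:
  assumes "0 < \<kappa>" "norm z \<le> 1" "z \<noteq> 1"
  shows "z \<in> dented_disc \<kappa>"
proof -
  have "((\<lambda>t::real. \<kappa> * norm (1 - of_real t * z) - norm (z - of_real t * z)) \<longlongrightarrow>
         \<kappa> * norm (1 - of_real 1 * z) - norm (z - of_real 1 * z)) (at_left 1)"
    by (intro tendsto_intros)
  moreover have "0 < \<kappa> * norm (1 - of_real 1 * z) - norm (z - of_real 1 * z)"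
    using assms by simp
  ultimately have "eventually (\<lambda>t::real. 0 < \<kappa> * norm (1 - of_real t * z) - norm (z - of_real t * z)) (at_left 1)"
    by (rule order_tendstoD)
  moreover have "eventually (\<lambda>t::real. t \<in> {0<..<1}) (at_left 1)"
    by (rule eventually_at_leftI[of 0]) auto
  ultimately have "eventually (\<lambda>t::real. z \<in> dented_disc \<kappa>) (at_left 1)"
  proof eventually_elim
    case (elim t)
    have "norm (of_real t * z) < 1"
      using elim assms by (simp add: norm_mult mult_less_le_imp_less le_less_trans[OF mult_left_le])
    then show ?case
      using elim unfolding dented_disc_def
      by (intro UN_I[of "of_real t * z"]) (auto simp: dist_norm norm_minus_commute)
  qed
  then show ?thesis by simp
qed

lemma ball_subset_dented_disc: "0 < \<kappa> \<Longrightarrow> ball 0 1 \<subseteq> dented_disc \<kappa>"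
  by (auto intro!: dented_disc_closed_disc)

lemma one_notin_dented_disc: "\<kappa> \<le> 1 \<Longrightarrow> 1 \<notin> dented_disc \<kappa>"
proof
  assume "\<kappa> \<le> 1" "1 \<in> dented_disc \<kappa>"
  then obtain z :: complex where "norm (z - 1) < \<kappa> * norm (1 - z)"
    by (force simp: dented_disc_def dist_norm)
  also have "\<dots> \<le> 1 * norm (1 - z)" using \<open>\<kappa> \<le> 1\<close> by (intro mult_right_mono) auto
  finally show False by (simp add: norm_minus_commute)
qed

lemma dented_discE:
  assumes "w \<in> dented_disc \<kappa>"
  obtains z where "norm z < 1" "norm (w - z) < \<kappa> * norm (1 - z)"
  using assms by (auto simp: dented_disc_def dist_norm norm_minus_commute)

text \<open>The factor \<open>\<kappa> / (1 - \<kappa>)\<close> bounds the sine of the angle by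
  which the region at 1 exceeds a half plane, and it tends to 0 with \<open>\<kappa>\<close>. Every
  later choice of a small \<open>\<kappa>\<close> for the sake of an angle rests on this.\<close>

lemma Re_dented_disc:
  assumes "w \<in> dented_disc \<kappa>" "0 < \<kappa>" "\<kappa> < 1"
  shows "Re (w - 1) < \<kappa> / (1 - \<kappa>) * norm (1 - w)"
proof -
  obtain z where z: "norm z < 1" "norm (w - z) < \<kappa> * norm (1 - z)"
    by (rule dented_discE[OF assms(1)])
  have "norm (1 - z) \<le> norm (1 - w) + norm (w - z)"
    using norm_triangle_ineq[of "1 - w" "w - z"] by simp
  then have "(1 - \<kappa>) * norm (1 - z) \<le> norm (1 - w)" using z by (simp add: algebra_simps)
  then have *: "norm (1 - z) \<le> norm (1 - w) / (1 - \<kappa>)"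
    using assms by (simp add: field_simps)
  have "Re (w - 1) = Re (z - 1) + Re (w - z)" by simp
  also have "\<dots> < 0 + norm (w - z)"
    using z complex_Re_le_cmod[of z] complex_Re_le_cmod[of "w - z"] by (intro add_less_le_mono) auto
  also have "\<dots> \<le> \<kappa> * norm (1 - z)" using z by simp
  also have "\<dots> \<le> \<kappa> * (norm (1 - w) / (1 - \<kappa>))"
    using * assms by (intro mult_left_mono) auto
  finally show ?thesis by simp
qed

section \<open>Estimates on circles inside the unit disc\<close>

text \<open>Jordan's inequality: the concave function \<open>sin\<close> lies above its chord on
  \<open>[0, pi/2]\<close>.\<close>

lemma sin_ge_two_x_over_pi:
  assumes "0 \<le> x" "x \<le> (1/2::real)"
  shows "2 * x \<le> sin (pi * x)"
proof -
  have "convex_on {0..pi/2} (\<lambda>x. - sin x)"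
    by (rule f''_ge0_imp_convex[where f' = "\<lambda>x. - cos x" and f'' = sin])
       (auto intro!: derivative_eq_intros sin_ge_zero)
  from convex_onD[OF this, of "2 * x" 0 "pi/2"] assms show ?thesis
    by (simp add: algebra_simps)
qed

text \<open>The squared modulus is \<open>(1 - r)^2 + 4 r sin^2 (pi x)\<close>, and Jordan's
  inequality replaces the sine by the distance of \<open>x\<close> to the nearer end of
  \<open>[0,1]\<close>. This trades the singular factor on a circle for a function with an
  elementary antiderivative.\<close>

lemma norm_one_minus_circle_ge:
  assumes "1/2 \<le> r" "r < 1" "0 \<le> x" "x \<le> 1"
  shows "((1 - r) + min x (1 - x)) / 2 \<le> norm (1 - of_real r * exp (2 * of_real pi * \<i> * of_real x))"
proof -
  define m where "m = min x (1 - x)"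
  have sin_m: "2 * m \<le> sin (pi * x)"
  proof (cases "x \<le> 1/2")
    case True
    then show ?thesis using sin_ge_two_x_over_pi[of x] assms by (simp add: m_def)
  next
    case False
    have "sin (pi * (1 - x)) = sin (pi * x)" by (simp add: algebra_simps sin_diff)
    then show ?thesis using sin_ge_two_x_over_pi[of "1 - x"] False assms by (simp add: m_def)
  qed
  have m0: "0 \<le> m" using assms by (simp add: m_def)
  have e: "exp (2 * of_real pi * \<i> * of_real x) = cis (2 * (pi * x))"
    by (simp add: cis_conv_exp mult_ac)
  have "(norm (1 - of_real r * cis (2 * (pi * x))))\<^sup>2
          = (1 - r * cos (2 * (pi * x)))\<^sup>2 + (r * sin (2 * (pi * x)))\<^sup>2"
    by (simp add: cmod_power2)
  also have "\<dots> = 1 - 2 * r * cos (2 * (pi * x)) + r\<^sup>2 * ((sin (2 * (pi * x)))\<^sup>2 + (cos (2 * (pi * x)))\<^sup>2)"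
    by (simp only: power2_diff power_mult_distrib distrib_left) simp
  also have "\<dots> = (1 - r)\<^sup>2 + 4 * r * (sin (pi * x))\<^sup>2"
    by (subst sin_cos_squared_add, subst cos_double_sin) (simp add: power2_eq_square algebra_simps)
  also have "\<dots> \<ge> (1 - r)\<^sup>2 + 4 * (1/2) * (2 * m)\<^sup>2"
    using assms sin_m m0 by (intro add_left_mono mult_mono power_mono) auto
  finally have "(1 - r)\<^sup>2 + 8 * m\<^sup>2 \<le> (norm (1 - of_real r * cis (2 * (pi * x))))\<^sup>2"
    by simp
  moreover have "(((1 - r) + m) / 2)\<^sup>2 \<le> (1 - r)\<^sup>2 + 8 * m\<^sup>2"
  proof -
    have "((s + m) / 2)\<^sup>2 \<le> s\<^sup>2 + 8 * m\<^sup>2" for s :: real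
    proof -
      have "s\<^sup>2 + 8 * m\<^sup>2 - ((s + m) / 2)\<^sup>2 = ((s - m)\<^sup>2 + 2 * s\<^sup>2 + 30 * m\<^sup>2) / 4"
        by (simp add: power2_eq_square field_simps)
      also have "\<dots> \<ge> 0" by simp
      finally show ?thesis by simp
    qed
    then show ?thesis .
  qed
  ultimately have "((1 - r + m) / 2)\<^sup>2 \<le> (norm (1 - of_real r * cis (2 * (pi * x))))\<^sup>2"
    by (rule order_trans[rotated])
  then show ?thesis
    unfolding e m_def[symmetric] by (rule power2_le_imp_le) simp
qed

text \<open>Both ends of the parameter interval of a circle belong to the point nearest to 1, hence
  two terms. For \<open>a < -1\<close> the far end of each antiderivative has a favourable sign and
  is dropped; what remains has the order of a peak of height \<open>s powr a\<close> and width
  \<open>s\<close>.\<close>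

lemma integral_powr_bound:
  assumes "0 < s" "a < (-1::real)"
  shows "\<exists>I. ((\<lambda>x. (s + x) powr a + (s + (1 - x)) powr a) has_integral I) {0..1} \<and>
             I \<le> 2 * s powr (a + 1) / (- (a + 1))"
proof -
  have 1: "((\<lambda>x. (s + x) powr a) has_integral ((s + 1) powr (a + 1) / (a + 1) - (s + 0) powr (a + 1) / (a + 1))) {0..1}"
    using assms
    by (intro fundamental_theorem_of_calculus)
       (auto intro!: derivative_eq_intros simp flip: has_real_derivative_iff_has_vector_derivative)
  have 2: "((\<lambda>x. (s + (1 - x)) powr a) has_integral (- ((s + (1 - 1)) powr (a + 1) / (a + 1)) - (- ((s + (1 - 0)) powr (a + 1) / (a + 1))))) {0..1}"
    using assms
    by (intro fundamental_theorem_of_calculus)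
       (auto intro!: derivative_eq_intros simp flip: has_real_derivative_iff_has_vector_derivative)
  have "(s + 1) powr (a + 1) / (a + 1) \<le> 0" using assms by (simp add: divide_le_0_iff)
  then have "((s + 1) powr (a + 1) / (a + 1) - (s + 0) powr (a + 1) / (a + 1)) +
      (- ((s + (1 - 1)) powr (a + 1) / (a + 1)) - (- ((s + (1 - 0)) powr (a + 1) / (a + 1))))
      \<le> 2 * s powr (a + 1) / (- (a + 1))"
    unfolding divide_minus_right by simp
  with has_integral_add[OF 1 2] show ?thesis by blast
qed

text \<open>The maximum modulus on the circle would lose a factor of order \<open>n\<close>, because
  the integrands of interest are large only on an arc of length about \<open>1/n\<close>. So
  Cauchy's formula is used with a majorant \<open>b\<close> that depends on the parameter of the
  circle.\<close>

lemma Cauchy_coeff_bound_integral: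
  assumes f: "f holomorphic_on ball 0 1" and r: "0 < r" "r < 1"
    and b: "\<And>x. 0 \<le> x \<Longrightarrow> x \<le> 1 \<Longrightarrow> norm (f (of_real r * exp (2 * of_real pi * \<i> * of_real x))) \<le> b x"
    and I: "(b has_integral I) {0..1}"
  shows "norm ((deriv ^^ n) f 0) / fact n * r ^ n \<le> I"
proof -
  define J where "J = (2 * pi * \<i>) / fact n * (deriv ^^ n) f 0"
  have "((\<lambda>u. f u / (u - 0) ^ Suc n) has_contour_integral J) (circlepath 0 r)"
    unfolding J_def using r
    by (intro Cauchy_has_contour_integral_higher_derivative_circlepath)
       (auto intro!: holomorphic_on_imp_continuous_on holomorphic_on_subset[OF f])
  then have J: "((\<lambda>x. f (circlepath 0 r x) / (circlepath 0 r x - 0) ^ Suc n *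
        vector_derivative (circlepath 0 r) (at x)) has_integral J) {0..1}" (is "(?g has_integral _) _")
    by (simp add: has_contour_integral)
  have b2: "((\<lambda>x. 2 * pi / r ^ n * b x) has_integral (2 * pi / r ^ n * I)) {0..1}"
    by (rule has_integral_mult_right[OF I])
  have "norm (integral {0..1} ?g) \<le> integral {0..1} (\<lambda>x. 2 * pi / r ^ n * b x)"
  proof (rule integral_norm_bound_integral)
    fix x :: real assume x: "x \<in> {0..1}"
    define e where "e = exp (2 * of_real pi * \<i> * of_real x)"
    have [simp]: "norm e = 1" "e \<noteq> 0" unfolding e_def by (simp_all add: norm_exp_eq_Re)
    have "norm (?g x) = norm (f (of_real r * e)) * (2 * pi / r ^ n)"
      unfolding vector_derivative_circlepath e_def[symmetric]
      using r by (simp add: circlepath e_def[symmetric] norm_mult norm_divide norm_power)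
    also have "\<dots> \<le> b x * (2 * pi / r ^ n)"
      using b[of x] x r unfolding e_def by (intro mult_right_mono) auto
    finally show "norm (?g x) \<le> 2 * pi / r ^ n * b x" by (simp add: mult_ac)
  qed (use J b2 in auto)
  then have "norm J \<le> 2 * pi / r ^ n * I"
    unfolding integral_unique[OF J] integral_unique[OF b2] .
  moreover have "norm J = 2 * pi * (norm ((deriv ^^ n) f 0) / fact n)"
    by (simp add: J_def norm_mult norm_divide)
  ultimately show ?thesis using r by (simp add: field_simps)
qed

text \<open>On the circle around \<open>z\<close> of radius
  \<open>\<kappa> / 2 * norm (1 - z)\<close>, the distance to 1 stays within a factor 2 of
  \<open>norm (1 - z)\<close>. Powers of the two distances therefore agree up to
  \<open>2 powr \<bar>a\<bar>\<close>, whatever the sign of \<open>a\<close>, and Cauchy's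
  inequality costs two powers of the radius. The small factor \<open>e\<close> is passed on
  unchanged.\<close>

lemma deriv2_bound:
  fixes g :: "complex \<Rightarrow> complex"
  assumes \<kappa>: "0 < \<kappa>" "\<kappa> < 1" and g: "g holomorphic_on dented_disc \<kappa>"
    and z: "norm z < 1" and e: "0 \<le> e"
    and b: "\<And>w. w \<in> dented_disc \<kappa> \<Longrightarrow> norm (1 - w) < \<delta> \<Longrightarrow> norm (g w) \<le> e * norm (1 - w) powr a"
    and near: "norm (1 - z) < \<delta> / 2"
  shows "norm ((deriv ^^ 2) g z) \<le> e * (2 * 2 powr \<bar>a\<bar> / (\<kappa> / 2)\<^sup>2) * norm (1 - z) powr (a - 2)"
proof -
  define d where "d = norm (1 - z)"
  have d: "0 < d" using z by (auto simp: d_def)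
  have sub: "cball z (\<kappa> / 2 * d) \<subseteq> dented_disc \<kappa>"
    using cball_in_dented_disc[of z "\<kappa>/2" \<kappa>] \<kappa> z by (simp add: d_def)
  have "norm ((deriv ^^ 2) g z) \<le> fact 2 * (e * (2 powr \<bar>a\<bar> * d powr a)) / (\<kappa> / 2 * d) ^ 2"
  proof (rule Cauchy_inequality)
    show "g holomorphic_on ball z (\<kappa> / 2 * d)"
      by (rule holomorphic_on_subset[OF g]) (use sub ball_subset_cball in blast)
    show "continuous_on (cball z (\<kappa> / 2 * d)) g"
      by (rule holomorphic_on_imp_continuous_on[OF holomorphic_on_subset[OF g sub]])
    show "0 < \<kappa> / 2 * d" using \<kappa> d by simp
    fix w assume w: "norm (z - w) = \<kappa> / 2 * d"
    have wd: "norm (z - w) \<le> d / 2"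
      unfolding w using mult_right_mono[of "\<kappa>/2" "1/2" d] \<kappa> d by simp
    have up: "norm (1 - w) \<le> 2 * d"
      using norm_triangle_ineq[of "1 - z" "z - w"] wd d by (simp flip: d_def)
    have lo: "d / 2 \<le> norm (1 - w)"
      using norm_triangle_ineq[of "1 - w" "w - z"] wd by (simp add: d_def norm_minus_commute)
    have "norm (1 - w) < \<delta>" using up near by (simp add: d_def)
    moreover have "w \<in> dented_disc \<kappa>" using sub w by (auto simp: dist_norm)
    ultimately have "norm (g w) \<le> e * norm (1 - w) powr a" by (rule b[rotated])
    also have "norm (1 - w) powr a \<le> 2 powr \<bar>a\<bar> * d powr a"
    proof (cases "0 \<le> a")
      case True
      then have "norm (1 - w) powr a \<le> (2 * d) powr a" using up by (intro powr_mono2) auto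
      then show ?thesis using True d by (simp add: powr_mult)
    next
      case False
      then have "norm (1 - w) powr a \<le> (d / 2) powr a"
        using lo d by (intro powr_mono2') auto
      then show ?thesis using False d by (simp add: powr_divide powr_minus field_simps)
    qed
    finally show "norm (g w) \<le> e * (2 powr \<bar>a\<bar> * d powr a)"
      using e by (simp add: mult_left_mono)
  qed
  also have "\<dots> = e * (2 * 2 powr \<bar>a\<bar> / (\<kappa> / 2)\<^sup>2) * (d powr a / d ^ 2)"
    using d \<kappa> by (simp add: power_mult_distrib power_divide)
  also have "d powr a / d ^ 2 = d powr (a - 2)"
    using d by (simp add: powr_diff powr_numeral)
  finally show ?thesis by (simp add: d_def)
qed

text \<open>Removing a ball around 1 from the closed unit disc leaves a compact subset of the dented
  disc, on which the second derivative is continuous.\<close>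

lemma deriv2_bound_away:
  fixes g :: "complex \<Rightarrow> complex"
  assumes \<kappa>: "0 < \<kappa>" "\<kappa> < 1" and g: "g holomorphic_on dented_disc \<kappa>" and "0 < \<delta>"
  shows "\<exists>B. \<forall>z. norm z \<le> 1 \<longrightarrow> \<delta> \<le> norm (1 - z) \<longrightarrow> norm ((deriv ^^ 2) g z) \<le> B"
proof -
  define K :: "complex set" where "K = cball 0 1 - ball 1 \<delta>"
  have "K \<subseteq> dented_disc \<kappa>"
    using \<kappa> \<open>0 < \<delta>\<close> by (auto simp: K_def intro!: dented_disc_closed_disc)
  moreover have "(deriv ^^ 2) g holomorphic_on dented_disc \<kappa>"
    by (intro holomorphic_higher_deriv g open_dented_disc)
  ultimately have "continuous_on K ((deriv ^^ 2) g)"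
    using holomorphic_on_imp_continuous_on holomorphic_on_subset by blast
  moreover have "compact K" unfolding K_def by (intro compact_diff compact_cball open_ball)
  ultimately have "bounded ((deriv ^^ 2) g ` K)"
    using compact_continuous_image compact_imp_bounded by blast
  then obtain B where "\<And>z. z \<in> K \<Longrightarrow> norm ((deriv ^^ 2) g z) \<le> B"
    unfolding bounded_iff by auto
  then show ?thesis by (intro exI[of _ B]) (auto simp: K_def dist_norm)
qed

text \<open>The coefficient of index \<open>n\<close> of \<open>g\<close> is that of index
  \<open>n - 2\<close> of the second derivative, divided by \<open>n * (n - 1)\<close>. For each
  \<open>e\<close> the second derivative is at most \<open>e\<close> times the singular power plus a
  constant. Integration gives \<open>n powr (1 - a)\<close> for the power, which outgrows the
  constant because \<open>a < 1\<close>.\<close>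

lemma coeff_smallo:
  fixes g :: "complex \<Rightarrow> complex"
  assumes \<kappa>: "0 < \<kappa>" "\<kappa> < 1" and g: "g holomorphic_on dented_disc \<kappa>" and a: "a < 1"
    and o: "g \<in> o[at 1 within dented_disc \<kappa>](\<lambda>z. (1 - z) powr of_real a)"
  shows "(\<lambda>n. (deriv ^^ n) g 0 / fact n * of_real (real n powr (a + 1))) \<longlonglongrightarrow> 0"
proof -
  define C where "C = 2 * 2 powr \<bar>a\<bar> / (\<kappa> / 2)\<^sup>2"
  have C: "0 < C" using \<kappa> by (simp add: C_def)
  \<comment> \<open>\<open>C\<close> comes from Cauchy's inequality, \<open>2 powr (2 - a)\<close>
    from the halved lower bound for the distance to 1 on the circle, and \<open>2 / (1 - a)\<close>
    from the integral.\<close>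
  define C2 where "C2 = C * 2 powr (2 - a) * 2 / (1 - a)"
  have C2: "0 < C2" using C a by (simp add: C2_def)
  \<comment> \<open>\<open>B\<close> may depend on \<open>e\<close> but not on \<open>n\<close>. The
    16 is the reciprocal of a lower bound for \<open>r ^ (n - 2)\<close>.\<close>
  have key: "\<exists>B. \<forall>n\<ge>4. norm ((deriv ^^ n) g 0) / fact n * (real n * (real n - 1)) / 16
        \<le> e * C2 * real n powr (1 - a) + B" if "0 < e" for e
  proof -
    from landau_o.smallD[OF o \<open>0 < e\<close>]
    obtain \<delta> where \<delta>: "0 < \<delta>" and
      b: "\<And>w. w \<in> dented_disc \<kappa> \<Longrightarrow> w \<noteq> 1 \<Longrightarrow> dist w 1 < \<delta> \<Longrightarrow> norm (g w) \<le> e * norm ((1 - w) powr of_real a)"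
      unfolding eventually_at by auto
    have b': "norm (g w) \<le> e * norm (1 - w) powr a" if "w \<in> dented_disc \<kappa>" "norm (1 - w) < \<delta>" for w
      using b[of w] that one_notin_dented_disc[of \<kappa>] \<kappa>
      by (auto simp: dist_norm norm_minus_commute norm_powr_real_powr')
    obtain B0 where B0: "\<And>z. norm z \<le> 1 \<Longrightarrow> \<delta> / 2 \<le> norm (1 - z) \<Longrightarrow> norm ((deriv ^^ 2) g z) \<le> B0"
      using deriv2_bound_away[OF \<kappa> g, of "\<delta> / 2"] \<delta> by auto
    define B where "B = max 0 B0"
    have bound: "norm ((deriv ^^ 2) g z) \<le> e * C * norm (1 - z) powr (a - 2) + B" if "norm z < 1" for z
    proof (cases "norm (1 - z) < \<delta> / 2")
      case True
      have "norm ((deriv ^^ 2) g z) \<le> e * C * norm (1 - z) powr (a - 2)"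
        unfolding C_def
        by (rule deriv2_bound[OF \<kappa> g that _ b' True]) (use \<open>0 < e\<close> in auto)
      then show ?thesis by (simp add: B_def add_increasing2)
    next
      case False
      then have "norm ((deriv ^^ 2) g z) \<le> B" using B0[of z] that by (simp add: B_def)
      moreover have "0 \<le> e * C * norm (1 - z) powr (a - 2)" using \<open>0 < e\<close> C by simp
      ultimately show ?thesis by linarith
    qed
    have "norm ((deriv ^^ n) g 0) / fact n * (real n * (real n - 1)) / 16
        \<le> e * C2 * real n powr (1 - a) + B" if n: "4 \<le> n" for n
    proof -
      define r where "r = 1 - 1 / real n"
      have r: "1/2 \<le> r" "0 < r" "r < 1" using n by (auto simp: r_def field_simps)
      have s: "1 - r = 1 / real n" by (simp add: r_def)
      define bb where "bb x = e * C * 2 powr (2 - a) * (((1 - r) + x) powr (a - 2) + ((1 - r) + (1 - x)) powr (a - 2)) + B" for x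
      obtain I where I: "((\<lambda>x. ((1 - r) + x) powr (a - 2) + ((1 - r) + (1 - x)) powr (a - 2)) has_integral I) {0..1}"
        "I \<le> 2 * (1 - r) powr (a - 2 + 1) / (- (a - 2 + 1))"
        using integral_powr_bound[of "1 - r" "a - 2"] r a by auto
      have "(bb has_integral (e * C * 2 powr (2 - a) * I + B)) {0..1}"
        unfolding bb_def using has_integral_const_real[of B 0 1]
        by (intro has_integral_add has_integral_mult_right I) auto
      moreover have "norm ((deriv ^^ 2) g (of_real r * exp (2 * of_real pi * \<i> * of_real x))) \<le> bb x"
        if x: "0 \<le> x" "x \<le> 1" for x
      proof -
        define w where "w = of_real r * exp (2 * of_real pi * \<i> * of_real x)"
        have w: "norm w < 1" using r by (simp add: w_def norm_mult norm_exp_eq_Re)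
        define m where "m = min x (1 - x)"
        have m: "0 \<le> m" using x by (simp add: m_def)
        have "((1 - r) + m) / 2 \<le> norm (1 - w)"
          using norm_one_minus_circle_ge[of r x] r x by (simp add: w_def m_def)
        then have "norm (1 - w) powr (a - 2) \<le> (((1 - r) + m) / 2) powr (a - 2)"
          using r m a by (intro powr_mono2') auto
        also have "\<dots> = 2 powr (2 - a) * ((1 - r) + m) powr (a - 2)"
          using r m by (simp add: powr_divide powr_diff field_simps)
        also have "((1 - r) + m) powr (a - 2) \<le> ((1 - r) + x) powr (a - 2) + ((1 - r) + (1 - x)) powr (a - 2)"
          by (auto simp: m_def min_def)
        finally have "norm (1 - w) powr (a - 2) \<le> 2 powr (2 - a) * (((1 - r) + x) powr (a - 2) + ((1 - r) + (1 - x)) powr (a - 2))"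
          by simp
        then have "e * C * norm (1 - w) powr (a - 2) \<le> e * C * (2 powr (2 - a) * (((1 - r) + x) powr (a - 2) + ((1 - r) + (1 - x)) powr (a - 2)))"
          using \<open>0 < e\<close> C by (intro mult_left_mono) auto
        with bound[OF w] show ?thesis unfolding w_def[symmetric] bb_def by (simp add: mult_ac)
      qed
      moreover have "(deriv ^^ 2) g holomorphic_on ball 0 1"
        by (rule holomorphic_on_subset[OF holomorphic_higher_deriv[OF g open_dented_disc]])
           (use ball_subset_dented_disc \<kappa> in auto)
      ultimately have *: "norm ((deriv ^^ (n - 2)) ((deriv ^^ 2) g) 0) / fact (n - 2) * r ^ (n - 2)
          \<le> e * C * 2 powr (2 - a) * I + B"
        using r by (intro Cauchy_coeff_bound_integral[where b = bb]) auto
      have "(deriv ^^ (n - 2 + 2)) g = (deriv ^^ (n - 2)) ((deriv ^^ 2) g)"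
        unfolding funpow_add by simp
      moreover have "n - 2 + 2 = n" using n by simp
      ultimately have "(deriv ^^ (n - 2)) ((deriv ^^ 2) g) = (deriv ^^ n) g"
        by (simp only:)
      moreover have "fact n = real n * (real n - 1) * fact (n - 2)"
      proof -
        obtain m where "n = Suc (Suc m)" by (rule that[of "n - 2"]) (use n in simp)
        then show ?thesis by (simp add: algebra_simps)
      qed
      ultimately have eq: "norm ((deriv ^^ (n - 2)) ((deriv ^^ 2) g) 0) / fact (n - 2)
          = norm ((deriv ^^ n) g 0) / fact n * (real n * (real n - 1))"
        using n by (simp only:) simp
      \<comment> \<open>For \<open>y \<le> 1/2\<close>, \<open>ln (1 - y)\<close> is at least
        \<open>- y - 2 y^2\<close> and hence at least \<open>- 2 y\<close>. With
        \<open>y = 1/n\<close> this gives \<open>r ^ n \<ge> exp (- 2) \<ge> 1/9\<close>.\<close>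
      have "1/16 \<le> r ^ (n - 2)"
      proof -
        define y where "y = 1 / real n"
        have y: "0 \<le> y" "y \<le> 1/2" "r = 1 - y" using n by (auto simp: y_def r_def)
        have "y\<^sup>2 \<le> y * (1/2)" unfolding power2_eq_square using y by (intro mult_left_mono)
        then have "- (2 * y) \<le> ln r"
          using ln_one_minus_pos_lower_bound[of y] y by simp
        then have "- (2 / real n) \<le> ln r" by (simp add: y_def)
        then have "real n * - (2 / real n) \<le> real n * ln r" by (rule mult_left_mono) simp
        then have "exp (- 2) \<le> exp (real n * ln r)" using n by simp
        also have "\<dots> = r ^ n" using r by (simp add: exp_of_nat_mult)
        also have "\<dots> \<le> r ^ (n - 2)" using r by (intro power_decreasing) auto
        finally have "exp (- 2) \<le> r ^ (n - 2)" .
        moreover have "exp 1 * exp (1::real) \<le> 3 * 3" using exp_le by (intro mult_mono) auto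
        then have "exp (2::real) \<le> 9" by (simp flip: exp_add)
        then have "1 / 16 \<le> exp (- 2 :: real)" by (simp add: exp_minus field_simps)
        ultimately show ?thesis by simp
      qed
      then have "norm ((deriv ^^ n) g 0) / fact n * (real n * (real n - 1)) * (1/16)
         \<le> norm ((deriv ^^ n) g 0) / fact n * (real n * (real n - 1)) * r ^ (n - 2)"
        using n by (intro mult_left_mono) auto
      also have "\<dots> \<le> e * C * 2 powr (2 - a) * I + B" using * unfolding eq .
      also have "\<dots> \<le> e * C * 2 powr (2 - a) * (2 * (1 - r) powr (a - 2 + 1) / (- (a - 2 + 1))) + B"
        using I(2) \<open>0 < e\<close> C by (intro add_right_mono mult_left_mono) auto
      also have "\<dots> = e * C2 * (1 / real n) powr (a - 1) + B"
        using a by (simp add: C2_def s)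
      also have "(1 / real n) powr (a - 1) = real n powr (1 - a)"
        using n by (simp add: powr_divide powr_diff field_simps)
      finally show ?thesis by simp
    qed
    then show ?thesis by blast
  qed
  show ?thesis
  proof (rule LIMSEQ_I)
    fix e0 :: real assume "0 < e0"
    \<comment> \<open>Passing from \<open>n * (n - 1)\<close> to \<open>n^2\<close> costs a factor
      2, so the constant in front of \<open>e * C2\<close> becomes 32, and this choice makes the
      main term \<open>e0 / 2\<close>.\<close>
    define e where "e = e0 / (64 * C2)"
    have "0 < e" using \<open>0 < e0\<close> C2 by (simp add: e_def)
    from key[OF this] obtain B where B: "\<And>n. 4 \<le> n \<Longrightarrow> norm ((deriv ^^ n) g 0) / fact n * (real n * (real n - 1)) / 16
        \<le> e * C2 * real n powr (1 - a) + B" by blast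
    have "(\<lambda>n. 32 * B * real n powr (a - 1)) \<longlonglongrightarrow> 0"
      using a by real_asymp
    then have "eventually (\<lambda>n. 32 * B * real n powr (a - 1) < e0 / 2) sequentially"
      using \<open>0 < e0\<close> by (intro order_tendstoD) auto
    then have "eventually (\<lambda>n. norm ((deriv ^^ n) g 0 / fact n * of_real (real n powr (a + 1)) - 0) < e0) sequentially"
      using eventually_ge_at_top[of 4]
    proof eventually_elim
      case (elim n)
      define N where "N = norm ((deriv ^^ n) g 0) / fact n"
      have N: "0 \<le> N" by (simp add: N_def)
      have n: "4 \<le> real n" using elim by simp
      have pos: "0 < real n powr (a - 1)" using n by simp
      have "N * (real n ^ 2 / 2) \<le> N * (real n * (real n - 1))"
        using mult_right_mono[OF n, of "real n"] N by (intro mult_left_mono) (auto simp: power2_eq_square algebra_simps)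
      also have "\<dots> \<le> 16 * (e * C2 * real n powr (1 - a) + B)" using B[of n] elim by (simp add: N_def)
      finally have "N * real n ^ 2 \<le> 32 * e * C2 * real n powr (1 - a) + 32 * B" by simp
      then have "N * real n ^ 2 * real n powr (a - 1) \<le> (32 * e * C2 * real n powr (1 - a) + 32 * B) * real n powr (a - 1)"
        using pos by (intro mult_right_mono) auto
      also have "\<dots> = 32 * e * C2 * (real n powr (1 - a) * real n powr (a - 1)) + 32 * B * real n powr (a - 1)"
        by (simp add: algebra_simps)
      also have "real n powr (1 - a) * real n powr (a - 1) = 1" using n by (simp flip: powr_add)
      also have "32 * e * C2 * 1 = e0 / 2" using C2 by (simp add: e_def)
      finally have "N * (real n ^ 2 * real n powr (a - 1)) < e0" using elim by simp
      also have "real n ^ 2 * real n powr (a - 1) = real n powr (a + 1)"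
      proof -
        have "real n ^ 2 = real n powr 2" using n by simp
        then show ?thesis by (simp only: powr_add[symmetric]) (simp add: add_ac)
      qed
      finally show ?case by (simp add: N_def norm_mult norm_divide)
    qed
    then show "\<exists>no. \<forall>n\<ge>no. norm ((deriv ^^ n) g 0 / fact n * of_real (real n powr (a + 1)) - 0) < e0"
      by (simp add: eventually_sequentially)
  qed
qed

text \<open>
  \<open>f(z) = C + A (1 - z)^a + o((1 - z)^a)\<close>. The bound \<open>\<kappa> \<le> 1/2\<close> keeps \<open>1 - z\<close> off the branch cut.
\<close>
definition sing_exp :: "real \<Rightarrow> (complex \<Rightarrow> complex) \<Rightarrow> complex \<Rightarrow> complex \<Rightarrow> real \<Rightarrow> bool" where
  "sing_exp \<kappa> f C A a \<longleftrightarrow> 0 < \<kappa> \<and> \<kappa> \<le> 1/2 \<and> f holomorphic_on dented_disc \<kappa> \<and>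
     (\<lambda>z. f z - C - A * (1 - z) powr of_real a)
       \<in> o[at 1 within dented_disc \<kappa>](\<lambda>z. (1 - z) powr of_real a)"

lemma one_minus_notin_nonpos_Reals:
  assumes "w \<in> dented_disc \<kappa>" "0 < \<kappa>" "\<kappa> \<le> 1/2"
  shows "1 - w \<notin> \<real>\<^sub>\<le>\<^sub>0"
proof
  assume "1 - w \<in> \<real>\<^sub>\<le>\<^sub>0"
  then have "norm (1 - w) = Re (w - 1)"
    by (auto simp: complex_nonpos_Reals_iff complex_eq_iff cmod_def)
  also have "\<dots> < \<kappa> / (1 - \<kappa>) * norm (1 - w)"
    using assms by (intro Re_dented_disc) auto
  also have "\<dots> \<le> 1 * norm (1 - w)"
    using assms by (intro mult_right_mono) (auto simp: field_simps)
  finally show False by simp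
qed

lemma holomorphic_on_powr_dented_disc:
  assumes "0 < \<kappa>" "\<kappa> \<le> 1/2"
  shows "(\<lambda>z. (1 - z) powr c) holomorphic_on dented_disc \<kappa>"
  using one_minus_notin_nonpos_Reals[OF _ assms] by (intro holomorphic_intros) auto

text \<open>The constant \<open>C\<close> affects only the coefficient of index 0, and the
  coefficients of \<open>(1 - z) powr a\<close> are signed binomial coefficients with known
  asymptotics. What remains is of smaller order and falls under \<open>coeff_smallo\<close>.\<close>

lemma transfer_sing_exp:
  assumes f: "sing_exp \<kappa> f C A a" and a: "a < 1"
    and c: "\<And>z. norm z < 1 \<Longrightarrow> (\<lambda>n. c n * z ^ n) sums f z"
  shows "(\<lambda>n. c n * of_real (real n powr (a + 1))) \<longlonglongrightarrow> A * rGamma (- of_real a)"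
proof -
  have \<kappa>: "0 < \<kappa>" "\<kappa> \<le> 1/2" and holf: "f holomorphic_on dented_disc \<kappa>"
    and o: "(\<lambda>z. f z - C - A * (1 - z) powr of_real a) \<in> o[at 1 within dented_disc \<kappa>](\<lambda>z. (1 - z) powr of_real a)"
    using f by (auto simp: sing_exp_def)
  define g where "g z = f z - C - A * (1 - z) powr of_real a" for z
  define b where "b n = c n - (if n = 0 then C else 0) - A * ((of_real a gchoose n) * (-1) ^ n)" for n
  have "(\<lambda>n. (deriv ^^ n) g 0 / fact n * of_real (real n powr (a + 1))) \<longlonglongrightarrow> 0"
  proof (rule coeff_smallo)
    show "g holomorphic_on dented_disc \<kappa>" unfolding g_def
      by (intro holomorphic_on_diff holomorphic_on_mult holomorphic_on_const holf
          holomorphic_on_powr_dented_disc \<kappa>)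
    show "g \<in> o[at 1 within dented_disc \<kappa>](\<lambda>z. (1 - z) powr of_real a)"
      using o unfolding g_def .
  qed (use \<kappa> a in auto)
  moreover have "g has_fps_expansion Abs_fps b"
  proof (rule has_fps_expansionI)
    have "eventually (\<lambda>z::complex. z \<in> ball 0 1) (nhds 0)" by (intro eventually_nhds_in_open) auto
    then show "\<forall>\<^sub>F u in nhds 0. (\<lambda>n. fps_nth (Abs_fps b) n * u ^ n) sums g u"
    proof eventually_elim
      case (elim z)
      then have z: "norm z < 1" by simp
      have 1: "(\<lambda>n. (if n = 0 then C else 0) * z ^ n) sums C"
      proof -
        have "(\<lambda>n. (if n = 0 then C else 0) * z ^ n) = (\<lambda>n. if n = 0 then C * z ^ n else 0)" by auto
        then show ?thesis using sums_single[of 0 "\<lambda>n. C * z ^ n"] by simp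
      qed
      have "(\<lambda>n. (of_real a gchoose n) * (- z) ^ n) sums (1 + (- z)) powr of_real a"
        using z by (intro gen_binomial_complex) auto
      then have 2: "(\<lambda>n. (of_real a gchoose n) * (-1) ^ n * z ^ n) sums (1 - z) powr of_real a"
        by (simp add: power_minus[of z] mult.assoc)
      show ?case
        using sums_diff[OF sums_diff[OF c[OF z] 1] sums_mult[OF 2, of A]]
        by (simp add: g_def b_def algebra_simps)
    qed
  qed
  ultimately have "(\<lambda>n. b n * of_real (real n powr (a + 1))) \<longlonglongrightarrow> 0"
    using fps_nth_fps_expansion[of g "Abs_fps b"] by simp
  moreover have "(\<lambda>n. A * ((of_real a gchoose n) / ((-1) ^ n / exp ((of_real a + 1) * of_real (ln (real n)))))) \<longlonglongrightarrow>
      A * inverse (Gamma (- of_real a))"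
    by (intro tendsto_intros gbinomial_asymptotic)
  ultimately have *: "(\<lambda>n. b n * of_real (real n powr (a + 1)) + A * ((of_real a gchoose n) / ((-1) ^ n / exp ((of_real a + 1) * of_real (ln (real n))))))
      \<longlonglongrightarrow> 0 + A * inverse (Gamma (- of_real a))"
    by (rule tendsto_add)
  \<comment> \<open>Index 0 is left out, since the constant \<open>C\<close> enters \<open>b\<close>
    there.\<close>
  have "eventually (\<lambda>n. b n * of_real (real n powr (a + 1)) + A * ((of_real a gchoose n) / ((-1) ^ n / exp ((of_real a + 1) * of_real (ln (real n)))))
      = c n * of_real (real n powr (a + 1))) sequentially"
    using eventually_gt_at_top[of 0]
  proof eventually_elim
    case (elim n)
    have "exp ((of_real a + 1) * of_real (ln (real n))) = complex_of_real (real n powr (a + 1))"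
      using elim by (simp add: powr_def exp_of_real[symmetric] mult.commute)
    moreover have "y / ((-1) ^ n / E) = y * (-1) ^ n * E" for y E :: complex
      by (cases "even n") auto
    ultimately show ?case using elim
      by (simp add: b_def ring_distribs mult.assoc)
  qed
  from Lim_transform_eventually[OF * this] show ?thesis
    by (simp add: rGamma_inverse_Gamma)
qed

section \<open>Calculus of singular expansions at 1\<close>

abbreviation one_filter :: "real \<Rightarrow> complex filter" where
  "one_filter \<kappa> \<equiv> at 1 within dented_disc \<kappa>"

lemma eventually_neq_one: "eventually (\<lambda>z. z \<noteq> 1) (one_filter \<kappa>)"
  by (simp add: eventually_at_filter)

lemma eventually_in_dented_disc: "eventually (\<lambda>z. z \<in> dented_disc \<kappa>) (one_filter \<kappa>)"
  by (simp add: eventually_at_filter)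

lemma tendsto_one_minus_powr_0:
  assumes "0 < b"
  shows "((\<lambda>z. (1 - z) powr of_real b) \<longlongrightarrow> 0) (at (1::complex) within S)"
proof -
  have "((\<lambda>z::complex. norm (1 - z)) \<longlongrightarrow> norm (1 - 1 :: complex)) (at 1 within S)"
    by (intro tendsto_intros)
  then have "((\<lambda>z::complex. norm (1 - z) powr b) \<longlongrightarrow> 0) (at 1 within S)"
    using assms by (intro tendsto_zero_powrI[where b = b]) auto
  then show ?thesis
    by (subst tendsto_norm_zero_iff[symmetric]) (simp add: norm_powr_real_powr')
qed

lemma one_minus_powr_smallo:
  assumes "b < a"
  shows "(\<lambda>z. (1 - z) powr of_real a) \<in> o[one_filter \<kappa>](\<lambda>z. (1 - z) powr of_real b)"
proof (rule smalloI_tendsto)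
  have "((\<lambda>z. (1 - z) powr of_real (a - b)) \<longlongrightarrow> 0) (one_filter \<kappa>)"
    using assms by (intro tendsto_one_minus_powr_0) auto
  moreover have "eventually (\<lambda>z. (1 - z) powr of_real (a - b) = (1 - z) powr of_real a / (1 - z) powr of_real b) (one_filter \<kappa>)"
    using eventually_neq_one by eventually_elim (simp add: powr_diff)
  ultimately show "((\<lambda>z. (1 - z) powr of_real a / (1 - z) powr of_real b) \<longlongrightarrow> 0) (one_filter \<kappa>)"
    by (rule Lim_transform_eventually)
  show "eventually (\<lambda>z. (1 - z) powr of_real b \<noteq> 0) (one_filter \<kappa>)"
    using eventually_neq_one by eventually_elim auto
qed

lemma one_minus_powr_smallo_1:
  assumes "0 < a"
  shows "(\<lambda>z. (1 - z) powr of_real a) \<in> o[one_filter \<kappa>](\<lambda>z. 1)"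
  using tendsto_one_minus_powr_0[OF assms] by (intro smalloI_tendsto) auto

lemma one_filter_mono: "\<kappa>' \<le> \<kappa> \<Longrightarrow> one_filter \<kappa>' \<le> one_filter \<kappa>"
  by (intro at_le dented_disc_mono)

lemma sing_exp_mono:
  assumes "sing_exp \<kappa> f C A a" "0 < \<kappa>'" "\<kappa>' \<le> \<kappa>"
  shows "sing_exp \<kappa>' f C A a"
  unfolding sing_exp_def
proof (intro conjI)
  show "f holomorphic_on dented_disc \<kappa>'"
    using assms(1) dented_disc_mono[OF assms(3)]
    by (auto simp: sing_exp_def intro: holomorphic_on_subset)
  show "(\<lambda>z. f z - C - A * (1 - z) powr of_real a) \<in> o[one_filter \<kappa>'](\<lambda>z. (1 - z) powr of_real a)"
    using assms(1) by (intro landau_o.small.filter_mono[OF one_filter_mono[OF assms(3)]]) (simp only: sing_exp_def)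
qed (use assms in \<open>auto simp: sing_exp_def\<close>)

text \<open>A weaker singularity is absorbed into the error at a smaller exponent, with singular
  coefficient 0. This brings factors with different exponents to a common one.\<close>

lemma sing_exp_weaken:
  assumes "sing_exp \<kappa> f C A a" "b < a"
  shows "sing_exp \<kappa> f C 0 b"
proof -
  note o = one_minus_powr_smallo[OF assms(2), of \<kappa>]
  have 1: "(\<lambda>z. f z - C - A * (1 - z) powr of_real a) \<in> o[one_filter \<kappa>](\<lambda>z. (1 - z) powr of_real b)"
    by (rule landau_o.small_trans[OF _ o]) (use assms in \<open>simp add: sing_exp_def\<close>)
  have 2: "(\<lambda>z. A * (1 - z) powr of_real a) \<in> o[one_filter \<kappa>](\<lambda>z. (1 - z) powr of_real b)"
    using o by simp
  have "(\<lambda>z. f z - C) \<in> o[one_filter \<kappa>](\<lambda>z. (1 - z) powr of_real b)"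
    using sum_in_smallo(1)[OF 1 2] by simp
  then show ?thesis using assms by (simp add: sing_exp_def)
qed

lemma sing_exp_diff_bigo:
  assumes "sing_exp \<kappa> f C A a"
  shows "(\<lambda>z. f z - C) \<in> O[one_filter \<kappa>](\<lambda>z. (1 - z) powr of_real a)"
proof -
  have 1: "(\<lambda>z. f z - C - A * (1 - z) powr of_real a) \<in> O[one_filter \<kappa>](\<lambda>z. (1 - z) powr of_real a)"
    using assms by (intro landau_o.small_imp_big) (simp add: sing_exp_def)
  have 2: "(\<lambda>z. A * (1 - z) powr of_real a) \<in> O[one_filter \<kappa>](\<lambda>z. (1 - z) powr of_real a)"
    by simp
  show ?thesis using sum_in_bigo(1)[OF 1 2] by simp
qed

lemma sing_exp_tendsto:
  assumes "sing_exp \<kappa> f C A a" "0 < a"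
  shows "(f \<longlongrightarrow> C) (one_filter \<kappa>)"
proof -
  have "(\<lambda>z. f z - C) \<in> o[one_filter \<kappa>](\<lambda>z. 1)"
    by (rule landau_o.big_small_trans[OF sing_exp_diff_bigo[OF assms(1)] one_minus_powr_smallo_1[OF assms(2)]])
  then have "((\<lambda>z. f z - C) \<longlongrightarrow> 0) (one_filter \<kappa>)"
    by (auto dest!: smalloD_tendsto)
  then show ?thesis by (simp add: LIM_zero_iff)
qed

text \<open>The singular coefficients obey the product rule: since \<open>a > 0\<close>, the cross
  term \<open>(f z - C) * (g z - D)\<close> is a bounded multiple of the power times something that
  tends to 0.\<close>

lemma sing_exp_mult:
  assumes f: "sing_exp \<kappa> f C A a" and g: "sing_exp \<kappa> g D B a" and "0 < a"
  shows "sing_exp \<kappa> (\<lambda>z. f z * g z) (C * D) (C * B + D * A) a"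
proof -
  let ?P = "\<lambda>z. (1 - z) powr of_real a"
  define r where "r z = f z - C - A * ?P z" for z
  define s where "s z = g z - D - B * ?P z" for z
  have rs: "r \<in> o[one_filter \<kappa>](?P)" "s \<in> o[one_filter \<kappa>](?P)"
    using f g by (simp_all add: sing_exp_def r_def[abs_def] s_def[abs_def])
  have "(\<lambda>z. g z - D) \<in> o[one_filter \<kappa>](\<lambda>z. 1)"
    by (rule landau_o.big_small_trans[OF sing_exp_diff_bigo[OF g] one_minus_powr_smallo_1[OF assms(3)]])
  with sing_exp_diff_bigo[OF f] have "(\<lambda>z. (f z - C) * (g z - D)) \<in> o[one_filter \<kappa>](\<lambda>z. ?P z * 1)"
    by (rule landau_o.big_small_mult)
  then have "(\<lambda>z. (C * s z + D * r z) + (f z - C) * (g z - D)) \<in> o[one_filter \<kappa>](?P)"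
    using rs by (intro sum_in_smallo(1)) auto
  moreover have "(\<lambda>z. (C * s z + D * r z) + (f z - C) * (g z - D)) =
      (\<lambda>z. f z * g z - C * D - (C * B + D * A) * ?P z)"
    by (simp add: r_def s_def algebra_simps)
  ultimately show ?thesis
    using f g holomorphic_on_mult[of f "dented_disc \<kappa>" g] by (simp only: sing_exp_def)
qed

text \<open>This serves negative exponents, where \<open>g\<close> may be unbounded near 1. The
  constant term of \<open>g\<close> is 0, so a mere limit of \<open>f\<close> suffices.\<close>

lemma sing_exp_mult_tendsto:
  assumes f: "f holomorphic_on dented_disc \<kappa>" "(f \<longlongrightarrow> l) (one_filter \<kappa>)"
    and g: "sing_exp \<kappa> g 0 A a"
  shows "sing_exp \<kappa> (\<lambda>z. f z * g z) 0 (l * A) a"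
proof -
  let ?P = "\<lambda>z. (1 - z) powr of_real a"
  have s: "(\<lambda>z. g z - A * ?P z) \<in> o[one_filter \<kappa>](?P)"
    using g by (simp add: sing_exp_def)
  have "(\<lambda>z. f z - l) \<in> o[one_filter \<kappa>](\<lambda>z. 1)"
    using f(2) by (intro smalloI_tendsto) (auto simp: LIM_zero_iff)
  then have "(\<lambda>z. (f z - l) * g z) \<in> o[one_filter \<kappa>](\<lambda>z. 1 * ?P z)"
    using sing_exp_diff_bigo[OF g] by (intro landau_o.small_big_mult) auto
  then have "(\<lambda>z. (f z - l) * g z + l * (g z - A * ?P z)) \<in> o[one_filter \<kappa>](?P)"
    using s by (intro sum_in_smallo(1)) auto
  moreover have "(\<lambda>z. (f z - l) * g z + l * (g z - A * ?P z)) = (\<lambda>z. f z * g z - 0 - (l * A) * ?P z)"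
    by (simp add: algebra_simps)
  ultimately show ?thesis
    using f g holomorphic_on_mult[of f "dented_disc \<kappa>" g] by (simp only: sing_exp_def)
qed

section \<open>From delta-domains to dented discs\<close>

lemma abs_Arg_gt:
  assumes "v \<noteq> 0" "0 \<le> \<theta>" "\<theta> \<le> pi" "Re v < cos \<theta> * norm v"
  shows "\<theta> < \<bar>Arg v\<bar>"
proof (rule ccontr)
  assume "\<not> \<theta> < \<bar>Arg v\<bar>"
  then have "cos \<theta> \<le> cos \<bar>Arg v\<bar>"
    using assms by (intro cos_monotone_0_pi_le) auto
  then have "cos \<theta> * norm v \<le> cos (Arg v) * norm v"
    by (intro mult_right_mono) auto
  also have "\<dots> = Re v"
    using arg_cong[OF rcis_cmod_Arg[of v], of Re] by (simp add: mult.commute)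
  finally show False using assms by simp
qed

lemma half_plane_in_delta_domain:
  assumes "Re w < \<rho>" "norm w < \<rho> + \<epsilon>" "0 < \<theta>" "\<theta> < pi / 2"
  shows "w \<in> delta_domain \<rho> \<epsilon> \<theta>"
proof -
  have "Re (w - of_real \<rho>) < 0" using assms by simp
  also have "0 \<le> cos \<theta> * norm (w - of_real \<rho>)"
    using assms by (simp add: cos_ge_zero)
  finally have "\<theta> < \<bar>Arg (w - of_real \<rho>)\<bar>"
    using assms by (intro abs_Arg_gt) auto
  then show ?thesis using assms by (simp add: delta_domain_def)
qed

lemma dented_disc_in_delta_domain:
  assumes "0 < \<rho>" "0 < \<epsilon>" "0 < \<theta>" "\<theta> < pi / 2"
  shows "\<exists>\<kappa>. 0 < \<kappa> \<and> \<kappa> \<le> 1/2 \<and> (\<forall>w\<in>dented_disc \<kappa>. of_real \<rho> * w \<in> delta_domain \<rho> \<epsilon> \<theta>)"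
proof -
  have c: "0 < cos \<theta>" using assms by (intro cos_gt_zero) auto
  \<comment> \<open>Points of the dented disc have modulus below \<open>1 + 2 * \<kappa>\<close>, as
    \<open>norm (1 - z) \<le> 2\<close> for the centres; the second bound keeps this below
    \<open>1 + \<epsilon> / \<rho>\<close>. The third gives \<open>\<kappa> / (1 - \<kappa>) \<le> 2
    * \<kappa> \<le> cos \<theta>\<close>, the angular condition.\<close>
  define \<kappa> where "\<kappa> = min (1/2) (min (\<epsilon> / (2 * \<rho>)) (cos \<theta> / 2))"
  have \<kappa>: "0 < \<kappa>" "\<kappa> \<le> 1/2" "\<kappa> \<le> \<epsilon> / (2 * \<rho>)" "\<kappa> \<le> cos \<theta> / 2"
    using assms c by (auto simp: \<kappa>_def)
  have "of_real \<rho> * w \<in> delta_domain \<rho> \<epsilon> \<theta>" if w: "w \<in> dented_disc \<kappa>" for w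
  proof -
    obtain z where z: "norm z < 1" "norm (w - z) < \<kappa> * norm (1 - z)"
      by (rule dented_discE[OF w])
    have "norm (1 - z) \<le> 2" using norm_triangle_ineq4[of 1 z] z by simp
    then have "norm (w - z) < \<kappa> * 2" using z \<kappa> by (intro less_le_trans[OF z(2)] mult_left_mono) auto
    then have "norm w < 1 + 2 * \<kappa>" using norm_triangle_ineq[of z "w - z"] z by simp
    also have "\<dots> \<le> 1 + \<epsilon> / \<rho>" using \<kappa> by simp
    finally have "norm (of_real \<rho> * w) < \<rho> + \<epsilon>"
      using assms by (simp add: norm_mult field_simps)
    moreover have "\<theta> < \<bar>Arg (of_real \<rho> * w - of_real \<rho>)\<bar>"
    proof (rule abs_Arg_gt)
      have eq: "of_real \<rho> * w - of_real \<rho> = of_real \<rho> * (w - 1)" by (simp add: algebra_simps)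
      have w1: "w \<noteq> 1" using w one_notin_dented_disc[of \<kappa>] \<kappa> by auto
      then show "of_real \<rho> * w - of_real \<rho> \<noteq> 0" unfolding eq using assms by simp
      have "Re (w - 1) < \<kappa> / (1 - \<kappa>) * norm (1 - w)"
        using w \<kappa> by (intro Re_dented_disc) auto
      also have "\<kappa> / (1 - \<kappa>) \<le> \<kappa> / (1/2)" using \<kappa> by (intro divide_left_mono) auto
      then have "\<kappa> / (1 - \<kappa>) * norm (1 - w) \<le> cos \<theta> * norm (1 - w)"
        using \<kappa> by (intro mult_right_mono) auto
      finally have "\<rho> * Re (w - 1) < \<rho> * (cos \<theta> * norm (1 - w))"
        using assms by (intro mult_strict_left_mono)
      then show "Re (of_real \<rho> * w - of_real \<rho>) < cos \<theta> * norm (of_real \<rho> * w - of_real \<rho>)"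
        unfolding eq norm_mult using assms by (simp add: norm_minus_commute[of w] mult.left_commute)
    qed (use assms in auto)
    ultimately show ?thesis by (simp add: delta_domain_def)
  qed
  with \<kappa> show ?thesis by blast
qed

definition disc_sums :: "(nat \<Rightarrow> real) \<Rightarrow> (complex \<Rightarrow> complex) \<Rightarrow> bool" where
  "disc_sums c \<psi> \<longleftrightarrow> (\<forall>z. norm z < 1 \<longrightarrow> (\<lambda>n. complex_of_real (c n) * z ^ n) sums \<psi> z)"

text \<open>The substitution \<open>z = \<rho> * w\<close> moves the singularity to 1. The
  asymptotic equivalence is put into additive form because additive errors can be summed and
  multiplied.\<close>

lemma singular_expansion_dented_disc:
  assumes "singular_expansion f \<rho> c lam"
  obtains \<kappa> \<psi> P where "0 < \<kappa>" "\<kappa> \<le> 1/2" "\<psi> holomorphic_on dented_disc \<kappa>"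
    "disc_sums (\<lambda>n. fps_nth f n * \<rho> ^ n) \<psi>"
    "lam < 0 \<longrightarrow> P = 0" "0 < lam \<and> lam < 1 \<longrightarrow> degree P = 0"
    "(\<lambda>z. \<psi> z - poly P (1 - z) - of_real c * (1 - z) powr of_real lam)
       \<in> o[one_filter \<kappa>](\<lambda>z. (1 - z) powr of_real lam)"
proof -
  from assms obtain \<epsilon> \<theta> \<phi> P where \<rho>: "0 < \<rho>" and *: "0 < \<epsilon>" "0 < \<theta>" "\<theta> < pi / 2"
    "\<phi> analytic_on delta_domain \<rho> \<epsilon> \<theta>"
    "\<And>z. norm z < \<rho> \<Longrightarrow> (\<lambda>n. complex_of_real (fps_nth f n) * z ^ n) sums \<phi> z"
    "lam < 0 \<longrightarrow> P = 0" "0 < lam \<and> lam < 1 \<longrightarrow> degree P = 0"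
    and as: "(\<lambda>z. \<phi> z - poly P (1 - z / complex_of_real \<rho>))
          \<sim>[at (complex_of_real \<rho>) within delta_domain \<rho> \<epsilon> \<theta>]
        (\<lambda>z. complex_of_real c * (1 - z / complex_of_real \<rho>) powr complex_of_real lam)"
    unfolding singular_expansion_def by auto
  obtain \<kappa> where \<kappa>: "0 < \<kappa>" "\<kappa> \<le> 1/2" and sub: "\<And>w. w \<in> dented_disc \<kappa> \<Longrightarrow> of_real \<rho> * w \<in> delta_domain \<rho> \<epsilon> \<theta>"
    using dented_disc_in_delta_domain[OF \<rho> *(1-3)] by blast
  have lim: "filterlim (\<lambda>z. of_real \<rho> * z) (at (complex_of_real \<rho>) within delta_domain \<rho> \<epsilon> \<theta>) (one_filter \<kappa>)"
    unfolding filterlim_at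
  proof
    have "eventually (\<lambda>z. z \<in> dented_disc \<kappa> \<and> z \<noteq> 1) (one_filter \<kappa>)"
      using eventually_neq_one eventually_in_dented_disc by eventually_elim auto
    then show "\<forall>\<^sub>F x in one_filter \<kappa>. of_real \<rho> * x \<in> delta_domain \<rho> \<epsilon> \<theta> \<and> of_real \<rho> * x \<noteq> of_real \<rho>"
      by eventually_elim (use sub \<rho> in auto)
    show "((\<lambda>z. of_real \<rho> * z) \<longlongrightarrow> of_real \<rho>) (one_filter \<kappa>)"
      by (rule tendsto_eq_intros refl | simp)+
  qed
  from asymp_equiv_imp_diff_smallo[OF asymp_equiv_compose'[OF as lim]]
  have "(\<lambda>z. \<phi> (of_real \<rho> * z) - poly P (1 - z) - of_real c * (1 - z) powr of_real lam)
       \<in> o[one_filter \<kappa>](\<lambda>z. of_real c * (1 - z) powr of_real lam)"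
    using \<rho> by simp
  also have "o[one_filter \<kappa>](\<lambda>z. of_real c * (1 - z) powr of_real lam) = o[one_filter \<kappa>](\<lambda>z. (1 - z) powr of_real lam)"
    using assms by (intro landau_o.small.cmult) (auto simp: singular_expansion_def)
  finally have o: "(\<lambda>z. \<phi> (of_real \<rho> * z) - poly P (1 - z) - of_real c * (1 - z) powr of_real lam)
       \<in> o[one_filter \<kappa>](\<lambda>z. (1 - z) powr of_real lam)" .
  have "(\<lambda>z. \<phi> (of_real \<rho> * z)) analytic_on dented_disc \<kappa>"
    by (rule analytic_on_compose[unfolded o_def, where g = \<phi>])
       (auto intro!: analytic_intros analytic_on_subset[OF *(4)] sub)
  then have hol: "(\<lambda>z. \<phi> (of_real \<rho> * z)) holomorphic_on dented_disc \<kappa>"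
    by (rule analytic_imp_holomorphic)
  have sums: "(\<lambda>n. complex_of_real (fps_nth f n * \<rho> ^ n) * z ^ n) sums \<phi> (of_real \<rho> * z)" if "norm z < 1" for z
    using *(5)[of "of_real \<rho> * z"] \<rho> that by (simp add: norm_mult power_mult_distrib mult.assoc)
  show thesis
    by (rule that[OF \<kappa> hol _ *(6,7) o]) (use sums in \<open>simp add: disc_sums_def\<close>)
qed

text \<open>At a point of differentiability increments are \<open>O(1 - z)\<close>, hence of smaller
  order than \<open>(1 - z) powr a\<close> for \<open>a < 1\<close>. This is why polynomials and
  analytic functions contribute only their value at 1.\<close>

lemma differentiable_diff_smallo:
  fixes f :: "complex \<Rightarrow> complex"
  assumes "f field_differentiable at 1" "a < 1"
  shows "(\<lambda>z. f z - f 1) \<in> o[one_filter \<kappa>](\<lambda>z. (1 - z) powr of_real a)"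
proof -
  obtain D where "(f has_field_derivative D) (at 1)"
    using assms by (auto simp: field_differentiable_def)
  then have "((\<lambda>z. (f z - f 1) / (z - 1)) \<longlongrightarrow> D) (one_filter \<kappa>)"
    unfolding has_field_derivative_iff by (rule filterlim_mono) (auto intro: at_le)
  then have "(\<lambda>z. f z - f 1) \<in> O[one_filter \<kappa>](\<lambda>z. z - 1)"
    by (rule bigoI_tendsto) (use eventually_neq_one in \<open>eventually_elim, auto\<close>)
  also have "(\<lambda>z. z - 1) \<in> O[one_filter \<kappa>](\<lambda>z. (1 - z) powr of_real 1)"
    by (rule landau_o.bigI[of 1], simp, use eventually_neq_one in eventually_elim)
       (simp add: norm_powr_real_powr' norm_minus_commute)
  also have "(\<lambda>z. (1 - z) powr of_real 1) \<in> o[one_filter \<kappa>](\<lambda>z. (1 - z) powr of_real a)"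
    by (rule one_minus_powr_smallo) fact
  finally show ?thesis .
qed

lemma sing_exp_singular_expansion:
  assumes "singular_expansion f \<rho> c lam" "lam < 1"
  obtains \<kappa> \<psi> C where "sing_exp \<kappa> \<psi> C (of_real c) lam" "lam < 0 \<longrightarrow> C = 0"
    "disc_sums (\<lambda>n. fps_nth f n * \<rho> ^ n) \<psi>"
proof -
  obtain \<kappa> \<psi> P where *: "0 < \<kappa>" "\<kappa> \<le> 1/2" "\<psi> holomorphic_on dented_disc \<kappa>"
    "disc_sums (\<lambda>n. fps_nth f n * \<rho> ^ n) \<psi>"
    "lam < 0 \<longrightarrow> P = 0" "0 < lam \<and> lam < 1 \<longrightarrow> degree P = 0"
    "(\<lambda>z. \<psi> z - poly P (1 - z) - of_real c * (1 - z) powr of_real lam)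
       \<in> o[one_filter \<kappa>](\<lambda>z. (1 - z) powr of_real lam)"
    by (rule singular_expansion_dented_disc[OF assms(1)])
  have "lam \<noteq> 0" using assms(1) by (auto simp: singular_expansion_def)
  then have "degree P = 0" using *(5,6) assms(2) by (cases "lam < 0") auto
  then obtain d where d: "P = [:d:]" by (rule degree_eq_zeroE)
  show thesis
  proof (rule that[of \<kappa> \<psi> d])
    show "sing_exp \<kappa> \<psi> d (of_real c) lam"
      using *(1-3,7) unfolding sing_exp_def d by simp
    show "lam < 0 \<longrightarrow> d = 0" using *(5) d by simp
  qed (rule *(4))
qed

lemma sing_exp_singular_expansion_gt_1:
  assumes "singular_expansion f \<rho> c lam" "1 < lam" "a < 1"
  obtains \<kappa> \<psi> C where "sing_exp \<kappa> \<psi> C 0 a"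
    "disc_sums (\<lambda>n. fps_nth f n * \<rho> ^ n) \<psi>"
proof -
  obtain \<kappa> \<psi> P where *: "0 < \<kappa>" "\<kappa> \<le> 1/2" "\<psi> holomorphic_on dented_disc \<kappa>"
    "disc_sums (\<lambda>n. fps_nth f n * \<rho> ^ n) \<psi>"
    "lam < 0 \<longrightarrow> P = 0" "0 < lam \<and> lam < 1 \<longrightarrow> degree P = 0"
    "(\<lambda>z. \<psi> z - poly P (1 - z) - of_real c * (1 - z) powr of_real lam)
       \<in> o[one_filter \<kappa>](\<lambda>z. (1 - z) powr of_real lam)"
    by (rule singular_expansion_dented_disc[OF assms(1)])
  let ?P = "\<lambda>a z. (1 - z) powr complex_of_real a"
  have la: "?P lam \<in> o[one_filter \<kappa>](?P a)"
    using assms by (intro one_minus_powr_smallo) auto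
  have 1: "(\<lambda>z. \<psi> z - poly P (1 - z) - of_real c * ?P lam z) \<in> o[one_filter \<kappa>](?P a)"
    by (rule landau_o.small_trans[OF *(7) la])
  have 2: "(\<lambda>z. of_real c * ?P lam z) \<in> o[one_filter \<kappa>](?P a)"
    using la by simp
  have 3: "(\<lambda>z. poly P (1 - z) - poly P (1 - 1)) \<in> o[one_filter \<kappa>](?P a)"
    by (rule differentiable_diff_smallo[where f = "\<lambda>z. poly P (1 - z)", OF _ assms(3)])
       (auto simp: field_differentiable_def intro!: exI derivative_eq_intros poly_DERIV[THEN DERIV_chain2])
  have "(\<lambda>z. \<psi> z - poly P 0) \<in> o[one_filter \<kappa>](?P a)"
    using sum_in_smallo(1)[OF sum_in_smallo(1)[OF 1 2] 3] by simp
  with *(1-3) have "sing_exp \<kappa> \<psi> (poly P 0) 0 a"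
    unfolding sing_exp_def by simp
  then show thesis using *(4) by (rule that)
qed

text \<open>Here \<open>\<rho>\<close> is a regular point, so the expansion at any exponent below 1
  consists of the value there and has no singular term.\<close>

lemma sing_exp_conv_radius_gt:
  assumes "ereal \<rho> < fps_conv_radius f" "0 < \<rho>" "a < 1"
  obtains \<kappa> \<psi> C where "sing_exp \<kappa> \<psi> C 0 a"
    "disc_sums (\<lambda>n. fps_nth f n * \<rho> ^ n) \<psi>"
proof -
  define F where "F = Abs_fps (\<lambda>n. complex_of_real (fps_nth f n))"
  have "fps_conv_radius F = conv_radius (\<lambda>n. norm (fps_nth F n))"
    by (simp add: fps_conv_radius_def)
  also have "\<dots> = conv_radius (\<lambda>n. norm (fps_nth f n))" by (simp add: F_def)
  also have "\<dots> = fps_conv_radius f" unfolding conv_radius_norm by (simp add: fps_conv_radius_def)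
  finally have rad: "fps_conv_radius F = fps_conv_radius f" .
  obtain R where R: "\<rho> < R" "ereal R < fps_conv_radius f"
    using ereal_dense2[OF assms(1)] by auto
  define \<psi> where "\<psi> z = eval_fps F (of_real \<rho> * z)" for z
  have hol: "\<psi> holomorphic_on ball 0 (R / \<rho>)"
  proof -
    have "eval_fps F holomorphic_on ball 0 R"
      using ball_eball_mono[OF less_imp_le[OF R(2)], of 0]
      by (intro holomorphic_on_eval_fps) (simp add: rad)
    moreover have "(\<lambda>z::complex. of_real \<rho> * z) ` ball 0 (R / \<rho>) \<subseteq> ball 0 R"
      using assms by (auto simp: norm_mult pos_less_divide_eq mult.commute)
    ultimately have "(eval_fps F \<circ> (\<lambda>z. of_real \<rho> * z)) holomorphic_on ball 0 (R / \<rho>)"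
      by (intro holomorphic_on_compose_gen) (auto intro!: holomorphic_intros)
    then show ?thesis by (simp add: o_def \<psi>_def[abs_def])
  qed
  \<comment> \<open>Chosen such that \<open>1 + 2 * \<kappa> \<le> R / \<rho>\<close>, since the
    dented disc lies in the ball of radius \<open>1 + 2 * \<kappa>\<close>.\<close>
  define \<kappa> where "\<kappa> = min (1/2) ((R / \<rho> - 1) / 2)"
  have \<kappa>: "0 < \<kappa>" "\<kappa> \<le> 1/2" unfolding \<kappa>_def using R assms by (simp, intro min.cobounded1)
  have sub: "dented_disc \<kappa> \<subseteq> ball 0 (R / \<rho>)"
  proof
    fix w assume w: "w \<in> dented_disc \<kappa>"
    obtain z where z: "norm z < 1" "norm (w - z) < \<kappa> * norm (1 - z)"
      by (rule dented_discE[OF w])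
    have "norm (1 - z) \<le> 2" using norm_triangle_ineq4[of 1 z] z by simp
    then have "norm (w - z) < \<kappa> * 2" using z \<kappa> by (intro less_le_trans[OF z(2)] mult_left_mono) auto
    then have "norm w < 1 + 2 * \<kappa>" using norm_triangle_ineq[of z "w - z"] z by simp
    also have "\<kappa> \<le> (R / \<rho> - 1) / 2" unfolding \<kappa>_def by (rule min.cobounded2)
    also have "1 + 2 * ((R / \<rho> - 1) / 2) = R / \<rho>" by (simp add: diff_divide_distrib)
    finally show "w \<in> ball 0 (R / \<rho>)" by simp
  qed
  have "\<psi> field_differentiable at 1"
    by (rule holomorphic_on_imp_differentiable_at[OF hol]) (use R assms in auto)
  from differentiable_diff_smallo[OF this assms(3), of \<kappa>]
  have "sing_exp \<kappa> \<psi> (\<psi> 1) 0 a"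
    using \<kappa> holomorphic_on_subset[OF hol sub] by (simp add: sing_exp_def)
  moreover have "(\<lambda>n. complex_of_real (fps_nth f n * \<rho> ^ n) * z ^ n) sums \<psi> z" if "norm z < 1" for z
  proof -
    have "ereal (norm (of_real \<rho> * z)) < ereal \<rho>"
      using assms that by (simp add: norm_mult)
    also note assms(1)
    finally show ?thesis
      using sums_eval_fps[of "of_real \<rho> * z" F] rad
      by (simp add: \<psi>_def F_def power_mult_distrib mult.assoc)
  qed
  ultimately show thesis by (intro that) (auto simp: disc_sums_def)
qed

section \<open>Boundary values of series with nonnegative coefficients\<close>

text \<open>Finite partial sums pass to the limit and are bounded by \<open>L\<close>, so
  \<open>b\<close> is summable; conversely every \<open>S x\<close> is at most the sum of
  \<open>b\<close>. Convergence at the boundary is thus a conclusion. It is needed both for a series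
  at its singularity and for the differentiated series.\<close>

lemma sums_monotone_limit:
  fixes a :: "real \<Rightarrow> nat \<Rightarrow> real"
  assumes bounds: "\<And>x n. 0 < x \<Longrightarrow> x < 1 \<Longrightarrow> 0 \<le> a x n \<and> a x n \<le> b n"
    and lim: "\<And>n. ((\<lambda>x. a x n) \<longlongrightarrow> b n) (at_left 1)"
    and S: "\<And>x. 0 < x \<Longrightarrow> x < 1 \<Longrightarrow> a x sums S x" "(S \<longlongrightarrow> L) (at_left 1)"
  shows "b sums L"
proof -
  have ev: "eventually (\<lambda>x::real. x \<in> {0<..<1}) (at_left 1)"
    by (rule eventually_at_leftI[of 0]) auto
  have b0: "0 \<le> b n" for n using bounds[of "1/2" n] by simp
  have le: "sum b {..<N} \<le> L" for N
  proof (rule tendsto_le[OF _ S(2)])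
    show "((\<lambda>x. sum (a x) {..<N}) \<longlongrightarrow> sum b {..<N}) (at_left 1)"
      by (intro tendsto_intros lim)
    show "eventually (\<lambda>x. sum (a x) {..<N} \<le> S x) (at_left 1)"
      using ev
    proof eventually_elim
      case (elim x)
      then show ?case using sum_le_suminf[of "a x" "{..<N}"] S(1)[of x] bounds[of x]
        by (auto simp: sums_iff)
    qed
  qed auto
  have sb: "summable b" by (rule summableI_nonneg_bounded[OF b0 le])
  have "L \<le> suminf b"
  proof (rule tendsto_upperbound[OF S(2)])
    show "eventually (\<lambda>x. S x \<le> suminf b) (at_left 1)"
      using ev
    proof eventually_elim
      case (elim x)
      then show ?case using bounds[of x]
        by (intro sums_le[OF _ S(1) summable_sums[OF sb]]) auto
    qed
  qed auto
  moreover have "suminf b \<le> L" by (rule suminf_le_const[OF sb le])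
  ultimately show ?thesis using sb by (simp add: sums_iff)
qed

lemma filterlim_of_real_one_filter:
  assumes "0 < \<kappa>"
  shows "filterlim complex_of_real (one_filter \<kappa>) (at_left 1)"
  unfolding filterlim_at
proof
  have "eventually (\<lambda>x::real. x \<in> {0<..<1}) (at_left 1)"
    by (rule eventually_at_leftI[of 0]) auto
  then show "\<forall>\<^sub>F x in at_left 1. complex_of_real x \<in> dented_disc \<kappa> \<and> complex_of_real x \<noteq> 1"
    by eventually_elim (use assms in \<open>auto intro!: dented_disc_closed_disc\<close>)
  have "((\<lambda>x. complex_of_real x) \<longlongrightarrow> complex_of_real 1) (at_left 1)"
    by (intro tendsto_intros)
  then show "((\<lambda>x. complex_of_real x) \<longlongrightarrow> 1) (at_left 1)" by simp
qed

lemma eventually_at_left_1_unit: "eventually (\<lambda>x::real. 0 < x \<and> x < 1) (at_left 1)"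
  using eventually_at_leftI[of 0 1 "\<lambda>x::real. 0 < x \<and> x < 1"] by auto

lemma tendsto_real_valued:
  fixes f :: "real \<Rightarrow> complex"
  assumes "(f \<longlongrightarrow> C) (at_left 1)" "\<And>x. 0 < x \<Longrightarrow> x < 1 \<Longrightarrow> Im (f x) = 0"
  shows "C = of_real (Re C)"
proof -
  have "((\<lambda>x. Im (f x)) \<longlongrightarrow> Im C) (at_left 1)"
    by (intro tendsto_intros assms)
  moreover have "eventually (\<lambda>x. Im (f x) = 0) (at_left 1)"
    using eventually_at_left_1_unit by eventually_elim (use assms in auto)
  ultimately have "((\<lambda>x::real. 0) \<longlongrightarrow> Im C) (at_left 1)"
    by (rule Lim_transform_eventually)
  then have "Im C = 0" by (simp add: tendsto_const_iff)
  then show "C = of_real (Re C)" by (simp add: complex_eq_iff)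
qed

lemma disc_sums_of_real:
  assumes "disc_sums c f" "0 < x" "x < 1"
  shows "(\<lambda>n. complex_of_real (c n * x ^ n)) sums f (of_real x)"
  using assms by (auto simp: disc_sums_def dest: spec[of _ "complex_of_real x"])

text \<open>This identifies the constant of a singular expansion, which is only known as a complex
  number, with the value of the series at its singularity.\<close>

lemma disc_sums_limit:
  assumes c: "\<And>n. 0 \<le> c n" "disc_sums c f"
    and lim: "((\<lambda>x. f (of_real x)) \<longlongrightarrow> C) (at_left 1)"
  shows "c sums Re C" "C = of_real (Re C)"
proof -
  have S: "(\<lambda>n. c n * x ^ n) sums Re (f (of_real x))" "Im (f (of_real x)) = 0" if "0 < x" "x < 1" for x
    using sums_Re[OF disc_sums_of_real[OF c(2) that]] sums_Im[OF disc_sums_of_real[OF c(2) that]]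
    by (auto simp: sums_iff)
  show "c sums Re C"
  proof (rule sums_monotone_limit[where a = "\<lambda>x n. c n * x ^ n"])
    show "0 \<le> c n * x ^ n \<and> c n * x ^ n \<le> c n" if "0 < x" "x < 1" for x n
      using that c(1)[of n] by (auto intro!: mult_left_le power_le_one)
    show "((\<lambda>x. c n * x ^ n) \<longlongrightarrow> c n) (at_left 1)" for n
      by (rule tendsto_eq_intros refl | simp)+
    show "((\<lambda>x. Re (f (of_real x))) \<longlongrightarrow> Re C) (at_left 1)"
      by (intro tendsto_intros lim)
  qed (use S in auto)
  show "C = of_real (Re C)"
    by (rule tendsto_real_valued[OF lim S(2)])
qed

lemma sing_exp_sums:
  assumes f: "sing_exp \<kappa> f C A a" "0 < a" and c: "\<And>n. 0 \<le> c n" "disc_sums c f"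
  shows "c sums Re C" "C = of_real (Re C)"
proof -
  have "0 < \<kappa>" using f by (simp add: sing_exp_def)
  then have lim: "((\<lambda>x. f (of_real x)) \<longlongrightarrow> C) (at_left 1)"
    by (intro filterlim_compose[OF sing_exp_tendsto[OF f] filterlim_of_real_one_filter])
  from disc_sums_limit[OF c lim] show "c sums Re C" "C = of_real (Re C)" by auto
qed

section \<open>Range of the inner series\<close>

text \<open>
  Equality would force \<open>z ^ n\<close> to be the same number \<open>u\<close> for all \<open>n\<close> in the support of \<open>c\<close>. Then
  \<open>\<psi> (z x) = u \<psi> x\<close>, so the singularity at \<open>1\<close> would also appear at \<open>z\<close>, where \<open>\<psi>\<close> is analytic.
\<close>
lemma norm_lt_sum_coeffs:
  assumes f: "sing_exp \<kappa> \<psi> C A a" and a: "0 < a" "a < 1" and A: "A \<noteq> 0"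
    and c: "\<And>n. 0 \<le> c n" "disc_sums c \<psi>"
    and z: "norm z \<le> 1" "z \<noteq> 1"
  shows "norm (\<psi> z) < Re C"
proof (rule ccontr)
  assume "\<not> norm (\<psi> z) < Re C"
  then have ge: "Re C \<le> norm (\<psi> z)" by simp
  have \<kappa>: "0 < \<kappa>" and hol: "\<psi> holomorphic_on dented_disc \<kappa>" using f by (auto simp: sing_exp_def)
  have cs: "c sums Re C" using sing_exp_sums[OF f a(1) c] by simp
  \<comment> \<open>The direction of \<open>\<psi> z\<close>, so that
    \<open>cnj u * \<psi> z\<close> is its modulus; if \<open>\<psi> z = 0\<close>, any number of
    modulus 1 does.\<close>
  define u where "u = (if \<psi> z = 0 then 1 else sgn (\<psi> z))"
  have u: "norm u = 1" by (simp add: u_def norm_sgn)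
  have uz: "Re (cnj u * \<psi> z) = norm (\<psi> z)"
  proof (cases "\<psi> z = 0")
    case False
    have "cnj (sgn (\<psi> z)) * \<psi> z = of_real (norm (\<psi> z))"
      using False complex_norm_square[of "\<psi> z"] by (simp add: sgn_eq power2_eq_square field_simps)
    then show ?thesis using False by (simp add: u_def)
  qed simp
  have diff: "\<psi> field_differentiable at z"
    by (rule holomorphic_on_imp_differentiable_at[OF hol])
       (use \<kappa> z in \<open>auto intro: dented_disc_closed_disc\<close>)
  have lim_z: "((\<lambda>x. of_real x * z) \<longlongrightarrow> z) (at_left (1::real))"
    by (rule tendsto_eq_intros refl | simp)+
  have lim\<psi>: "((\<lambda>x. \<psi> (of_real x * z)) \<longlongrightarrow> \<psi> z) (at_left (1::real))"
    using field_differentiable_imp_continuous_at[OF diff] lim_z by (rule isCont_tendsto_compose)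
  have sums: "(\<lambda>n. complex_of_real (c n) * (of_real x * z) ^ n) sums \<psi> (of_real x * z)" if "0 < x" "x < 1" for x :: real
  proof -
    have "norm (of_real x * z) < 1" using that z by (simp add: norm_mult mult_le_cancel_left1 le_less_trans[of _ x])
    then show ?thesis using c(2) by (simp add: disc_sums_def)
  qed
  have zn: "z ^ n = u" if "c n \<noteq> 0" for n
  proof -
    \<comment> \<open>All terms \<open>c m * (1 - Re (cnj u * z ^ m))\<close> are nonnegative and
      their total is at most 0, so each vanishes. If \<open>z\<close> lies on the unit circle, the
      power series is only available at \<open>x * z\<close> with \<open>x < 1\<close>, whence the
      passage to the limit.\<close>
    have "c n * (1 - Re (cnj u * z ^ n)) \<le> Re C - Re (cnj u * \<psi> z)"
    proof (rule tendsto_le)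
      show "((\<lambda>x::real. Re C - Re (cnj u * \<psi> (of_real x * z))) \<longlongrightarrow> Re C - Re (cnj u * \<psi> z)) (at_left 1)"
        by (intro tendsto_intros lim\<psi>)
      show "((\<lambda>x::real. c n * (1 - x ^ n * Re (cnj u * z ^ n))) \<longlongrightarrow> c n * (1 - Re (cnj u * z ^ n))) (at_left 1)"
        by (rule tendsto_eq_intros refl | simp)+
      show "\<forall>\<^sub>F x in at_left 1. c n * (1 - x ^ n * Re (cnj u * z ^ n)) \<le> Re C - Re (cnj u * \<psi> (of_real x * z))"
        using eventually_at_left_1_unit
      proof eventually_elim
        case (elim x)
        have "(\<lambda>m. Re (cnj u * (of_real (c m) * (of_real x * z) ^ m))) sums Re (cnj u * \<psi> (of_real x * z))"
          using elim by (intro sums_Re sums_mult sums) auto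
        moreover have "Re (cnj u * (of_real (c m) * (of_real x * z) ^ m)) = c m * (x ^ m * Re (cnj u * z ^ m))" for m
        proof -
          have "cnj u * (of_real (c m) * (of_real x * z) ^ m) = of_real (c m * x ^ m) * (cnj u * z ^ m)"
            by (simp add: power_mult_distrib mult_ac)
          moreover have "Re (of_real r * w) = r * Re w" for r w by simp
          ultimately show ?thesis by (simp only: mult.assoc)
        qed
        ultimately have "(\<lambda>m. c m * (x ^ m * Re (cnj u * z ^ m))) sums Re (cnj u * \<psi> (of_real x * z))"
          by simp
        from sums_diff[OF cs this]
        have s: "(\<lambda>m. c m * (1 - x ^ m * Re (cnj u * z ^ m))) sums (Re C - Re (cnj u * \<psi> (of_real x * z)))"
          by (simp add: algebra_simps)
        have nn: "0 \<le> c m * (1 - x ^ m * Re (cnj u * z ^ m))" for m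
        proof -
          have "norm (cnj u * z ^ m) \<le> 1" using u z by (simp add: norm_mult norm_power power_le_one)
          then have "Re (cnj u * z ^ m) \<le> 1" using complex_Re_le_cmod order_trans by blast
          then have "x ^ m * Re (cnj u * z ^ m) \<le> x ^ m * 1" using elim by (intro mult_left_mono) auto
          also have "\<dots> \<le> 1" using elim by (simp add: power_le_one)
          finally show ?thesis using c(1)[of m] by simp
        qed
        show ?case using sum_le_suminf[of _ "{n}", OF sums_summable[OF s]] nn s
          by (simp add: sums_iff)
      qed
    qed auto
    also have "\<dots> \<le> 0" using uz ge by simp
    finally have "1 - Re (cnj u * z ^ n) \<le> 0" using c(1)[of n] that by (simp add: mult_le_0_iff)
    moreover have n1: "norm (cnj u * z ^ n) \<le> 1" using u z by (simp add: norm_mult norm_power power_le_one)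
    ultimately have "Re (cnj u * z ^ n) = 1" using complex_Re_le_cmod[of "cnj u * z ^ n"] by linarith
    then have "cnj u * z ^ n = 1"
      using n1 cmod_power2[of "cnj u * z ^ n"] power_le_one[of "norm (cnj u * z ^ n)" 2]
      by (simp add: complex_eq_iff)
    then have "u * cnj u * z ^ n = u" by (simp add: mult.assoc)
    then show "z ^ n = u" using u by (simp add: complex_norm_square[symmetric])
  qed
  have eq: "\<psi> (of_real x * z) = u * \<psi> (of_real x)" if "0 < x" "x < 1" for x :: real
  proof -
    have "(\<lambda>n. u * complex_of_real (c n * x ^ n)) sums (u * \<psi> (of_real x))"
      by (intro sums_mult disc_sums_of_real c that)
    moreover have "u * complex_of_real (c n * x ^ n) = complex_of_real (c n) * (of_real x * z) ^ n" for n
      using zn[of n] by (cases "c n = 0") (auto simp: power_mult_distrib)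
    ultimately have "(\<lambda>n. complex_of_real (c n) * (of_real x * z) ^ n) sums (u * \<psi> (of_real x))"
      by (simp only:)
    with sums[OF that] show ?thesis by (rule sums_unique2)
  qed
  have lim1: "((\<lambda>x. \<psi> (of_real x)) \<longlongrightarrow> C) (at_left 1)"
    by (rule filterlim_compose[OF sing_exp_tendsto[OF f a(1)] filterlim_of_real_one_filter[OF \<kappa>]])
  have "((\<lambda>x. u * \<psi> (of_real x)) \<longlongrightarrow> \<psi> z) (at_left 1)"
    by (rule Lim_transform_eventually[OF lim\<psi>])
       (use eventually_at_left_1_unit in \<open>eventually_elim, simp add: eq\<close>)
  moreover have "((\<lambda>x. u * \<psi> (of_real x)) \<longlongrightarrow> u * C) (at_left 1)"
    by (intro tendsto_intros lim1)
  ultimately have \<psi>z: "\<psi> z = u * C" using tendsto_unique trivial_limit_at_left_real by blast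
  \<comment> \<open>\<open>u\<close> times the normalised error of the expansion at 1, so it tends
    to 0. The normalised increment of \<open>\<psi>\<close> along the ray to \<open>z\<close> tends
    to 0 as well, by differentiability at \<open>z\<close>, yet the two differ by the constant
    \<open>u * A\<close>.\<close>
  define q where "q x = u * (\<psi> (of_real x) - C - A * (1 - of_real x) powr of_real a) / (1 - of_real x) powr of_real a" for x :: real
  have "((\<lambda>w. (\<psi> w - C - A * (1 - w) powr of_real a) / (1 - w) powr of_real a) \<longlongrightarrow> 0) (one_filter \<kappa>)"
    using f by (intro smalloD_tendsto) (auto simp: sing_exp_def)
  from filterlim_compose[OF this filterlim_of_real_one_filter[OF \<kappa>]]
  have q0: "(q \<longlongrightarrow> u * 0) (at_left 1)"
    unfolding q_def times_divide_eq_right[symmetric] by (intro tendsto_intros)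
  have "(\<lambda>w. \<psi> (w * z)) field_differentiable at 1"
  proof -
    have "(\<lambda>w. w * z) field_differentiable at (1::complex)"
      by (intro field_differentiable_mult field_differentiable_ident field_differentiable_const)
    from field_differentiable_compose[OF this, of \<psi>] diff show ?thesis by (simp add: o_def)
  qed
  from differentiable_diff_smallo[OF this a(2), of \<kappa>]
  have "((\<lambda>w. (\<psi> (w * z) - \<psi> z) / (1 - w) powr of_real a) \<longlongrightarrow> 0) (one_filter \<kappa>)"
    by (intro smalloD_tendsto) simp
  from filterlim_compose[OF this filterlim_of_real_one_filter[OF \<kappa>]] q0
  have "((\<lambda>x::real. (\<psi> (of_real x * z) - \<psi> z) / (1 - of_real x) powr of_real a - q x) \<longlongrightarrow> 0 - u * 0) (at_left 1)"
    by (rule tendsto_diff)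
  moreover have "\<forall>\<^sub>F x in at_left 1. (\<psi> (of_real x * z) - \<psi> z) / (1 - of_real x) powr of_real a - q x = u * A"
    using eventually_at_left_1_unit
  proof eventually_elim
    case (elim x)
    then have "(1 - complex_of_real x) powr of_real a \<noteq> 0" by auto
    moreover have "\<psi> (of_real x * z) = u * \<psi> (of_real x)" using elim by (simp add: eq)
    ultimately show ?case unfolding \<psi>z q_def by (simp only:) (simp add: field_simps)
  qed
  ultimately have "((\<lambda>x::real. u * A) \<longlongrightarrow> 0 - u * 0) (at_left 1)"
    by (rule Lim_transform_eventually)
  then have "u * A = 0" by (simp add: tendsto_const_iff)
  then show False using u A by auto
qed

text \<open>On a slightly dented disc the argument of \<open>1 - w\<close> stays within an angle
  \<open>\<beta>\<close> just above \<open>pi / 2\<close>. The power multiplies it by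
  \<open>a < 1\<close>, which brings it strictly below \<open>pi / 2\<close>, so the real part is
  comparable to the modulus.\<close>

lemma Re_powr_dented_disc:
  assumes "0 < a" "a < 1"
  shows "\<exists>\<kappa> \<gamma>. 0 < \<kappa> \<and> \<kappa> \<le> 1/2 \<and> 0 < \<gamma> \<and>
    (\<forall>w\<in>dented_disc \<kappa>. \<gamma> * norm (1 - w) powr a \<le> Re ((1 - w) powr of_real a))"
proof -
  \<comment> \<open>any angle in \<open>(pi/2, pi)\<close> with \<open>a * \<beta> < pi/2\<close>\<close>
  define \<beta> where "\<beta> = pi / (1 + a)"
  have \<beta>: "pi / 2 < \<beta>" "\<beta> < pi" "0 \<le> a * \<beta>" "a * \<beta> < pi / 2"
    using assms by (auto simp: \<beta>_def field_simps)
  define \<gamma> where "\<gamma> = cos (a * \<beta>)"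
  have \<gamma>: "0 < \<gamma>" unfolding \<gamma>_def by (rule cos_gt_zero_pi) (use \<beta> in linarith)+
  have cb: "cos \<beta> < 0" using \<beta> cos_lt_zero_pi cos_monotone_0_pi[of "pi/2" \<beta>] by simp
  \<comment> \<open>This gives \<open>\<kappa> / (1 - \<kappa>) \<le> 2 * \<kappa> \<le> - cos
    \<beta>\<close>, so \<open>Re_dented_disc\<close> excludes arguments beyond
    \<open>\<beta>\<close>.\<close>
  define \<kappa> where "\<kappa> = min (1/2) (- cos \<beta> / 2)"
  have \<kappa>: "0 < \<kappa>" "\<kappa> \<le> 1/2" "\<kappa> \<le> - cos \<beta> / 2" using cb by (auto simp: \<kappa>_def)
  have "\<gamma> * norm (1 - w) powr a \<le> Re ((1 - w) powr of_real a)" if w: "w \<in> dented_disc \<kappa>" for w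
  proof -
    have w1: "w \<noteq> 1" using w one_notin_dented_disc[of \<kappa>] \<kappa> by auto
    have "\<bar>Arg (1 - w)\<bar> \<le> \<beta>"
    proof (rule ccontr)
      assume "\<not> \<bar>Arg (1 - w)\<bar> \<le> \<beta>"
      then have "cos \<bar>Arg (1 - w)\<bar> < cos \<beta>"
        using \<beta> Arg_bounded[of "1 - w"] pi_gt_zero by (intro cos_monotone_0_pi) (auto simp: abs_le_iff)
      then have "norm (1 - w) * cos (Arg (1 - w)) < norm (1 - w) * cos \<beta>"
        using w1 by simp
      moreover have "norm (1 - w) * cos (Arg (1 - w)) = Re (1 - w)"
        using arg_cong[OF rcis_cmod_Arg[of "1 - w"], of Re] by simp
      moreover have "Re (w - 1) < \<kappa> / (1 - \<kappa>) * norm (1 - w)"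
        using w \<kappa> by (intro Re_dented_disc) auto
      moreover have "\<kappa> / (1 - \<kappa>) \<le> \<kappa> / (1/2)" using \<kappa> by (intro divide_left_mono) auto
      then have "\<kappa> / (1 - \<kappa>) * norm (1 - w) \<le> - cos \<beta> * norm (1 - w)"
        using \<kappa> by (intro mult_right_mono) auto
      ultimately show False by (simp add: mult.commute)
    qed
    then have "\<bar>a * Arg (1 - w)\<bar> \<le> a * \<beta>" using assms by (simp add: abs_mult)
    then have "cos (a * \<beta>) \<le> cos \<bar>a * Arg (1 - w)\<bar>"
      using \<beta> by (intro cos_monotone_0_pi_le) auto
    then have "\<gamma> \<le> cos (a * Arg (1 - w))" by (simp add: \<gamma>_def)
    then have "\<gamma> * norm (1 - w) powr a \<le> cos (a * Arg (1 - w)) * norm (1 - w) powr a"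
      by (intro mult_right_mono) auto
    also have "\<dots> = Re ((1 - w) powr of_real a)"
      using w1 by (simp add: powr_def Re_exp Arg_eq_Im_Ln mult.commute)
    finally show ?thesis .
  qed
  with \<kappa> \<gamma> show ?thesis by blast
qed

text \<open>The part of a delta-domain of \<open>G\<close> in which the values of \<open>H\<close> lie.\<close>
definition half_disc :: "real \<Rightarrow> real \<Rightarrow> complex set" where
  "half_disc \<rho> \<epsilon> = {w. Re w < \<rho> \<and> norm w < \<rho> + \<epsilon>}"

lemma maps_into_half_disc_near:
  assumes f: "sing_exp \<kappa>0 \<psi> (of_real \<rho>) (of_real A) a" and a: "0 < a" "a < 1" and A: "A < 0"
    and \<epsilon>: "0 < \<epsilon>" "0 < \<rho>"
  shows "\<exists>\<kappa> \<delta>. 0 < \<kappa> \<and> \<kappa> \<le> \<kappa>0 \<and> 0 < \<delta> \<and>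
     (\<forall>w\<in>dented_disc \<kappa>. norm (1 - w) < \<delta> \<longrightarrow> \<psi> w \<in> half_disc \<rho> \<epsilon>)"
proof -
  obtain \<kappa>1 \<gamma> where \<kappa>1: "0 < \<kappa>1" "\<kappa>1 \<le> 1/2" "0 < \<gamma>"
    and re: "\<And>w. w \<in> dented_disc \<kappa>1 \<Longrightarrow> \<gamma> * norm (1 - w) powr a \<le> Re ((1 - w) powr of_real a)"
    using Re_powr_dented_disc[OF a] by blast
  have \<kappa>0: "0 < \<kappa>0" using f by (simp add: sing_exp_def)
  define \<kappa> where "\<kappa> = min \<kappa>0 \<kappa>1"
  have \<kappa>: "0 < \<kappa>" "\<kappa> \<le> \<kappa>0" "\<kappa> \<le> \<kappa>1" using \<kappa>0 \<kappa>1 by (auto simp: \<kappa>_def)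
  have f': "sing_exp \<kappa> \<psi> (of_real \<rho>) (of_real A) a" by (rule sing_exp_mono[OF f \<kappa>(1,2)])
  \<comment> \<open>The singular term lowers the real part by at least
    \<open>- A * \<gamma> * norm (1 - w) powr a\<close>; the error is allowed half of that.\<close>
  have "eventually (\<lambda>w. norm (\<psi> w - of_real \<rho> - of_real A * (1 - w) powr of_real a)
      \<le> (- A * \<gamma> / 2) * norm ((1 - w) powr of_real a)) (one_filter \<kappa>)"
    using f' A \<kappa>1 by (intro landau_o.smallD) (auto simp: sing_exp_def mult_neg_pos)
  moreover have "((\<lambda>w. norm (\<psi> w)) \<longlongrightarrow> norm (complex_of_real \<rho>)) (one_filter \<kappa>)"
    by (intro tendsto_norm sing_exp_tendsto[OF f' a(1)])
  then have "eventually (\<lambda>w. norm (\<psi> w) < \<rho> + \<epsilon>) (one_filter \<kappa>)"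
    using \<epsilon> by (intro order_tendstoD(2)) auto
  ultimately have "eventually (\<lambda>w. \<psi> w \<in> half_disc \<rho> \<epsilon>) (one_filter \<kappa>)"
    using eventually_in_dented_disc eventually_neq_one
  proof eventually_elim
    case (elim w)
    have p: "0 < norm (1 - w) powr a" using elim by simp
    have "Re (\<psi> w - of_real \<rho>) = A * Re ((1 - w) powr of_real a)
        + Re (\<psi> w - of_real \<rho> - of_real A * (1 - w) powr of_real a)"
      by simp
    also have "A * Re ((1 - w) powr of_real a) \<le> A * (\<gamma> * norm (1 - w) powr a)"
      using A re[of w] elim dented_disc_mono[OF \<kappa>(3)] by (intro mult_left_mono_neg) auto
    also have "Re (\<psi> w - of_real \<rho> - of_real A * (1 - w) powr of_real a)
        \<le> (- A * \<gamma> / 2) * norm ((1 - w) powr of_real a)"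
      using elim(1) complex_Re_le_cmod order_trans by blast
    also have "A * (\<gamma> * norm (1 - w) powr a) + (- A * \<gamma> / 2) * norm ((1 - w) powr of_real a)
        = A * \<gamma> / 2 * norm (1 - w) powr a"
      by (simp add: norm_powr_real_powr')
    also have "\<dots> < 0" using A \<kappa>1 p by (simp add: mult_less_0_iff zero_less_mult_iff)
    finally show ?case using elim by (simp add: half_disc_def)
  qed
  then obtain \<delta> where \<delta>: "0 < \<delta>" "\<And>w. w \<in> dented_disc \<kappa> \<Longrightarrow> w \<noteq> 1 \<Longrightarrow> dist w 1 < \<delta> \<Longrightarrow> \<psi> w \<in> half_disc \<rho> \<epsilon>"
    unfolding eventually_at by auto
  have "\<kappa> \<le> 1" using \<kappa> \<kappa>1 by simp
  then have "\<psi> w \<in> half_disc \<rho> \<epsilon>" if "w \<in> dented_disc \<kappa>" "norm (1 - w) < \<delta>" for w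
    using \<delta>(2)[of w] that one_notin_dented_disc[of \<kappa>] by (auto simp: dist_norm norm_minus_commute)
  with \<kappa> \<delta> show ?thesis by blast
qed

text \<open>Near 1 the singular term decides. On the rest of the closed disc, which is compact, the
  strict bound on the modulus persists in a uniform neighbourhood.\<close>

lemma maps_into_half_disc:
  assumes f: "sing_exp \<kappa>0 \<psi> (of_real \<rho>) (of_real A) a" and a: "0 < a" "a < 1" and A: "A < 0"
    and \<epsilon>: "0 < \<epsilon>" "0 < \<rho>"
    and lt: "\<And>z. norm z \<le> 1 \<Longrightarrow> z \<noteq> 1 \<Longrightarrow> norm (\<psi> z) < \<rho>"
  shows "\<exists>\<kappa>. 0 < \<kappa> \<and> \<kappa> \<le> \<kappa>0 \<and> \<psi> ` dented_disc \<kappa> \<subseteq> half_disc \<rho> \<epsilon>"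
proof -
  obtain \<kappa>1 \<delta> where \<kappa>1: "0 < \<kappa>1" "\<kappa>1 \<le> \<kappa>0" "0 < \<delta>"
    and near: "\<And>w. w \<in> dented_disc \<kappa>1 \<Longrightarrow> norm (1 - w) < \<delta> \<Longrightarrow> \<psi> w \<in> half_disc \<rho> \<epsilon>"
    using maps_into_half_disc_near[OF f a A \<epsilon>] by blast
  have hol: "\<psi> holomorphic_on dented_disc \<kappa>0" and \<kappa>0: "0 < \<kappa>0" using f by (auto simp: sing_exp_def)
  define K :: "complex set" where "K = cball 0 1 - ball 1 (\<delta> / 2)"
  define U where "U = dented_disc \<kappa>0 \<inter> \<psi> -` ball 0 \<rho>"
  have "open U" unfolding U_def
    by (intro continuous_open_preimage holomorphic_on_imp_continuous_on hol) auto
  moreover have "K \<subseteq> U"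
  proof
    fix z assume "z \<in> K"
    then have z: "norm z \<le> 1" "z \<noteq> 1" using \<kappa>1 by (auto simp: K_def)
    then show "z \<in> U" unfolding U_def using lt \<kappa>0 by (auto intro: dented_disc_closed_disc)
  qed
  moreover have "compact K" unfolding K_def by (intro compact_diff compact_cball open_ball)
  ultimately obtain d where d: "0 < d" "(\<Union>x\<in>K. ball x d) \<subseteq> U"
    by (metis compact_subset_open_imp_ball_epsilon_subset)
  \<comment> \<open>A point \<open>w\<close> lies within \<open>2 * \<kappa> \<le> d\<close> of its
    centre \<open>z\<close>. If \<open>w\<close> is at least \<open>\<delta>\<close> away from 1,
    then \<open>2 * \<kappa> \<le> \<delta> / 2\<close> keeps \<open>z\<close> at least
    \<open>\<delta> / 2\<close> away, that is in \<open>K\<close>.\<close>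
  define \<kappa> where "\<kappa> = min \<kappa>1 (min (d / 2) (\<delta> / 4))"
  have \<kappa>: "0 < \<kappa>" "\<kappa> \<le> \<kappa>1" "\<kappa> \<le> d / 2" "\<kappa> \<le> \<delta> / 4"
    using \<kappa>1 d by (auto simp: \<kappa>_def)
  have "\<psi> w \<in> half_disc \<rho> \<epsilon>" if w: "w \<in> dented_disc \<kappa>" for w
  proof (cases "norm (1 - w) < \<delta>")
    case True
    then show ?thesis using near w dented_disc_mono[OF \<kappa>(2)] by auto
  next
    case False
    obtain z where z: "norm z < 1" "norm (w - z) < \<kappa> * norm (1 - z)"
      by (rule dented_discE[OF w])
    have "norm (1 - z) \<le> 2" using norm_triangle_ineq4[of 1 z] z by simp
    then have wz: "norm (w - z) < \<kappa> * 2"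
      using z \<kappa> by (intro less_le_trans[OF z(2)] mult_left_mono) auto
    have "\<delta> / 2 \<le> norm (1 - z)"
      using norm_triangle_ineq[of "1 - z" "z - w"] False wz \<kappa> by (simp add: norm_minus_commute[of z])
    then have "z \<in> K" using z by (simp add: K_def dist_norm)
    moreover have "w \<in> ball z d" using wz \<kappa> by (simp add: dist_norm norm_minus_commute)
    ultimately have "w \<in> U" using d(2) by blast
    then have "norm (\<psi> w) < \<rho>" by (simp add: U_def)
    then show ?thesis using \<epsilon> complex_Re_le_cmod[of "\<psi> w"] by (simp add: half_disc_def)
  qed
  then show ?thesis using \<kappa> \<kappa>1 by (intro exI[of _ \<kappa>]) auto
qed

lemma rGamma_minus_neg:
  assumes "0 < a" "a < (1::real)"
  shows "rGamma (- a) < 0"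
proof -
  have "rGamma (- a) = - a * rGamma (- a + 1)" by (rule rGamma_plus1[symmetric])
  moreover have "0 < rGamma (- a + 1)" using assms by (simp add: rGamma_inverse_Gamma)
  ultimately show ?thesis using assms by (simp add: mult_neg_pos)
qed

text \<open>By transfer the rescaled nonnegative coefficients converge to
  \<open>A * rGamma (- a)\<close>, and \<open>rGamma (- a)\<close> is negative for
  \<open>0 < a < 1\<close>.\<close>

lemma sing_exp_coeff_neg:
  assumes f: "sing_exp \<kappa> \<psi> C (of_real A) a" and a: "0 < a" "a < 1" and A: "A \<noteq> 0"
    and c: "\<And>n. 0 \<le> c n" "disc_sums c \<psi>"
  shows "A < 0"
proof -
  have "(\<lambda>n. complex_of_real (c n) * of_real (real n powr (a + 1))) \<longlonglongrightarrow> of_real A * rGamma (- of_real a)"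
    using c(2) by (intro transfer_sing_exp[OF f a(2)]) (auto simp: disc_sums_def)
  then have "(\<lambda>n. complex_of_real (c n * real n powr (a + 1))) \<longlonglongrightarrow> of_real (A * rGamma (- a))"
    using rGamma_complex_of_real[of "- a"] by simp
  then have "(\<lambda>n. c n * real n powr (a + 1)) \<longlonglongrightarrow> A * rGamma (- a)"
    by (simp only: tendsto_of_real_iff)
  then have "0 \<le> A * rGamma (- a)"
    by (rule LIMSEQ_le_const) (use c in auto)
  then show ?thesis using rGamma_minus_neg[OF a] A by (auto simp: zero_le_mult_iff)
qed

section \<open>Expansion of the outer series and composition\<close>

lemma half_disc_subset_delta_domain:
  "0 < \<theta> \<Longrightarrow> \<theta> < pi / 2 \<Longrightarrow> half_disc \<rho> \<epsilon> \<subseteq> delta_domain \<rho> \<epsilon> \<theta>"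
  by (auto simp: half_disc_def intro: half_plane_in_delta_domain)

lemma powr_of_real_bigo:
  assumes "f \<in> O[F](g)" "0 \<le> a"
  shows "(\<lambda>z. f z powr of_real a) \<in> O[F](\<lambda>z. (g z :: complex) powr of_real a)"
proof -
  obtain K where K: "0 < K" "eventually (\<lambda>z. norm (f z) \<le> K * norm (g z)) F"
    using assms(1) by (rule landau_o.bigE)
  show ?thesis
  proof (rule landau_o.bigI)
    show "0 < K powr a" using K by simp
    show "\<forall>\<^sub>F z in F. norm (f z powr of_real a) \<le> K powr a * norm (g z powr of_real a)"
      using K(2)
    proof eventually_elim
      case (elim z)
      then have "norm (f z) powr a \<le> (K * norm (g z)) powr a"
        using assms(2) by (intro powr_mono2) auto
      then show ?case using K by (simp add: norm_powr_real_powr' powr_mult)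
    qed
  qed
qed

text \<open>The half disc no longer depends on the angle of the delta-domain. For the composition an
  upper bound on the singular part is enough, so the equivalence is weakened to
  \<open>O\<close>.\<close>

lemma singular_expansion_half_disc:
  assumes "singular_expansion f \<rho> c lam"
  obtains \<epsilon> \<phi> P where "0 < \<epsilon>" "\<phi> holomorphic_on half_disc \<rho> \<epsilon>"
    "disc_sums (\<lambda>n. fps_nth f n * \<rho> ^ n) (\<lambda>z. \<phi> (of_real \<rho> * z))"
    "0 < lam \<and> lam < 1 \<longrightarrow> degree P = 0"
    "(\<lambda>w. \<phi> w - poly P (1 - w / of_real \<rho>))
       \<in> O[at (of_real \<rho>) within half_disc \<rho> \<epsilon>](\<lambda>w. (1 - w / of_real \<rho>) powr of_real lam)"
proof -
  from assms obtain \<epsilon> \<theta> \<phi> P where \<rho>: "0 < \<rho>" and *: "0 < \<epsilon>" "0 < \<theta>" "\<theta> < pi / 2"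
    "\<phi> analytic_on delta_domain \<rho> \<epsilon> \<theta>"
    "\<And>z. norm z < \<rho> \<Longrightarrow> (\<lambda>n. complex_of_real (fps_nth f n) * z ^ n) sums \<phi> z"
    "0 < lam \<and> lam < 1 \<longrightarrow> degree P = 0"
    and as: "(\<lambda>z. \<phi> z - poly P (1 - z / complex_of_real \<rho>))
          \<sim>[at (complex_of_real \<rho>) within delta_domain \<rho> \<epsilon> \<theta>]
        (\<lambda>z. complex_of_real c * (1 - z / complex_of_real \<rho>) powr complex_of_real lam)"
    unfolding singular_expansion_def by auto
  have sub: "half_disc \<rho> \<epsilon> \<subseteq> delta_domain \<rho> \<epsilon> \<theta>" by (rule half_disc_subset_delta_domain) fact+
  have hol: "\<phi> holomorphic_on half_disc \<rho> \<epsilon>"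
    by (rule analytic_imp_holomorphic[OF analytic_on_subset[OF *(4) sub]])
  have "disc_sums (\<lambda>n. fps_nth f n * \<rho> ^ n) (\<lambda>z. \<phi> (of_real \<rho> * z))"
    unfolding disc_sums_def
  proof (intro allI impI)
    fix z :: complex assume "norm z < 1"
    then show "(\<lambda>n. complex_of_real (fps_nth f n * \<rho> ^ n) * z ^ n) sums \<phi> (of_real \<rho> * z)"
      using *(5)[of "of_real \<rho> * z"] \<rho> by (simp add: norm_mult power_mult_distrib mult.assoc)
  qed
  moreover have "(\<lambda>w. \<phi> w - poly P (1 - w / of_real \<rho>))
       \<in> O[at (of_real \<rho>) within half_disc \<rho> \<epsilon>](\<lambda>w. of_real c * (1 - w / of_real \<rho>) powr of_real lam)"
    by (rule landau_o.big.filter_mono[OF at_le[OF sub] asymp_equiv_imp_bigo[OF as]])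
  moreover have "c \<noteq> 0" using assms by (simp add: singular_expansion_def)
  ultimately show thesis
    using that[of \<epsilon> \<phi> P] *(1,6) hol by simp
qed

lemma filterlim_of_real_half_disc:
  assumes "0 < \<rho>" "0 < \<epsilon>"
  shows "filterlim (\<lambda>x. of_real \<rho> * complex_of_real x) (at (of_real \<rho>) within half_disc \<rho> \<epsilon>) (at_left 1)"
  unfolding filterlim_at
proof
  show "\<forall>\<^sub>F x in at_left 1. of_real \<rho> * complex_of_real x \<in> half_disc \<rho> \<epsilon> \<and> of_real \<rho> * complex_of_real x \<noteq> of_real \<rho>"
    using eventually_at_left_1_unit
  proof eventually_elim
    case (elim x)
    then have "\<rho> * x < \<rho>" "0 < \<rho> * x" "\<rho> * x < \<rho> + \<epsilon>"
      using assms by (auto intro: less_trans[of _ \<rho>])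
    then show ?case using assms elim by (auto simp: half_disc_def norm_mult)
  qed
  show "((\<lambda>x. of_real \<rho> * complex_of_real x) \<longlongrightarrow> of_real \<rho>) (at_left 1)"
    by (rule tendsto_eq_intros refl | simp)+
qed

text \<open>The expansion yields a radial limit, and nonnegative coefficients turn it into
  convergence of the series at the singularity, with the constant of the expansion as its
  sum.\<close>

lemma half_disc_expansion_lt_1:
  assumes f: "singular_expansion f \<rho> c lam" and lam: "0 < lam" "lam < 1" and nn: "\<And>n. 0 \<le> fps_nth f n"
  obtains \<epsilon> \<phi> \<tau> where "0 < \<epsilon>" "\<phi> holomorphic_on half_disc \<rho> \<epsilon>"
    "disc_sums (\<lambda>n. fps_nth f n * \<rho> ^ n) (\<lambda>z. \<phi> (of_real \<rho> * z))"
    "(\<lambda>n. fps_nth f n * \<rho> ^ n) sums \<tau>"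
    "(\<lambda>w. \<phi> w - of_real \<tau>) \<in> O[at (of_real \<rho>) within half_disc \<rho> \<epsilon>](\<lambda>w. (1 - w / of_real \<rho>) powr of_real lam)"
proof -
  have \<rho>: "0 < \<rho>" using f by (simp add: singular_expansion_def)
  obtain \<epsilon> \<phi> P where *: "0 < \<epsilon>" "\<phi> holomorphic_on half_disc \<rho> \<epsilon>"
    "disc_sums (\<lambda>n. fps_nth f n * \<rho> ^ n) (\<lambda>z. \<phi> (of_real \<rho> * z))"
    "0 < lam \<and> lam < 1 \<longrightarrow> degree P = 0"
    "(\<lambda>w. \<phi> w - poly P (1 - w / of_real \<rho>))
       \<in> O[at (of_real \<rho>) within half_disc \<rho> \<epsilon>](\<lambda>w. (1 - w / of_real \<rho>) powr of_real lam)"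
    by (rule singular_expansion_half_disc[OF f])
  obtain d where "P = [:d:]" using *(4) lam by (auto elim: degree_eq_zeroE)
  with *(5) have O: "(\<lambda>w. \<phi> w - d)
       \<in> O[at (of_real \<rho>) within half_disc \<rho> \<epsilon>](\<lambda>w. (1 - w / of_real \<rho>) powr of_real lam)"
    by simp
  let ?x = "\<lambda>x. of_real \<rho> * complex_of_real x"
  have "(\<lambda>x. \<phi> (?x x) - d) \<in> O[at_left 1](\<lambda>x. (1 - ?x x / of_real \<rho>) powr of_real lam)"
    by (rule landau_o.big.compose[OF O filterlim_of_real_half_disc[OF \<rho> *(1)]])
  then have O1: "(\<lambda>x. \<phi> (?x x) - d) \<in> O[at_left 1](\<lambda>x. (1 - of_real x) powr of_real lam)"
    using \<rho> by simp
  have "((\<lambda>x. (1 - complex_of_real x) powr of_real lam) \<longlongrightarrow> 0) (at_left 1)"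
    by (rule filterlim_compose[OF tendsto_one_minus_powr_0[OF lam(1)] filterlim_of_real_one_filter[of "1/2"]]) simp
  then have "(\<lambda>x. (1 - complex_of_real x) powr of_real lam) \<in> o[at_left 1](\<lambda>x. 1 :: complex)"
    by (intro smalloI_tendsto) auto
  with O1 have "(\<lambda>x. \<phi> (?x x) - d) \<in> o[at_left 1](\<lambda>x. 1 :: complex)"
    by (rule landau_o.big_small_trans)
  then have "((\<lambda>x. \<phi> (?x x) - d) \<longlongrightarrow> 0) (at_left 1)"
    by (auto dest!: smalloD_tendsto)
  then have "((\<lambda>x. \<phi> (?x x)) \<longlongrightarrow> d) (at_left 1)" by (simp add: LIM_zero_iff)
  from disc_sums_limit[OF _ *(3) this] nn \<rho>
  have "(\<lambda>n. fps_nth f n * \<rho> ^ n) sums Re d" "d = of_real (Re d)" by auto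
  with O *(1-3) show thesis by (intro that[of \<epsilon> \<phi> "Re d"]) auto
qed

text \<open>The singular term is of smaller order than the linear one, so the first two coefficients
  of \<open>P\<close> give a value and a derivative at \<open>\<rho>\<close>. That these are the
  sums of the series and of the differentiated series follows from radial limits of function values
  and of difference quotients.\<close>

lemma half_disc_expansion_gt_1:
  assumes f: "singular_expansion f \<rho> c lam" and lam: "1 < lam" and nn: "\<And>n. 0 \<le> fps_nth f n"
  obtains \<epsilon> \<phi> \<tau> D where "0 < \<epsilon>" "\<phi> holomorphic_on half_disc \<rho> \<epsilon>"
    "disc_sums (\<lambda>n. fps_nth f n * \<rho> ^ n) (\<lambda>z. \<phi> (of_real \<rho> * z))"
    "(\<lambda>n. fps_nth f n * \<rho> ^ n) sums \<tau>"
    "(\<lambda>n. real n * fps_nth f n * \<rho> ^ (n - 1)) sums D"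
    "(\<lambda>w. \<phi> w - of_real \<tau> - of_real D * (w - of_real \<rho>))
       \<in> o[at (of_real \<rho>) within half_disc \<rho> \<epsilon>](\<lambda>w. w - of_real \<rho>)"
proof -
  have \<rho>: "0 < \<rho>" using f by (simp add: singular_expansion_def)
  obtain \<epsilon> \<phi> P where *: "0 < \<epsilon>" "\<phi> holomorphic_on half_disc \<rho> \<epsilon>"
    "disc_sums (\<lambda>n. fps_nth f n * \<rho> ^ n) (\<lambda>z. \<phi> (of_real \<rho> * z))"
    "0 < lam \<and> lam < 1 \<longrightarrow> degree P = 0"
    and O: "(\<lambda>w. \<phi> w - poly P (1 - w / of_real \<rho>))
       \<in> O[at (of_real \<rho>) within half_disc \<rho> \<epsilon>](\<lambda>w. (1 - w / of_real \<rho>) powr of_real lam)"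
    by (rule singular_expansion_half_disc[OF f])
  let ?F = "at (complex_of_real \<rho>) within half_disc \<rho> \<epsilon>"
  let ?x = "\<lambda>x. of_real \<rho> * complex_of_real x"
  define C where "C = poly P 0"
  \<comment> \<open>The derivative of \<open>poly P (1 - w / \<rho>)\<close> at
    \<open>w = \<rho>\<close>.\<close>
  define E where "E = - poly (pderiv P) 0 / of_real \<rho>"
  have ne: "eventually (\<lambda>w. w \<noteq> of_real \<rho>) ?F" by (simp add: eventually_at_filter)
  have "(\<lambda>w. (1 - w / of_real \<rho>) powr of_real lam) \<in> o[?F](\<lambda>w. w - of_real \<rho>)"
  proof (rule landau_o.small_big_trans)
    have "((\<lambda>w. 1 - w / of_real \<rho>) \<longlongrightarrow> 0) ?F"
      using \<rho> by - (rule tendsto_eq_intros refl | simp)+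
    then have "((\<lambda>w. norm (1 - w / of_real \<rho>) powr (lam - 1)) \<longlongrightarrow> 0) ?F"
      using lam by (intro tendsto_zero_powrI[where b = "lam - 1"] tendsto_norm_zero) auto
    then have "((\<lambda>w. norm ((1 - w / of_real \<rho>) powr of_real lam / (1 - w / of_real \<rho>) powr of_real 1)) \<longlongrightarrow> 0) ?F"
      by (rule Lim_transform_eventually)
         (use ne in eventually_elim, use \<rho> in \<open>simp add: norm_divide norm_powr_real_powr' powr_diff\<close>)
    then have "((\<lambda>w. (1 - w / of_real \<rho>) powr of_real lam / (1 - w / of_real \<rho>) powr of_real 1) \<longlongrightarrow> 0) ?F"
      by (rule tendsto_norm_zero_cancel)
    then show "(\<lambda>w. (1 - w / of_real \<rho>) powr of_real lam) \<in> o[?F](\<lambda>w. (1 - w / of_real \<rho>) powr of_real 1)"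
      by (rule smalloI_tendsto) (use ne in eventually_elim, use \<rho> in auto)
    show "(\<lambda>w. (1 - w / of_real \<rho>) powr of_real 1) \<in> O[?F](\<lambda>w. w - of_real \<rho>)"
    proof (rule landau_o.bigI[of "1 / \<rho>"])
      show "\<forall>\<^sub>F w in ?F. norm ((1 - w / of_real \<rho>) powr of_real 1) \<le> 1 / \<rho> * norm (w - of_real \<rho>)"
      proof (rule always_eventually, rule allI)
        fix w :: complex
        have "1 - w / of_real \<rho> = - (w - of_real \<rho>) / of_real \<rho>" using \<rho> by (simp add: field_simps)
        then have "norm (1 - w / of_real \<rho>) = norm (w - of_real \<rho>) / \<rho>"
          using \<rho> by (simp only: norm_divide norm_minus_cancel) simp
        then show "norm ((1 - w / of_real \<rho>) powr of_real 1) \<le> 1 / \<rho> * norm (w - of_real \<rho>)"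
          using \<rho> by (subst norm_powr_real_powr') auto
      qed
    qed (use \<rho> in auto)
  qed
  with O have 1: "(\<lambda>w. \<phi> w - poly P (1 - w / of_real \<rho>)) \<in> o[?F](\<lambda>w. w - of_real \<rho>)"
    by (rule landau_o.big_small_trans)
  have "((\<lambda>w. poly P (1 - w / of_real \<rho>)) has_field_derivative E) (at (of_real \<rho>) within half_disc \<rho> \<epsilon>)"
    unfolding E_def using \<rho>
    by (auto intro!: derivative_eq_intros poly_DERIV[THEN DERIV_chain2] simp: field_simps)
  then have "((\<lambda>w. (poly P (1 - w / of_real \<rho>) - C) / (w - of_real \<rho>)) \<longlongrightarrow> E) ?F"
    using \<rho> by (simp add: has_field_derivative_iff C_def)
  then have "((\<lambda>w. (poly P (1 - w / of_real \<rho>) - C) / (w - of_real \<rho>) - E) \<longlongrightarrow> 0) ?F"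
    by (simp add: LIM_zero_iff)
  then have "((\<lambda>w. (poly P (1 - w / of_real \<rho>) - C - E * (w - of_real \<rho>)) / (w - of_real \<rho>)) \<longlongrightarrow> 0) ?F"
    by (rule Lim_transform_eventually)
       (use ne in eventually_elim, simp add: diff_divide_distrib)
  then have 2: "(\<lambda>w. poly P (1 - w / of_real \<rho>) - C - E * (w - of_real \<rho>)) \<in> o[?F](\<lambda>w. w - of_real \<rho>)"
    by (rule smalloI_tendsto) (use ne in eventually_elim, simp)
  have o: "(\<lambda>w. \<phi> w - C - E * (w - of_real \<rho>)) \<in> o[?F](\<lambda>w. w - of_real \<rho>)"
  proof -
    have "(\<lambda>w. (\<phi> w - poly P (1 - w / of_real \<rho>)) + (poly P (1 - w / of_real \<rho>) - C - E * (w - of_real \<rho>)))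
        = (\<lambda>w. \<phi> w - C - E * (w - of_real \<rho>))" by (intro ext) simp
    with sum_in_smallo(1)[OF 1 2] show ?thesis by (simp only:)
  qed
  have "((\<lambda>w. (\<phi> w - C - E * (w - of_real \<rho>)) / (w - of_real \<rho>)) \<longlongrightarrow> 0) ?F"
    by (rule smalloD_tendsto[OF o])
  from filterlim_compose[OF this filterlim_of_real_half_disc[OF \<rho> *(1)]]
  have q: "((\<lambda>x. (\<phi> (?x x) - C - E * (?x x - of_real \<rho>)) / (?x x - of_real \<rho>)) \<longlongrightarrow> 0) (at_left 1)" .
  have x1: "((\<lambda>x. ?x x - of_real \<rho>) \<longlongrightarrow> 0) (at_left 1)"
    by (rule tendsto_eq_intros refl | simp)+
  have evx: "\<forall>\<^sub>F x in at_left 1. ?x x - of_real \<rho> \<noteq> 0"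
    using eventually_at_left_1_unit by eventually_elim (use \<rho> in auto)
  have "((\<lambda>x. (\<phi> (?x x) - C - E * (?x x - of_real \<rho>)) / (?x x - of_real \<rho>) + E) \<longlongrightarrow> 0 + E) (at_left 1)"
    by (intro tendsto_intros q)
  then have quot: "((\<lambda>x. (\<phi> (?x x) - C) / (?x x - of_real \<rho>)) \<longlongrightarrow> E) (at_left 1)"
    unfolding add_0 by (rule Lim_transform_eventually)
       (use evx in eventually_elim, simp add: diff_divide_distrib)
  have "((\<lambda>x. (\<phi> (?x x) - C) / (?x x - of_real \<rho>) * (?x x - of_real \<rho>) + C) \<longlongrightarrow> E * 0 + C) (at_left 1)"
    by (intro tendsto_intros quot x1)
  then have "((\<lambda>x. \<phi> (?x x)) \<longlongrightarrow> C) (at_left 1)"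
    unfolding mult_zero_right add_0 by (rule Lim_transform_eventually)
       (use evx in eventually_elim, simp)
  from disc_sums_limit[OF _ *(3) this] nn \<rho>
  have C: "(\<lambda>n. fps_nth f n * \<rho> ^ n) sums Re C" "C = of_real (Re C)" by auto
  define b where "b n = fps_nth f n * \<rho> ^ n" for n
  have b: "0 \<le> b n" for n using nn \<rho> by (simp add: b_def)
  \<comment> \<open>The difference quotient of a monomial between \<open>x\<close> and 1 is a
    geometric sum with nonnegative terms. It increases to \<open>n\<close>, the weight in the
    differentiated series, so \<open>sums_monotone_limit\<close> applies.\<close>
  have S: "(\<lambda>n. complex_of_real (b n * (\<Sum>i<n. x ^ i))) sums (of_real \<rho> * ((\<phi> (?x x) - C) / (?x x - of_real \<rho>)))"
    if x: "0 < x" "x < 1" for x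
  proof -
    have "(\<lambda>n. complex_of_real (b n * x ^ n)) sums \<phi> (?x x)"
      using disc_sums_of_real[OF *(3) x] by (simp add: b_def)
    moreover have "(\<lambda>n. complex_of_real (b n)) sums C"
      using sums_of_real[OF C(1), where 'a = complex] C(2) by (simp add: b_def)
    ultimately have "(\<lambda>n. (complex_of_real (b n * x ^ n) - of_real (b n)) / (of_real x - 1)) sums ((\<phi> (?x x) - C) / (of_real x - 1))"
      by (intro sums_divide sums_diff)
    moreover have "(complex_of_real (b n * x ^ n) - of_real (b n)) / (of_real x - 1) = complex_of_real (b n * (\<Sum>i<n. x ^ i))" for n
    proof -
      have "b n * (x ^ n - 1) = (b n * (\<Sum>i<n. x ^ i)) * (x - 1)"
        using power_diff_1_eq[of x n] by simp
      then have "complex_of_real (b n * (x ^ n - 1)) = complex_of_real ((b n * (\<Sum>i<n. x ^ i)) * (x - 1))"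
        by (simp only:)
      then have "complex_of_real (b n * x ^ n) - of_real (b n) = complex_of_real (b n * (\<Sum>i<n. x ^ i)) * (of_real x - 1)"
        by (simp add: right_diff_distrib)
      then show ?thesis using x by simp
    qed
    moreover have "(\<phi> (?x x) - C) / (of_real x - 1) = of_real \<rho> * ((\<phi> (?x x) - C) / (?x x - of_real \<rho>))"
    proof -
      have "?x x - of_real \<rho> = of_real \<rho> * (of_real x - 1)" by (simp add: algebra_simps)
      then show ?thesis using \<rho> by simp
    qed
    ultimately show ?thesis by simp
  qed
  have limE: "((\<lambda>x. of_real \<rho> * ((\<phi> (?x x) - C) / (?x x - of_real \<rho>))) \<longlongrightarrow> of_real \<rho> * E) (at_left 1)"
    by (intro tendsto_intros quot)
  have "(\<lambda>n. b n * real n) sums Re (of_real \<rho> * E)"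
  proof (rule sums_monotone_limit[where a = "\<lambda>x n. b n * (\<Sum>i<n. x ^ i)"])
    show "0 \<le> b n * (\<Sum>i<n. x ^ i) \<and> b n * (\<Sum>i<n. x ^ i) \<le> b n * real n" if "0 < x" "x < 1" for x n
    proof -
      have "(\<Sum>i<n. x ^ i) \<le> (\<Sum>i<n. 1)" using that by (intro sum_mono power_le_one) auto
      moreover have "0 \<le> (\<Sum>i<n. x ^ i)" using that by (intro sum_nonneg) auto
      ultimately show ?thesis using b[of n] by (auto intro: mult_left_mono)
    qed
    show "((\<lambda>x. b n * (\<Sum>i<n. x ^ i)) \<longlongrightarrow> b n * real n) (at_left 1)" for n
      by (rule tendsto_eq_intros refl | simp)+
    show "((\<lambda>x. Re (of_real \<rho> * ((\<phi> (?x x) - C) / (?x x - of_real \<rho>)))) \<longlongrightarrow> Re (of_real \<rho> * E)) (at_left 1)"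
      by (intro tendsto_Re limE)
    show "(\<lambda>n. b n * (\<Sum>i<n. x ^ i)) sums Re (of_real \<rho> * ((\<phi> (?x x) - C) / (?x x - of_real \<rho>)))" if "0 < x" "x < 1" for x
      using sums_Re[OF S[OF that]] by (simp only: Re_complex_of_real)
  qed
  from sums_divide[OF this, of \<rho>]
  have D: "(\<lambda>n. b n * real n / \<rho>) sums Re E" using \<rho> by simp
  have "b n * real n / \<rho> = real n * fps_nth f n * \<rho> ^ (n - 1)" for n
    using \<rho> by (cases n) (auto simp: b_def)
  with D have D: "(\<lambda>n. real n * fps_nth f n * \<rho> ^ (n - 1)) sums Re E" by simp
  have "of_real \<rho> * E = of_real (Re (of_real \<rho> * E))"
  proof (rule tendsto_real_valued[OF limE])
    fix x :: real assume "0 < x" "x < 1"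
    then show "Im (of_real \<rho> * ((\<phi> (?x x) - C) / (?x x - of_real \<rho>))) = 0"
      using sums_Im[OF S] by (auto simp: sums_iff)
  qed
  then have "E = of_real (Re E)" using \<rho> by (simp add: complex_eq_iff)
  with C(2) o have "(\<lambda>w. \<phi> w - of_real (Re C) - of_real (Re E) * (w - of_real \<rho>)) \<in> o[?F](\<lambda>w. w - of_real \<rho>)"
    by simp
  from that[OF *(1-3) C(1) D this] show thesis .
qed

text \<open>Real parts in the half disc are strictly below \<open>\<rho>\<close>, so
  \<open>\<psi>\<close> omits \<open>\<rho>\<close> itself, as the punctured filter
  requires.\<close>

lemma sing_exp_half_disc:
  assumes \<psi>: "sing_exp \<kappa> \<psi> (of_real \<rho>) A a" "0 < a" "\<psi> ` dented_disc \<kappa> \<subseteq> half_disc \<rho> \<epsilon>"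
  shows "filterlim \<psi> (at (of_real \<rho>) within half_disc \<rho> \<epsilon>) (one_filter \<kappa>)"
  unfolding filterlim_at
proof
  show "\<forall>\<^sub>F z in one_filter \<kappa>. \<psi> z \<in> half_disc \<rho> \<epsilon> \<and> \<psi> z \<noteq> of_real \<rho>"
    using eventually_in_dented_disc
  proof eventually_elim
    case (elim z)
    then have "\<psi> z \<in> half_disc \<rho> \<epsilon>" using \<psi>(3) by auto
    then show ?case by (auto simp: half_disc_def)
  qed
  show "(\<psi> \<longlongrightarrow> of_real \<rho>) (one_filter \<kappa>)" by (rule sing_exp_tendsto[OF \<psi>(1,2)])
qed

lemma holomorphic_on_compose_half_disc:
  assumes "sing_exp \<kappa> \<psi> C A a" "\<psi> ` dented_disc \<kappa> \<subseteq> half_disc \<rho> \<epsilon>" "\<phi> holomorphic_on half_disc \<rho> \<epsilon>"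
  shows "(\<lambda>z. \<phi> (\<psi> z)) holomorphic_on dented_disc \<kappa>"
  using assms holomorphic_on_compose_gen[of \<psi> "dented_disc \<kappa>" \<phi> "half_disc \<rho> \<epsilon>"]
  by (simp add: sing_exp_def o_def)

lemma sing_exp_compose_linear:
  assumes \<psi>: "sing_exp \<kappa> \<psi> (of_real \<rho>) A a" "0 < a" "\<psi> ` dented_disc \<kappa> \<subseteq> half_disc \<rho> \<epsilon>"
    and \<phi>: "\<phi> holomorphic_on half_disc \<rho> \<epsilon>"
    "(\<lambda>w. \<phi> w - \<tau> - D * (w - of_real \<rho>)) \<in> o[at (of_real \<rho>) within half_disc \<rho> \<epsilon>](\<lambda>w. w - of_real \<rho>)"
  shows "sing_exp \<kappa> (\<lambda>z. \<phi> (\<psi> z)) \<tau> (D * A) a"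
proof -
  let ?P = "\<lambda>z. (1 - z) powr complex_of_real a"
  have "(\<lambda>z. \<phi> (\<psi> z) - \<tau> - D * (\<psi> z - of_real \<rho>)) \<in> o[one_filter \<kappa>](\<lambda>z. \<psi> z - of_real \<rho>)"
    by (rule landau_o.small.compose[OF \<phi>(2) sing_exp_half_disc[OF \<psi>]])
  from landau_o.small_big_trans[OF this sing_exp_diff_bigo[OF \<psi>(1)]]
  have 1: "(\<lambda>z. \<phi> (\<psi> z) - \<tau> - D * (\<psi> z - of_real \<rho>)) \<in> o[one_filter \<kappa>](?P)" .
  have 2: "(\<lambda>z. D * (\<psi> z - of_real \<rho> - A * ?P z)) \<in> o[one_filter \<kappa>](?P)"
    using \<psi>(1) by (simp add: sing_exp_def)
  have "(\<lambda>z. (\<phi> (\<psi> z) - \<tau> - D * (\<psi> z - of_real \<rho>)) + D * (\<psi> z - of_real \<rho> - A * ?P z))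
      = (\<lambda>z. \<phi> (\<psi> z) - \<tau> - D * A * ?P z)"
    by (intro ext) (simp add: algebra_simps)
  with sum_in_smallo(1)[OF 1 2] have "(\<lambda>z. \<phi> (\<psi> z) - \<tau> - D * A * ?P z) \<in> o[one_filter \<kappa>](?P)"
    by (simp only:)
  with holomorphic_on_compose_half_disc[OF \<psi>(1,3) \<phi>(1)] \<psi>(1) show ?thesis
    by (simp only: sing_exp_def)
qed

lemma sing_exp_compose_powr:
  assumes \<psi>: "sing_exp \<kappa> \<psi> (of_real \<rho>) A a" "0 < a" "\<psi> ` dented_disc \<kappa> \<subseteq> half_disc \<rho> \<epsilon>"
    and \<phi>: "\<phi> holomorphic_on half_disc \<rho> \<epsilon>"
    "(\<lambda>w. \<phi> w - \<tau>) \<in> O[at (of_real \<rho>) within half_disc \<rho> \<epsilon>](\<lambda>w. (1 - w / of_real \<rho>) powr of_real lam)"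
    and "0 < \<rho>" "0 < lam" "b < lam * a"
  shows "sing_exp \<kappa> (\<lambda>z. \<phi> (\<psi> z)) \<tau> 0 b"
proof -
  let ?P = "\<lambda>a z. (1 - z) powr complex_of_real a"
  have 1: "(\<lambda>z. \<phi> (\<psi> z) - \<tau>) \<in> O[one_filter \<kappa>](\<lambda>z. (1 - \<psi> z / of_real \<rho>) powr of_real lam)"
    by (rule landau_o.big.compose[OF \<phi>(2) sing_exp_half_disc[OF \<psi>]])
  have "(\<lambda>z. (- 1 / of_real \<rho>) * (\<psi> z - of_real \<rho>)) \<in> O[one_filter \<kappa>](?P a)"
    using sing_exp_diff_bigo[OF \<psi>(1)] by (intro landau_o.big.cmult_in_iff[THEN iffD2]) (use assms in auto)
  also have "(\<lambda>z. (- 1 / of_real \<rho>) * (\<psi> z - of_real \<rho>)) = (\<lambda>z. 1 - \<psi> z / of_real \<rho>)"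
    using assms by (intro ext) (simp add: field_simps)
  finally have 2: "(\<lambda>z. (1 - \<psi> z / of_real \<rho>) powr of_real lam) \<in> O[one_filter \<kappa>](\<lambda>z. ?P a z powr of_real lam)"
    using assms by (intro powr_of_real_bigo) auto
  \<comment> \<open>Only moduli are compared, for which real exponents multiply; no branch of the
    complex power has to be tracked.\<close>
  have 3: "(\<lambda>z. ?P a z powr of_real lam) \<in> O[one_filter \<kappa>](?P (lam * a))"
    by (rule landau_o.bigI[of 1]) (auto intro!: always_eventually simp: norm_powr_real_powr' powr_powr mult.commute)
  have 4: "?P (lam * a) \<in> o[one_filter \<kappa>](?P b)"
    using assms by (intro one_minus_powr_smallo) auto
  have "(\<lambda>z. \<phi> (\<psi> z) - \<tau>) \<in> o[one_filter \<kappa>](?P b)"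
    by (rule landau_o.big_small_trans[OF landau_o.big_trans[OF landau_o.big_trans[OF 1 2] 3] 4])
  with holomorphic_on_compose_half_disc[OF \<psi>(1,3) \<phi>(1)] \<psi>(1) show ?thesis
    by (simp add: sing_exp_def)
qed

lemma sing_exp_const_1:
  assumes "0 < \<kappa>" "\<kappa> \<le> 1/2"
  shows "sing_exp \<kappa> (\<lambda>z. 1) 1 0 a"
  using assms by (simp add: sing_exp_def)

text \<open>The factor \<open>k * C ^ (k - 1)\<close>, the derivative of a power, is the origin of
  the size-biased weights.\<close>

lemma sing_exp_power:
  assumes \<psi>: "sing_exp \<kappa> \<psi> C A a" and a: "0 < a"
  shows "sing_exp \<kappa> (\<lambda>z. \<psi> z ^ k) (C ^ k) (of_nat k * C ^ (k - 1) * A) a"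
proof (induction k)
  case 0
  then show ?case using sing_exp_const_1 \<psi> by (simp add: sing_exp_def)
next
  case (Suc k)
  have "C * (of_nat k * C ^ (k - 1) * A) + C ^ k * A = of_nat (Suc k) * C ^ (Suc k - 1) * A"
    by (cases k) (auto simp: algebra_simps)
  with sing_exp_mult[OF \<psi> Suc a] show ?case by simp
qed

text \<open>The factor with the smaller exponent carries the singularity, and \<open>f\<close>
  enters through its value \<open>C\<close> alone. For \<open>a > 0\<close> the product rule applies
  after weakening \<open>f\<close>; for \<open>a < 0\<close> the constant of \<open>g\<close> is 0
  and the limit of \<open>f\<close> suffices.\<close>

lemma sing_exp_mult_dominated:
  assumes f: "sing_exp \<kappa> f C A b" "0 < b" and g: "sing_exp \<kappa> g E B a" "a < b" "a < 0 \<longrightarrow> E = 0" "a \<noteq> 0"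
  shows "\<exists>E'. sing_exp \<kappa> (\<lambda>z. f z * g z) E' (C * B) a"
proof (cases "0 < a")
  case True
  from sing_exp_mult[OF sing_exp_weaken[OF f(1) g(2)] g(1) True] show ?thesis by auto
next
  case False
  then have "E = 0" using g by auto
  moreover have "f holomorphic_on dented_disc \<kappa>" using f by (simp add: sing_exp_def)
  ultimately show ?thesis using sing_exp_mult_tendsto[OF _ sing_exp_tendsto[OF f]] g(1) by blast
qed

text \<open>Both sequences are rescaled by the same power of \<open>n\<close>, and
  \<open>rGamma (- a)\<close> cancels; it is nonzero because \<open>a\<close> is not a natural
  number. The case \<open>A = 0\<close> is included.\<close>

lemma sing_exp_coeff_ratio:
  assumes f: "sing_exp \<kappa> f C (of_real A) a" "disc_sums c f"
    and g: "sing_exp \<kappa> g D (of_real B) a" "disc_sums d g"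
    and a: "a < 1" "a \<notin> \<nat>" and B: "B \<noteq> 0"
  shows "(\<lambda>n. c n / d n) \<longlonglongrightarrow> A / B"
proof -
  have lim: "(\<lambda>n. c n * real n powr (a + 1)) \<longlonglongrightarrow> A * rGamma (- a)"
    if f: "sing_exp \<kappa> f C (of_real A) a" "disc_sums c f" for f c C A
  proof -
    have "(\<lambda>n. complex_of_real (c n) * of_real (real n powr (a + 1))) \<longlonglongrightarrow> of_real A * rGamma (- of_real a)"
      using f(2) by (intro transfer_sing_exp[OF f(1) a(1)]) (auto simp: disc_sums_def)
    then have "(\<lambda>n. complex_of_real (c n * real n powr (a + 1))) \<longlonglongrightarrow> of_real (A * rGamma (- a))"
      using rGamma_complex_of_real[of "- a"] by simp
    then show ?thesis by (simp only: tendsto_of_real_iff)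
  qed
  have rG: "rGamma (- a) \<noteq> 0"
  proof
    assume "rGamma (- a) = 0"
    then have "- a \<in> \<int>\<^sub>\<le>\<^sub>0" by (simp add: rGamma_eq_zero_iff)
    then have "a \<in> \<nat>" by (auto elim!: nonpos_Ints_cases' simp: minus_equation_iff)
    then show False using a by simp
  qed
  have "(\<lambda>n. (c n * real n powr (a + 1)) / (d n * real n powr (a + 1))) \<longlonglongrightarrow> (A * rGamma (- a)) / (B * rGamma (- a))"
    using B rG by (intro tendsto_divide lim[OF f] lim[OF g]) auto
  moreover have "eventually (\<lambda>n. (c n * real n powr (a + 1)) / (d n * real n powr (a + 1)) = c n / d n) sequentially"
    using eventually_gt_at_top[of 0] by eventually_elim simp
  ultimately have "(\<lambda>n. c n / d n) \<longlonglongrightarrow> (A * rGamma (- a)) / (B * rGamma (- a))"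
    by (rule Lim_transform_eventually)
  then show ?thesis using rG by simp
qed

section \<open>Power series of composed functions\<close>

text \<open>The series of \<open>f (\<rho> * z)\<close> over the complex numbers. With
  \<open>\<rho> = 1\<close> it is just the embedding of real into complex series.\<close>

definition fps_scale :: "real \<Rightarrow> real fps \<Rightarrow> complex fps" where
  "fps_scale \<rho> f = Abs_fps (\<lambda>n. of_real (fps_nth f n * \<rho> ^ n))"

lemma fps_scale_mult: "fps_scale \<rho> (f * g) = fps_scale \<rho> f * fps_scale \<rho> g"
proof (rule fps_ext)
  fix n
  have "fps_nth f i * fps_nth g (n - i) * \<rho> ^ n = (fps_nth f i * \<rho> ^ i) * (fps_nth g (n - i) * \<rho> ^ (n - i))"
    if "i \<in> {0..n}" for i
    using that by (simp add: power_add[symmetric])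
  then have "(\<Sum>i = 0..n. fps_nth f i * fps_nth g (n - i) * \<rho> ^ n)
      = (\<Sum>i = 0..n. (fps_nth f i * \<rho> ^ i) * (fps_nth g (n - i) * \<rho> ^ (n - i)))"
    by (intro sum.cong) auto
  then show "fps_nth (fps_scale \<rho> (f * g)) n = fps_nth (fps_scale \<rho> f * fps_scale \<rho> g) n"
    by (simp add: fps_scale_def fps_mult_nth sum_distrib_right flip: of_real_mult of_real_sum of_real_power)
qed

lemma fps_scale_power: "fps_scale \<rho> (f ^ i) = fps_scale \<rho> f ^ i"
proof (induction i)
  case 0
  show ?case by (rule fps_ext) (simp add: fps_scale_def)
qed (simp add: fps_scale_mult)

lemma fps_scale_compose: "fps_scale \<rho> (g oo f) = fps_scale 1 g oo fps_scale \<rho> f"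
proof (rule fps_ext)
  fix n
  have "fps_nth (fps_scale \<rho> f ^ i) n = of_real (fps_nth (f ^ i) n * \<rho> ^ n)" for i
    unfolding fps_scale_power[symmetric] by (simp add: fps_scale_def)
  then show "fps_nth (fps_scale \<rho> (g oo f)) n = fps_nth (fps_scale 1 g oo fps_scale \<rho> f) n"
    by (simp add: fps_compose_nth) (simp add: fps_scale_def fps_compose_nth sum_distrib_left mult_ac)
qed

lemma disc_sums_has_fps_expansion:
  assumes "disc_sums (\<lambda>n. fps_nth f n * \<rho> ^ n) \<psi>"
  shows "\<psi> has_fps_expansion fps_scale \<rho> f"
proof (rule has_fps_expansionI)
  have "eventually (\<lambda>z::complex. z \<in> ball 0 1) (nhds 0)" by (intro eventually_nhds_in_open) auto
  then show "\<forall>\<^sub>F u in nhds 0. (\<lambda>n. fps_nth (fps_scale \<rho> f) n * u ^ n) sums \<psi> u"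
    by eventually_elim (use assms in \<open>auto simp: disc_sums_def fps_scale_def\<close>)
qed

text \<open>In a composition only the inner variable is rescaled; the outer function is evaluated at
  unscaled values, so its scaling is undone.\<close>

lemma disc_sums_has_fps_expansion_unscaled:
  assumes "0 < \<rho>" "disc_sums (\<lambda>n. fps_nth f n * \<rho> ^ n) (\<lambda>z. \<phi> (of_real \<rho> * z))"
  shows "\<phi> has_fps_expansion fps_scale 1 f"
proof (rule has_fps_expansionI)
  have "eventually (\<lambda>z::complex. z \<in> ball 0 \<rho>) (nhds 0)" using assms by (intro eventually_nhds_in_open) auto
  then show "\<forall>\<^sub>F u in nhds 0. (\<lambda>n. fps_nth (fps_scale 1 f) n * u ^ n) sums \<phi> u"
  proof eventually_elim
    case (elim u)
    then have "norm (u / of_real \<rho>) < 1" using assms by (simp add: norm_divide)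
    with assms have "(\<lambda>n. complex_of_real (fps_nth f n * \<rho> ^ n) * (u / of_real \<rho>) ^ n) sums \<phi> (of_real \<rho> * (u / of_real \<rho>))"
      unfolding disc_sums_def by blast
    then show ?case using assms by (simp add: fps_scale_def power_divide)
  qed
qed

text \<open>Formal composition determines the germ at 0; holomorphy on the unit disc then makes the
  resulting series converge to the function on the whole disc.\<close>

lemma disc_sums_compose:
  assumes \<phi>: "\<phi> has_fps_expansion fps_scale 1 g"
    and \<psi>: "disc_sums (\<lambda>n. fps_nth f n * \<rho> ^ n) \<psi>" "fps_nth f 0 = 0"
    and \<mu>: "disc_sums (\<lambda>n. fps_nth m n * \<rho> ^ n) \<mu>"
    and hol: "(\<lambda>z. \<phi> (\<psi> z)) holomorphic_on ball 0 1" "\<mu> holomorphic_on ball 0 1"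
  shows "disc_sums (\<lambda>n. fps_nth ((g oo f) * m) n * \<rho> ^ n) (\<lambda>z. \<phi> (\<psi> z) * \<mu> z)"
  unfolding disc_sums_def
proof (intro allI impI)
  fix z :: complex assume z: "norm z < 1"
  have "(\<phi> \<circ> \<psi>) has_fps_expansion (fps_scale 1 g oo fps_scale \<rho> f)"
    by (rule has_fps_expansion_compose[OF \<phi> disc_sums_has_fps_expansion[OF \<psi>(1)]])
       (simp add: fps_scale_def \<psi>(2))
  from has_fps_expansion_mult[OF this disc_sums_has_fps_expansion[OF \<mu>]]
  have "(\<lambda>z. \<phi> (\<psi> z) * \<mu> z) has_fps_expansion fps_scale \<rho> ((g oo f) * m)"
    by (simp add: fps_scale_mult fps_scale_compose)
  moreover have "(\<lambda>z. \<phi> (\<psi> z) * \<mu> z) holomorphic_on eball 0 (ereal 1)"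
    using holomorphic_on_mult[OF hol] by (simp only: eball_ereal)
  ultimately have "(\<lambda>n. fps_nth (fps_scale \<rho> ((g oo f) * m)) n * z ^ n) sums (\<phi> (\<psi> z) * \<mu> z)"
    by (rule has_fps_expansion_imp_sums_complex) (use z in simp)
  then show "(\<lambda>n. complex_of_real (fps_nth ((g oo f) * m) n * \<rho> ^ n) * z ^ n) sums (\<phi> (\<psi> z) * \<mu> z)"
    by (simp add: fps_scale_def)
qed

section \<open>Coefficients of the scheme and limit laws\<close>

lemma fps_lift_poly_nth [simp]: "fps_nth (fps_lift_poly f) n = [:fps_nth f n:]"
  by (simp add: fps_lift_poly_def)

lemma sum_const_poly: "(\<Sum>i\<in>A. [:f i:]) = [:\<Sum>i\<in>A. f i:]"
  by (rule poly_eqI) (simp add: coeff_sum coeff_pCons split: nat.splits)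

lemma fps_lift_poly_mult: "fps_lift_poly (f * g) = fps_lift_poly f * fps_lift_poly g"
  by (rule fps_ext) (simp add: fps_mult_nth sum_const_poly mult.commute)

lemma fps_lift_poly_power: "fps_lift_poly (f ^ i) = fps_lift_poly f ^ i"
proof (induction i)
  case 0
  show ?case by (rule fps_ext) (auto simp: one_pCons)
qed (simp add: fps_lift_poly_mult)

lemma composition_inner_nth:
  "fps_nth (fps_lift_poly G oo (fps_const [:0, 1:] * fps_lift_poly H)) n =
     (\<Sum>i = 0..n. monom (fps_nth G i * fps_nth (H ^ i) n) i)"
proof -
  have "(fps_const [:0, 1:] * fps_lift_poly H) ^ i = fps_const (monom 1 i) * fps_lift_poly (H ^ i)" for i
    by (simp add: power_mult_distrib fps_lift_poly_power fps_const_power monom_altdef)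
  then show ?thesis
    by (simp add: fps_compose_nth mult_monom smult_monom)
qed

lemma composition_gf_nth:
  "fps_nth (composition_gf G H M) n =
     (\<Sum>j = 0..n. (\<Sum>i = 0..j. monom (fps_nth G i * fps_nth (H ^ i) j) i) * [:fps_nth M (n - j):])"
  unfolding composition_gf_def fps_mult_nth composition_inner_nth fps_lift_poly_nth ..

lemma poly_composition_gf:
  "poly (fps_nth (composition_gf G H M) n) 1 = fps_nth ((G oo H) * M) n"
  unfolding composition_gf_nth fps_mult_nth fps_compose_nth
  by (simp add: poly_sum poly_monom mult.commute)

lemma coeff_composition_gf:
  assumes "fps_nth H 0 = 0"
  shows "coeff (fps_nth (composition_gf G H M) n) k = fps_nth G k * fps_nth (H ^ k * M) n"
proof -
  have "coeff (\<Sum>i = 0..j. monom (fps_nth G i * fps_nth (H ^ i) j) i) k = fps_nth G k * fps_nth (H ^ k) j" for j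
  proof -
    have "coeff (\<Sum>i = 0..j. monom (fps_nth G i * fps_nth (H ^ i) j) i) k
        = (if k \<le> j then fps_nth G k * fps_nth (H ^ k) j else 0)"
      by (simp add: coeff_sum)
    also have "\<dots> = fps_nth G k * fps_nth (H ^ k) j"
      \<comment> \<open>For \<open>k > j\<close> the coefficient of \<open>H ^ k\<close> vanishes
        because \<open>H\<close> starts at index 1, so the truncation of the sum at \<open>j\<close>
        loses nothing.\<close>
      using startsby_zero_power_prefix[OF assms, of k] by simp
    finally show ?thesis .
  qed
  moreover have "coeff (p * [:c:]) k = coeff p k * c" for p :: "real poly" and c
    by (simp add: mult.commute)
  ultimately show ?thesis
    unfolding composition_gf_nth fps_mult_nth coeff_sum[of _ "{0..n}"]
    by (simp only:) (simp add: sum_distrib_left mult_ac)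
qed

lemma core_size_prob_eq:
  assumes "fps_nth H 0 = 0"
  shows "core_size_prob G H M n k = fps_nth G k * (fps_nth (H ^ k * M) n / fps_nth ((G oo H) * M) n)"
  by (simp add: core_size_prob_def poly_composition_gf coeff_composition_gf[OF assms])

lemma pmf_embed_pmf_nat:
  fixes f :: "nat \<Rightarrow> real"
  assumes "\<And>j. 0 \<le> f j" "f sums 1"
  shows "pmf (embed_pmf f) k = f k"
proof (rule pmf_embed_pmf)
  show "(\<integral>\<^sup>+ x. ennreal (f x) \<partial>count_space UNIV) = 1"
    using suminf_ennreal_eq[OF assms] by (simp add: nn_integral_count_space_nat)
qed (use assms in auto)

text \<open>Conditioned on the Bernoulli variable, the map is a projection of the independent pair.
  The subtraction on \<open>nat\<close> is harmless, as \<open>of_bool\<close> is 0 or 1.\<close>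

lemma pmf_bernoulli_mixture:
  fixes A B :: "nat pmf"
  assumes "0 \<le> p" "p \<le> 1"
  shows "pmf (map_pmf (\<lambda>(i, a, b). of_bool i * a + (1 - of_bool i) * b)
           (pair_pmf (bernoulli_pmf p) (pair_pmf A B))) k = p * pmf A k + (1 - p) * pmf B k"
proof -
  define F where "F = (\<lambda>(i, a, b). of_bool i * a + (1 - of_bool i) * b :: nat)"
  have "map_pmf F (pair_pmf (bernoulli_pmf p) (pair_pmf A B)) =
      bernoulli_pmf p \<bind> (\<lambda>i. map_pmf (\<lambda>ab. F (i, ab)) (pair_pmf A B))"
    by (subst pair_pmf_def) (simp add: map_bind_pmf map_pmf_def bind_assoc_pmf bind_return_pmf)
  also have "(\<lambda>i. map_pmf (\<lambda>ab. F (i, ab)) (pair_pmf A B)) = (\<lambda>i. if i then A else B)"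
  proof
    fix i
    have "(\<lambda>ab. F (i, ab)) = (if i then fst else snd)"
      by (auto simp: F_def)
    then show "map_pmf (\<lambda>ab. F (i, ab)) (pair_pmf A B) = (if i then A else B)"
      by (simp add: map_fst_pair_pmf map_snd_pair_pmf)
  qed
  finally show ?thesis
    using assms unfolding F_def[symmetric] by (simp add: pmf_bind)
qed

section \<open>Limits of the core size probabilities\<close>

lemma core_size_prob_limit:
  assumes \<rho>: "0 < \<rho>" and h0: "fps_nth H 0 = 0"
    and \<psi>: "\<psi> holomorphic_on ball 0 1" "disc_sums (\<lambda>n. fps_nth H n * \<rho> ^ n) \<psi>"
    and \<phi>: "\<phi> has_fps_expansion fps_scale 1 G" "(\<lambda>z. \<phi> (\<psi> z)) holomorphic_on ball 0 1"
    and \<mu>: "\<mu> holomorphic_on ball 0 1" "disc_sums (\<lambda>n. fps_nth M n * \<rho> ^ n) \<mu>"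
    and A: "sing_exp \<kappa> (\<lambda>z. \<psi> z ^ k * \<mu> z) E (of_real A) a"
    and B: "sing_exp \<kappa> (\<lambda>z. \<phi> (\<psi> z) * \<mu> z) E' (of_real B) a"
    and a: "a < 1" "a \<notin> \<nat>" "B \<noteq> 0"
  shows "(\<lambda>n. core_size_prob G H M n k) \<longlonglongrightarrow> fps_nth G k * (A / B)"
proof -
  \<comment> \<open>\<open>H ^ k * M\<close> is treated as the scheme with outer function
    \<open>w ^ k\<close>, so \<open>disc_sums_compose\<close> serves numerator and denominator
    alike.\<close>
  have "fps_scale 1 fps_X = fps_X" by (rule fps_ext) (simp add: fps_scale_def fps_X_def)
  then have "(\<lambda>w. w ^ k) has_fps_expansion fps_scale 1 (fps_X ^ k)"
    unfolding fps_scale_power by (simp add: has_fps_expansion_fps_X_power)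
  from disc_sums_compose[OF this \<psi>(2) h0 \<mu>(2) holomorphic_on_power[OF \<psi>(1)] \<mu>(1)]
  have "disc_sums (\<lambda>n. fps_nth (H ^ k * M) n * \<rho> ^ n) (\<lambda>z. \<psi> z ^ k * \<mu> z)"
    using h0 by (simp add: fps_compose_power[symmetric])
  moreover have "disc_sums (\<lambda>n. fps_nth ((G oo H) * M) n * \<rho> ^ n) (\<lambda>z. \<phi> (\<psi> z) * \<mu> z)"
    by (rule disc_sums_compose[OF \<phi>(1) \<psi>(2) h0 \<mu>(2) \<phi>(2) \<mu>(1)])
  ultimately have "(\<lambda>n. (fps_nth (H ^ k * M) n * \<rho> ^ n) / (fps_nth ((G oo H) * M) n * \<rho> ^ n)) \<longlonglongrightarrow> A / B"
    by (intro sing_exp_coeff_ratio[OF A _ B _ a]) auto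
  then have "(\<lambda>n. fps_nth (H ^ k * M) n / fps_nth ((G oo H) * M) n) \<longlonglongrightarrow> A / B"
    using \<rho> by simp
  then show ?thesis
    unfolding core_size_prob_eq[OF h0] by (intro tendsto_mult tendsto_const)
qed

text \<open>A constant series has infinite radius. The index is at least 1 so that the coefficient
  also survives differentiation; it makes both the value and the derivative of the outer series
  positive.\<close>

lemma fps_conv_radius_finite_imp_coeff:
  fixes f :: "real fps"
  assumes "fps_conv_radius f = ereal \<rho>"
  obtains n where "1 \<le> n" "fps_nth f n \<noteq> 0"
proof -
  have "\<exists>n\<ge>1. fps_nth f n \<noteq> 0"
  proof (rule ccontr)
    assume "\<not> (\<exists>n\<ge>1. fps_nth f n \<noteq> 0)"
    then have "fps_nth f n = fps_nth (fps_const (fps_nth f 0)) n" for n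
      by (cases "n = 0") auto
    then have "f = fps_const (fps_nth f 0)" by (rule fps_ext)
    then have "fps_conv_radius f = \<infinity>" by (metis fps_conv_radius_const)
    then show False using assms by simp
  qed
  then show thesis using that by blast
qed

lemma sums_pos:
  fixes f :: "nat \<Rightarrow> real"
  assumes "f sums s" "\<And>n. 0 \<le> f n" "0 < f m"
  shows "0 < s"
  using suminf_pos_iff[of f] assms by (auto simp: sums_iff)

lemma eval_fps_deriv_sums:
  assumes "(\<lambda>n. real n * fps_nth f n * \<rho> ^ (n - 1)) sums D"
  shows "eval_fps (fps_deriv f) \<rho> = D"
proof -
  have "(\<lambda>n. real (Suc n) * fps_nth f (Suc n) * \<rho> ^ (Suc n - 1)) sums D"
    using assms by (subst sums_Suc_iff) simp
  then show ?thesis by (simp add: eval_fps_def sums_iff)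
qed

text \<open>The last conclusion quantifies over all \<open>\<epsilon>\<close> because the half disc
  available for the outer function is not known yet; \<open>\<kappa>\<close> is shrunk to it
  afterwards.\<close>

lemma critical_inner_series:
  assumes H: "singular_expansion H \<rho> c a" "0 < a" "a < 1" and nn: "\<And>n. 0 \<le> fps_nth H n"
    and r: "eval_fps H \<rho> = r" "0 < r"
  obtains \<kappa> \<psi> where "sing_exp \<kappa> \<psi> (of_real r) (of_real c) a"
    "disc_sums (\<lambda>n. fps_nth H n * \<rho> ^ n) \<psi>" "c < 0"
    "\<forall>\<epsilon>>0. \<exists>\<kappa>'. 0 < \<kappa>' \<and> \<kappa>' \<le> \<kappa> \<and> \<psi> ` dented_disc \<kappa>' \<subseteq> half_disc r \<epsilon>"
proof -
  have \<rho>: "0 < \<rho>" "c \<noteq> 0" using H by (auto simp: singular_expansion_def)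
  obtain \<kappa> \<psi> C where \<psi>: "sing_exp \<kappa> \<psi> C (of_real c) a" "a < 0 \<longrightarrow> C = 0"
    "disc_sums (\<lambda>n. fps_nth H n * \<rho> ^ n) \<psi>"
    by (rule sing_exp_singular_expansion[OF H(1,3)])
  have nn': "0 \<le> fps_nth H n * \<rho> ^ n" for n using nn \<rho> by simp
  have "Re C = r" "C = of_real (Re C)"
    using sing_exp_sums[OF \<psi>(1) H(2) nn' \<psi>(3)] r by (auto simp: eval_fps_def sums_iff)
  then have C: "C = of_real r" by simp
  have c: "c < 0" by (rule sing_exp_coeff_neg[OF \<psi>(1) H(2,3) \<rho>(2) nn' \<psi>(3)])
  have lt: "norm (\<psi> z) < r" if "norm z \<le> 1" "z \<noteq> 1" for z
    using norm_lt_sum_coeffs[OF \<psi>(1) H(2,3) _ nn' \<psi>(3) that] \<rho> C by simp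
  show thesis
  proof (rule that)
    show s: "sing_exp \<kappa> \<psi> (of_real r) (of_real c) a" using \<psi>(1) C by simp
    show "\<forall>\<epsilon>>0. \<exists>\<kappa>'. 0 < \<kappa>' \<and> \<kappa>' \<le> \<kappa> \<and> \<psi> ` dented_disc \<kappa>' \<subseteq> half_disc r \<epsilon>"
      using maps_into_half_disc[OF s H(2,3) c _ r(2) lt] by blast
  qed (use \<psi> c in auto)
qed

lemma sing_exp_holomorphic_ball: "sing_exp \<kappa> f C A a \<Longrightarrow> f holomorphic_on ball 0 1"
  using ball_subset_dented_disc holomorphic_on_subset unfolding sing_exp_def by blast

text \<open>\<open>M\<close> has the strongest singularity, so \<open>H ^ k\<close> and
  \<open>G(H)\<close> count only through their values \<open>r ^ k\<close> and \<open>\<tau>\<close>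
  at the singularity, and \<open>d\<close> cancels.\<close>

lemma core_size_prob_limit_dominated:
  assumes \<rho>: "0 < \<rho>" and h0: "fps_nth H 0 = 0"
    and \<psi>: "sing_exp \<kappa> \<psi> (of_real r) (of_real c) a" "0 < a" "disc_sums (\<lambda>n. fps_nth H n * \<rho> ^ n) \<psi>"
    and \<phi>: "\<phi> has_fps_expansion fps_scale 1 G" "sing_exp \<kappa> (\<lambda>z. \<phi> (\<psi> z)) (of_real \<tau>) B b" "0 < b"
    and \<mu>: "sing_exp \<kappa> \<mu> C (of_real d) l" "l < 0 \<longrightarrow> C = 0" "disc_sums (\<lambda>n. fps_nth M n * \<rho> ^ n) \<mu>"
    and l: "l < a" "l < b" "l < 1" "l \<notin> \<nat>" and nz: "\<tau> \<noteq> 0" "d \<noteq> 0"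
  shows "(\<lambda>n. core_size_prob G H M n k) \<longlonglongrightarrow> fps_nth G k * r ^ k / \<tau>"
proof -
  have l0: "l \<noteq> 0" using l by auto
  obtain E where E: "sing_exp \<kappa> (\<lambda>z. \<phi> (\<psi> z) * \<mu> z) E (of_real (\<tau> * d)) l"
    using sing_exp_mult_dominated[OF \<phi>(2,3) \<mu>(1) l(2) \<mu>(2) l0] by auto
  obtain E' where E': "sing_exp \<kappa> (\<lambda>z. \<psi> z ^ k * \<mu> z) E' (of_real (r ^ k * d)) l"
    using sing_exp_mult_dominated[OF sing_exp_power[OF \<psi>(1,2)] \<psi>(2) \<mu>(1) l(1) \<mu>(2) l0] by auto
  have "(\<lambda>n. core_size_prob G H M n k) \<longlonglongrightarrow> fps_nth G k * ((r ^ k * d) / (\<tau> * d))"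
    by (rule core_size_prob_limit[OF \<rho> h0 sing_exp_holomorphic_ball[OF \<psi>(1)] \<psi>(3) \<phi>(1)
          sing_exp_holomorphic_ball[OF \<phi>(2)] sing_exp_holomorphic_ball[OF \<mu>(1)] \<mu>(3) E' E l(3,4)])
       (use nz in simp)
  then show ?thesis using nz by simp
qed

text \<open>All factors are expanded at the common exponent \<open>a\<close>, and the product rule
  yields the singular coefficients of numerator and denominator. The value \<open>d = 0\<close> is
  allowed and represents an \<open>M\<close> with a weaker singularity or none.\<close>

lemma core_size_prob_limit_linear:
  assumes \<rho>: "0 < \<rho>" and h0: "fps_nth H 0 = 0"
    and \<psi>: "sing_exp \<kappa> \<psi> (of_real r) (of_real c) a" "0 < a" "a < 1" "disc_sums (\<lambda>n. fps_nth H n * \<rho> ^ n) \<psi>"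
    and \<phi>: "\<phi> has_fps_expansion fps_scale 1 G" "sing_exp \<kappa> (\<lambda>z. \<phi> (\<psi> z)) (of_real \<tau>) (of_real (D * c)) a"
    and \<mu>: "sing_exp \<kappa> \<mu> (of_real m) (of_real d) a" "disc_sums (\<lambda>n. fps_nth M n * \<rho> ^ n) \<mu>"
    and nz: "d * \<tau> + c * m * D \<noteq> 0"
  shows "(\<lambda>n. core_size_prob G H M n k) \<longlonglongrightarrow>
    fps_nth G k * ((d * r ^ k + c * m * (real k * r ^ (k - 1))) / (d * \<tau> + c * m * D))"
proof -
  have a: "a \<notin> \<nat>" using \<psi>(2,3) by (auto elim!: Nats_cases)
  have E: "sing_exp \<kappa> (\<lambda>z. \<phi> (\<psi> z) * \<mu> z) (of_real (\<tau> * m)) (of_real (d * \<tau> + c * m * D)) a"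
    using sing_exp_mult[OF \<phi>(2) \<mu>(1) \<psi>(2)] by (simp add: algebra_simps)
  have E': "sing_exp \<kappa> (\<lambda>z. \<psi> z ^ k * \<mu> z) (of_real (r ^ k * m)) (of_real (d * r ^ k + c * m * (real k * r ^ (k - 1)))) a"
    using sing_exp_mult[OF sing_exp_power[OF \<psi>(1,2)] \<mu>(1) \<psi>(2), of k] by (simp add: algebra_simps)
  show ?thesis
    by (rule core_size_prob_limit[OF \<rho> h0 sing_exp_holomorphic_ball[OF \<psi>(1)] \<psi>(4) \<phi>(1)
          sing_exp_holomorphic_ball[OF \<phi>(2)] sing_exp_holomorphic_ball[OF \<mu>(1)] \<mu>(2) E' E \<psi>(3) a nz])
qed

lemma sing_exp_of_larger_exponent:
  assumes "fps_conv_radius M > ereal \<rho> \<or>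
      (\<exists>l. a < l \<and> singular_expansion M \<rho> c l)" "0 < \<rho>" "0 < a" "a < 1"
  obtains \<kappa> \<mu> C where "sing_exp \<kappa> \<mu> C 0 a" "disc_sums (\<lambda>n. fps_nth M n * \<rho> ^ n) \<mu>"
  using assms(1)
proof (elim disjE exE conjE)
  assume "fps_conv_radius M > ereal \<rho>"
  then show thesis by (rule sing_exp_conv_radius_gt[OF _ assms(2,4)]) (rule that)
next
  fix l assume l: "a < l" "singular_expansion M \<rho> c l"
  then have "l \<noteq> 1" by (auto simp: singular_expansion_def)
  then consider "l < 1" | "1 < l" by linarith
  then show thesis
  proof cases
    case 1
    obtain \<kappa> \<mu> C where *: "sing_exp \<kappa> \<mu> C (of_real c) l" "l < 0 \<longrightarrow> C = 0" "disc_sums (\<lambda>n. fps_nth M n * \<rho> ^ n) \<mu>"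
      by (rule sing_exp_singular_expansion[OF l(2) 1])
    show thesis by (rule that[OF sing_exp_weaken[OF *(1) l(1)] *(3)])
  next
    case 2
    show thesis by (rule sing_exp_singular_expansion_gt_1[OF l(2) 2 assms(4)]) (rule that)
  qed
qed


lemma critical_composition_gt_1:
  assumes H: "singular_expansion H \<rho> c a" "0 < a" "a < 1" "\<And>n. 0 \<le> fps_nth H n"
    and r: "eval_fps H \<rho> = r"
    and G: "singular_expansion G r cG lam" "1 < lam" "\<And>n. 0 \<le> fps_nth G n"
  obtains \<kappa> \<psi> \<phi> \<tau> D where "sing_exp \<kappa> \<psi> (of_real r) (of_real c) a"
    "disc_sums (\<lambda>n. fps_nth H n * \<rho> ^ n) \<psi>" "c < 0" "\<phi> has_fps_expansion fps_scale 1 G"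
    "sing_exp \<kappa> (\<lambda>z. \<phi> (\<psi> z)) (of_real \<tau>) (of_real (D * c)) a"
    "(\<lambda>n. fps_nth G n * r ^ n) sums \<tau>" "(\<lambda>n. real n * fps_nth G n * r ^ (n - 1)) sums D"
proof -
  have r0: "0 < r" using G by (simp add: singular_expansion_def)
  obtain \<kappa>0 \<psi> where \<psi>: "sing_exp \<kappa>0 \<psi> (of_real r) (of_real c) a"
    "disc_sums (\<lambda>n. fps_nth H n * \<rho> ^ n) \<psi>" "c < 0"
    and dom: "\<forall>\<epsilon>>0. \<exists>\<kappa>'. 0 < \<kappa>' \<and> \<kappa>' \<le> \<kappa>0 \<and> \<psi> ` dented_disc \<kappa>' \<subseteq> half_disc r \<epsilon>"
    by (rule critical_inner_series[OF H(1-4) r r0])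
  obtain \<epsilon> \<phi> \<tau> D where \<phi>: "0 < \<epsilon>" "\<phi> holomorphic_on half_disc r \<epsilon>"
    "disc_sums (\<lambda>n. fps_nth G n * r ^ n) (\<lambda>z. \<phi> (of_real r * z))"
    "(\<lambda>n. fps_nth G n * r ^ n) sums \<tau>" "(\<lambda>n. real n * fps_nth G n * r ^ (n - 1)) sums D"
    "(\<lambda>w. \<phi> w - of_real \<tau> - of_real D * (w - of_real r))
       \<in> o[at (of_real r) within half_disc r \<epsilon>](\<lambda>w. w - of_real r)"
    by (rule half_disc_expansion_gt_1[OF G])
  obtain \<kappa> where \<kappa>: "0 < \<kappa>" "\<kappa> \<le> \<kappa>0" "\<psi> ` dented_disc \<kappa> \<subseteq> half_disc r \<epsilon>"
    using dom \<phi>(1) by blast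
  have \<psi>': "sing_exp \<kappa> \<psi> (of_real r) (of_real c) a" by (rule sing_exp_mono[OF \<psi>(1) \<kappa>(1,2)])
  have "sing_exp \<kappa> (\<lambda>z. \<phi> (\<psi> z)) (of_real \<tau>) (of_real (D * c)) a"
    using sing_exp_compose_linear[OF \<psi>' H(2) \<kappa>(3) \<phi>(2,6)] by simp
  from that[OF \<psi>' \<psi>(2,3) disc_sums_has_fps_expansion_unscaled[OF r0 \<phi>(3)] this \<phi>(4,5)]
  show thesis .
qed

lemma critical_composition_lt_1:
  assumes H: "singular_expansion H \<rho> c a" "0 < a" "a < 1" "\<And>n. 0 \<le> fps_nth H n"
    and r: "eval_fps H \<rho> = r"
    and G: "singular_expansion G r cG lam" "0 < lam" "lam < 1" "\<And>n. 0 \<le> fps_nth G n"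
    and b: "b < lam * a"
  obtains \<kappa> \<psi> \<phi> \<tau> where "sing_exp \<kappa> \<psi> (of_real r) (of_real c) a"
    "disc_sums (\<lambda>n. fps_nth H n * \<rho> ^ n) \<psi>" "\<phi> has_fps_expansion fps_scale 1 G"
    "sing_exp \<kappa> (\<lambda>z. \<phi> (\<psi> z)) (of_real \<tau>) 0 b"
    "(\<lambda>n. fps_nth G n * r ^ n) sums \<tau>"
proof -
  have r0: "0 < r" using G by (simp add: singular_expansion_def)
  obtain \<kappa>0 \<psi> where \<psi>: "sing_exp \<kappa>0 \<psi> (of_real r) (of_real c) a"
    "disc_sums (\<lambda>n. fps_nth H n * \<rho> ^ n) \<psi>" "c < 0"
    and dom: "\<forall>\<epsilon>>0. \<exists>\<kappa>'. 0 < \<kappa>' \<and> \<kappa>' \<le> \<kappa>0 \<and> \<psi> ` dented_disc \<kappa>' \<subseteq> half_disc r \<epsilon>"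
    by (rule critical_inner_series[OF H(1-4) r r0])
  obtain \<epsilon> \<phi> \<tau> where \<phi>: "0 < \<epsilon>" "\<phi> holomorphic_on half_disc r \<epsilon>"
    "disc_sums (\<lambda>n. fps_nth G n * r ^ n) (\<lambda>z. \<phi> (of_real r * z))"
    "(\<lambda>n. fps_nth G n * r ^ n) sums \<tau>"
    "(\<lambda>w. \<phi> w - of_real \<tau>) \<in> O[at (of_real r) within half_disc r \<epsilon>](\<lambda>w. (1 - w / of_real r) powr of_real lam)"
    by (rule half_disc_expansion_lt_1[OF G])
  obtain \<kappa> where \<kappa>: "0 < \<kappa>" "\<kappa> \<le> \<kappa>0" "\<psi> ` dented_disc \<kappa> \<subseteq> half_disc r \<epsilon>"
    using dom \<phi>(1) by blast
  have \<psi>': "sing_exp \<kappa> \<psi> (of_real r) (of_real c) a" by (rule sing_exp_mono[OF \<psi>(1) \<kappa>(1,2)])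
  have "sing_exp \<kappa> (\<lambda>z. \<phi> (\<psi> z)) (of_real \<tau>) 0 b"
    by (rule sing_exp_compose_powr[OF \<psi>' H(2) \<kappa>(3) \<phi>(2,5) r0 G(2) b])
  from that[OF \<psi>' \<psi>(2) disc_sums_has_fps_expansion_unscaled[OF r0 \<phi>(3)] this \<phi>(4)]
  show thesis .
qed

lemma sing_exp_common:
  assumes "sing_exp \<kappa>1 f C A a" "sing_exp \<kappa>2 g E B b"
  shows "sing_exp (min \<kappa>1 \<kappa>2) f C A a" "sing_exp (min \<kappa>1 \<kappa>2) g E B b"
proof -
  have "0 < \<kappa>1" "0 < \<kappa>2" using assms by (simp_all add: sing_exp_def)
  then show "sing_exp (min \<kappa>1 \<kappa>2) f C A a" "sing_exp (min \<kappa>1 \<kappa>2) g E B b"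
    by (auto intro: sing_exp_mono[OF assms(1)] sing_exp_mono[OF assms(2)])
qed

theorem theorem4p3:
  fixes G H M :: "real fps"
    and \<rho>\<^sub>G \<rho>\<^sub>H c\<^sub>G lam\<^sub>G c\<^sub>H lam\<^sub>H c\<^sub>M :: real and lam\<^sub>M :: ereal
    and k :: nat
  assumes scheme: "extended_composition_scheme G H M \<rho>\<^sub>G \<rho>\<^sub>H c\<^sub>G lam\<^sub>G c\<^sub>H lam\<^sub>H c\<^sub>M lam\<^sub>M"
    and critical: "critical_scheme H M \<rho>\<^sub>G \<rho>\<^sub>H"
    and lam_H: "0 < lam\<^sub>H" "lam\<^sub>H < 1"
    and degenerate: "degenerate_scheme lam\<^sub>G lam\<^sub>H lam\<^sub>M"
  shows
   "let boltzmann = (\<lambda>j. fps_nth G j * \<rho>\<^sub>G ^ j / eval_fps G \<rho>\<^sub>G);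
        biased = (\<lambda>j. real j * fps_nth G j * \<rho>\<^sub>G ^ (j - 1) / eval_fps (fps_deriv G) \<rho>\<^sub>G);
        \<tau>\<^sub>M = eval_fps M \<rho>\<^sub>H;
        p = c\<^sub>M * eval_fps G \<rho>\<^sub>G /
              (c\<^sub>M * eval_fps G \<rho>\<^sub>G + c\<^sub>H * \<tau>\<^sub>M * eval_fps (fps_deriv G) \<rho>\<^sub>G)
    in
      pmf (boltzmann_pmf G \<rho>\<^sub>G) k = boltzmann k \<and>
      (0 < lam\<^sub>G \<and> lam\<^sub>G < 1 \<and> lam\<^sub>M < ereal (lam\<^sub>G * lam\<^sub>H) \<longrightarrow>
         (\<lambda>n. core_size_prob G H M n k) \<longlonglongrightarrow> boltzmann k) \<and>
      (1 < lam\<^sub>G \<longrightarrow>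
         (lam\<^sub>M < ereal lam\<^sub>H \<longrightarrow>
            (\<lambda>n. core_size_prob G H M n k) \<longlonglongrightarrow> boltzmann k) \<and>
         (lam\<^sub>M = ereal lam\<^sub>H \<longrightarrow>
            0 \<le> p \<and> p \<le> 1 \<and>
            (\<lambda>n. core_size_prob G H M n k) \<longlonglongrightarrow> p * boltzmann k + (1 - p) * biased k \<and>
            (\<exists>A' :: nat pmf. (\<forall>j. pmf A' j = biased j) \<and>
               pmf (map_pmf (\<lambda>(i, a, a'). of_bool i * a + (1 - of_bool i) * a')
                      (pair_pmf (bernoulli_pmf p) (pair_pmf (boltzmann_pmf G \<rho>\<^sub>G) A'))) k
                 = p * boltzmann k + (1 - p) * biased k)) \<and>
         (lam\<^sub>M > ereal lam\<^sub>H \<longrightarrow>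
            (\<lambda>n. core_size_prob G H M n k) \<longlonglongrightarrow> biased k))"
proof -
  have nG: "\<And>n. 0 \<le> fps_nth G n" and nH: "\<And>n. 0 \<le> fps_nth H n" and nM: "\<And>n. 0 \<le> fps_nth M n"
    and h0: "fps_nth H 0 = 0" and M0: "M \<noteq> 0"
    and sG: "singular_expansion G \<rho>\<^sub>G c\<^sub>G lam\<^sub>G" and sH: "singular_expansion H \<rho>\<^sub>H c\<^sub>H lam\<^sub>H"
    and M_eq: "fps_conv_radius M = ereal \<rho>\<^sub>H \<Longrightarrow> \<exists>l. lam\<^sub>M = ereal l \<and> singular_expansion M \<rho>\<^sub>H c\<^sub>M l"
    and M_gt: "fps_conv_radius M > ereal \<rho>\<^sub>H \<Longrightarrow> lam\<^sub>M = \<infinity>"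
    using scheme unfolding extended_composition_scheme_def by auto
  have r: "eval_fps H \<rho>\<^sub>H = \<rho>\<^sub>G" and radM: "ereal \<rho>\<^sub>H \<le> fps_conv_radius M"
    using critical by (auto simp: critical_scheme_def)
  have \<rho>: "0 < \<rho>\<^sub>G" "0 < \<rho>\<^sub>H" "c\<^sub>H \<noteq> 0" using sG sH by (auto simp: singular_expansion_def)
  have M_cases: "(fps_conv_radius M > ereal \<rho>\<^sub>H \<and> lam\<^sub>M = \<infinity>) \<or> (\<exists>l. lam\<^sub>M = ereal l \<and> singular_expansion M \<rho>\<^sub>H c\<^sub>M l)"
    using M_eq M_gt radM by (cases "fps_conv_radius M = ereal \<rho>\<^sub>H") auto
  define \<tau> where "\<tau> = eval_fps G \<rho>\<^sub>G"
  define D where "D = eval_fps (fps_deriv G) \<rho>\<^sub>G"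
  define m where "m = eval_fps M \<rho>\<^sub>H"
  define p where "p = c\<^sub>M * \<tau> / (c\<^sub>M * \<tau> + c\<^sub>H * m * D)"
  define bol where "bol = (\<lambda>j. fps_nth G j * \<rho>\<^sub>G ^ j / \<tau>)"
  define bia where "bia = (\<lambda>j. real j * fps_nth G j * \<rho>\<^sub>G ^ (j - 1) / D)"

  have lam_G: "1 < lam\<^sub>G \<or> 0 < lam\<^sub>G \<and> lam\<^sub>G < 1"
    using degenerate by (auto simp: degenerate_scheme_def)
  have "(\<lambda>n. fps_nth G n * \<rho>\<^sub>G ^ n) sums t \<Longrightarrow> t = \<tau>" for t
    by (simp add: \<tau>_def eval_fps_def sums_iff)
  note tau_eq = this
  have \<tau>_sums: "(\<lambda>n. fps_nth G n * \<rho>\<^sub>G ^ n) sums \<tau>"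
    using lam_G
  proof (elim disjE conjE)
    assume "1 < lam\<^sub>G"
    from half_disc_expansion_gt_1[OF sG this nG] show ?thesis using tau_eq by metis
  next
    assume "0 < lam\<^sub>G" "lam\<^sub>G < 1"
    from half_disc_expansion_lt_1[OF sG this nG] show ?thesis using tau_eq by metis
  qed
  obtain n\<^sub>0 where n0: "1 \<le> n\<^sub>0" "fps_nth G n\<^sub>0 \<noteq> 0"
    using fps_conv_radius_finite_imp_coeff[of G \<rho>\<^sub>G] sG by (auto simp: singular_expansion_def)
  then have n0': "0 < fps_nth G n\<^sub>0" using nG[of n\<^sub>0] by linarith
  have \<tau>_pos: "0 < \<tau>"
    by (rule sums_pos[OF \<tau>_sums, of n\<^sub>0]) (use nG n0' \<rho> in auto)
  have pmf_bol: "pmf (boltzmann_pmf G \<rho>\<^sub>G) j = bol j" for j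
    unfolding boltzmann_pmf_def \<tau>_def[symmetric] bol_def
    by (rule pmf_embed_pmf_nat) (use nG \<rho> \<tau>_pos sums_divide[OF \<tau>_sums, of \<tau>] in auto)

  \<comment> \<open>Shared by part (a), with \<open>B = 0\<close> and \<open>b\<close> just below
    the product of the exponents, and by the first case of part (b), with \<open>b\<close> the
    exponent of \<open>H\<close>.\<close>
  have small_exponent: "(\<lambda>n. core_size_prob G H M n k) \<longlonglongrightarrow> bol k"
    if *: "sing_exp \<kappa> \<psi> (of_real \<rho>\<^sub>G) (of_real c\<^sub>H) lam\<^sub>H" "disc_sums (\<lambda>n. fps_nth H n * \<rho>\<^sub>H ^ n) \<psi>"
      "\<phi> has_fps_expansion fps_scale 1 G" "sing_exp \<kappa> (\<lambda>z. \<phi> (\<psi> z)) (of_real \<tau>) B b" "0 < b"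
      and l: "lam\<^sub>M = ereal l" "singular_expansion M \<rho>\<^sub>H c\<^sub>M l" "l < b" "l < lam\<^sub>H"
    for \<kappa> \<psi> \<phi> B b l
  proof -
    have l1: "l < 1" "l \<notin> \<nat>" "c\<^sub>M \<noteq> 0" using l lam_H by (auto simp: singular_expansion_def)
    obtain \<kappa>' \<mu> C where \<mu>: "sing_exp \<kappa>' \<mu> C (of_real c\<^sub>M) l" "l < 0 \<longrightarrow> C = 0"
      "disc_sums (\<lambda>n. fps_nth M n * \<rho>\<^sub>H ^ n) \<mu>"
      by (rule sing_exp_singular_expansion[OF l(2) l1(1)])
    show ?thesis unfolding bol_def
      by (rule core_size_prob_limit_dominated[OF \<rho>(2) h0 sing_exp_common(1)[OF *(1) \<mu>(1)] lam_H(1) *(2,3)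
            sing_exp_common(1)[OF *(4) \<mu>(1)] *(5) sing_exp_common(2)[OF *(1) \<mu>(1)] \<mu>(2,3) l(4,3) l1(1,2)])
         (use \<tau>_pos l1 in auto)
  qed

  have part_a: "(\<lambda>n. core_size_prob G H M n k) \<longlonglongrightarrow> bol k"
    if lt: "0 < lam\<^sub>G" "lam\<^sub>G < 1" "lam\<^sub>M < ereal (lam\<^sub>G * lam\<^sub>H)"
  proof -
    obtain l where l: "lam\<^sub>M = ereal l" "singular_expansion M \<rho>\<^sub>H c\<^sub>M l" using M_cases lt by auto
    have l2: "l < lam\<^sub>G * lam\<^sub>H" "0 < lam\<^sub>G * lam\<^sub>H" using l lt lam_H by auto
    have l3: "lam\<^sub>G * lam\<^sub>H < lam\<^sub>H" using lt lam_H by simp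
    \<comment> \<open>The composition has an error of smaller order only for exponents strictly
      below the product. The midpoint with \<open>max 0 l\<close> is positive and exceeds
      \<open>l\<close> even when \<open>l\<close> is negative.\<close>
    define b where "b = (max 0 l + lam\<^sub>G * lam\<^sub>H) / 2"
    have b: "0 < b" "l < b" "b < lam\<^sub>G * lam\<^sub>H" using l2 by (auto simp: b_def)
    obtain \<kappa> \<psi> \<phi> t where *: "sing_exp \<kappa> \<psi> (of_real \<rho>\<^sub>G) (of_real c\<^sub>H) lam\<^sub>H"
      "disc_sums (\<lambda>n. fps_nth H n * \<rho>\<^sub>H ^ n) \<psi>" "\<phi> has_fps_expansion fps_scale 1 G"
      "sing_exp \<kappa> (\<lambda>z. \<phi> (\<psi> z)) (of_real t) 0 b" "(\<lambda>n. fps_nth G n * \<rho>\<^sub>G ^ n) sums t"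
      by (rule critical_composition_lt_1[OF sH lam_H nH r sG lt(1,2) nG b(3)])
    show ?thesis
      by (rule small_exponent[OF *(1-3) *(4)[unfolded tau_eq[OF *(5)]] b(1) l b(2)]) (use l2 l3 in simp)
  qed

  have part_b: "(lam\<^sub>M < ereal lam\<^sub>H \<longrightarrow> (\<lambda>n. core_size_prob G H M n k) \<longlonglongrightarrow> bol k) \<and>
      (lam\<^sub>M = ereal lam\<^sub>H \<longrightarrow>
            0 \<le> p \<and> p \<le> 1 \<and>
            (\<lambda>n. core_size_prob G H M n k) \<longlonglongrightarrow> p * bol k + (1 - p) * bia k \<and>
            (\<exists>A' :: nat pmf. (\<forall>j. pmf A' j = bia j) \<and>
               pmf (map_pmf (\<lambda>(i, a, a'). of_bool i * a + (1 - of_bool i) * a')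
                      (pair_pmf (bernoulli_pmf p) (pair_pmf (boltzmann_pmf G \<rho>\<^sub>G) A'))) k
                 = p * bol k + (1 - p) * bia k)) \<and>
      (lam\<^sub>M > ereal lam\<^sub>H \<longrightarrow> (\<lambda>n. core_size_prob G H M n k) \<longlonglongrightarrow> bia k)"
    if gt: "1 < lam\<^sub>G"
  proof -
    obtain \<kappa> \<psi> \<phi> t d where *: "sing_exp \<kappa> \<psi> (of_real \<rho>\<^sub>G) (of_real c\<^sub>H) lam\<^sub>H"
      "disc_sums (\<lambda>n. fps_nth H n * \<rho>\<^sub>H ^ n) \<psi>" "c\<^sub>H < 0" "\<phi> has_fps_expansion fps_scale 1 G"
      "sing_exp \<kappa> (\<lambda>z. \<phi> (\<psi> z)) (of_real t) (of_real (d * c\<^sub>H)) lam\<^sub>H"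
      "(\<lambda>n. fps_nth G n * \<rho>\<^sub>G ^ n) sums t" "(\<lambda>n. real n * fps_nth G n * \<rho>\<^sub>G ^ (n - 1)) sums d"
      by (rule critical_composition_gt_1[OF sH lam_H nH r sG gt nG])
    have t: "t = \<tau>" by (rule tau_eq[OF *(6)])
    have d: "d = D" using eval_fps_deriv_sums[OF *(7)] by (simp add: D_def)
    note \<Phi> = *(5)[unfolded t d] and D_sums = *(7)[unfolded d]
    have D_pos: "0 < D"
      by (rule sums_pos[OF D_sums, of n\<^sub>0]) (use nG n0 n0' \<rho> in auto)

    \<comment> \<open>Used with \<open>c = 0\<close> when the exponent of \<open>M\<close> exceeds
      that of \<open>H\<close>, and with \<open>c\<close> the constant of \<open>M\<close> when they
      agree. The sign \<open>c \<le> 0\<close> rules out cancellation: both summands of the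
      denominator are then nonpositive, and the second is negative.\<close>
    have linear: "0 < m \<and> (c \<le> 0 \<longrightarrow> (\<lambda>n. core_size_prob G H M n k) \<longlonglongrightarrow>
        fps_nth G k * ((c * \<rho>\<^sub>G ^ k + c\<^sub>H * m * (real k * \<rho>\<^sub>G ^ (k - 1))) / (c * \<tau> + c\<^sub>H * m * D)))"
      if \<mu>: "sing_exp \<kappa>' \<mu> C (of_real c) lam\<^sub>H" "disc_sums (\<lambda>n. fps_nth M n * \<rho>\<^sub>H ^ n) \<mu>" for \<kappa>' \<mu> C c
    proof -
      have nM': "0 \<le> fps_nth M n * \<rho>\<^sub>H ^ n" for n using nM \<rho> by simp
      have ms: "(\<lambda>n. fps_nth M n * \<rho>\<^sub>H ^ n) sums Re C" "C = of_real (Re C)"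
        using sing_exp_sums[OF \<mu>(1) lam_H(1) nM' \<mu>(2)] by auto
      then have m: "Re C = m" by (simp add: m_def eval_fps_def sums_iff)
      obtain j where "fps_nth M j \<noteq> 0" using M0 by (auto simp: fps_eq_iff)
      then have "0 < fps_nth M j" using nM[of j] by linarith
      then have "0 < fps_nth M j * \<rho>\<^sub>H ^ j" using \<rho> by simp
      from sums_pos[OF ms(1) nM' this] have m_pos: "0 < m" by (simp add: m)
      have neg: "c\<^sub>H * m * D < 0" using *(3) m_pos D_pos by (simp add: mult_neg_pos)
      moreover have "c * \<tau> \<le> 0" if "c \<le> 0" using that \<tau>_pos by (simp add: mult_nonpos_nonneg)
      ultimately have nz: "c * \<tau> + c\<^sub>H * m * D \<noteq> 0" if "c \<le> 0" using that by fastforce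
      have \<mu>': "sing_exp \<kappa>' \<mu> (of_real m) (of_real c) lam\<^sub>H" using \<mu>(1) ms(2) m by simp
      show ?thesis
        using core_size_prob_limit_linear[OF \<rho>(2) h0 sing_exp_common(1)[OF *(1) \<mu>'] lam_H *(2,4)
            sing_exp_common(1)[OF \<Phi> \<mu>'] sing_exp_common(2)[OF *(1) \<mu>'] \<mu>(2) nz] m_pos by blast
    qed

    show ?thesis
    proof (intro conjI impI)
      assume lt: "lam\<^sub>M < ereal lam\<^sub>H"
      obtain l where l: "lam\<^sub>M = ereal l" "singular_expansion M \<rho>\<^sub>H c\<^sub>M l" using M_cases lt by auto
      show "(\<lambda>n. core_size_prob G H M n k) \<longlonglongrightarrow> bol k"
        by (rule small_exponent[OF *(1,2,4) \<Phi> lam_H(1) l]) (use l lt in auto)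
    next
      assume gtM: "lam\<^sub>M > ereal lam\<^sub>H"
      have "fps_conv_radius M > ereal \<rho>\<^sub>H \<or> (\<exists>l. lam\<^sub>H < l \<and> singular_expansion M \<rho>\<^sub>H c\<^sub>M l)"
        using M_cases gtM by auto
      from sing_exp_of_larger_exponent[OF this \<rho>(2) lam_H]
      obtain \<kappa>' \<mu> C where \<mu>: "sing_exp \<kappa>' \<mu> C (of_real 0) lam\<^sub>H" "disc_sums (\<lambda>n. fps_nth M n * \<rho>\<^sub>H ^ n) \<mu>"
        by auto
      from linear[OF this] have m: "0 < m"
        and lim: "(\<lambda>n. core_size_prob G H M n k) \<longlonglongrightarrow>
          fps_nth G k * ((c\<^sub>H * m * (real k * \<rho>\<^sub>G ^ (k - 1))) / (c\<^sub>H * m * D))" by auto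
      have "fps_nth G k * ((c\<^sub>H * m * (real k * \<rho>\<^sub>G ^ (k - 1))) / (c\<^sub>H * m * D)) = bia k"
        using m \<rho> D_pos by (simp add: bia_def)
      with lim show "(\<lambda>n. core_size_prob G H M n k) \<longlonglongrightarrow> bia k" by simp
    next
      assume eq: "lam\<^sub>M = ereal lam\<^sub>H"
      then have sM: "singular_expansion M \<rho>\<^sub>H c\<^sub>M lam\<^sub>H" using M_cases by auto
      then have cM0: "c\<^sub>M \<noteq> 0" by (simp add: singular_expansion_def)
      obtain \<kappa>' \<mu> C where \<mu>: "sing_exp \<kappa>' \<mu> C (of_real c\<^sub>M) lam\<^sub>H" "lam\<^sub>H < 0 \<longrightarrow> C = 0"
        "disc_sums (\<lambda>n. fps_nth M n * \<rho>\<^sub>H ^ n) \<mu>"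
        by (rule sing_exp_singular_expansion[OF sM lam_H(2)])
      have cM: "c\<^sub>M < 0"
        by (rule sing_exp_coeff_neg[OF \<mu>(1) lam_H cM0 _ \<mu>(3)]) (use nM \<rho> in auto)
      from linear[OF \<mu>(1,3)] cM have m: "0 < m"
        and lim: "(\<lambda>n. core_size_prob G H M n k) \<longlonglongrightarrow>
          fps_nth G k * ((c\<^sub>M * \<rho>\<^sub>G ^ k + c\<^sub>H * m * (real k * \<rho>\<^sub>G ^ (k - 1))) / (c\<^sub>M * \<tau> + c\<^sub>H * m * D))"
        by auto
      \<comment> \<open>\<open>x\<close> and \<open>y\<close> are the contributions of the
        singularities of \<open>M\<close> and of \<open>G(H)\<close> to the denominator. Both are
        negative, so \<open>p\<close> is a proper weight.\<close>
      define x where "x = c\<^sub>M * \<tau>"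
      define y where "y = c\<^sub>H * m * D"
      have xy: "x < 0" "y < 0"
        using cM \<tau>_pos *(3) m D_pos by (auto simp: x_def y_def mult_neg_pos)
      have p_x: "p = x / (x + y)" by (simp only: p_def x_def y_def)
      moreover have "1 - x / (x + y) = y / (x + y)" using xy by (simp add: field_simps)
      ultimately have p_xy: "p = x / (x + y)" "1 - p = y / (x + y)" by simp_all
      show p: "0 \<le> p" "p \<le> 1" using xy unfolding p_x
        by (auto simp: divide_nonpos_nonpos divide_le_eq_1)
      have "p * bol k + (1 - p) * bia k = (c\<^sub>M * (fps_nth G k * \<rho>\<^sub>G ^ k) + c\<^sub>H * m * (real k * fps_nth G k * \<rho>\<^sub>G ^ (k - 1))) / (x + y)"
        unfolding p_xy(2) unfolding p_x bol_def bia_def using \<tau>_pos D_pos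
        by (simp add: x_def y_def add_divide_distrib)
      also have "\<dots> = fps_nth G k * ((c\<^sub>M * \<rho>\<^sub>G ^ k + c\<^sub>H * m * (real k * \<rho>\<^sub>G ^ (k - 1))) / (c\<^sub>M * \<tau> + c\<^sub>H * m * D))"
        by (simp add: x_def y_def algebra_simps)
      finally show "(\<lambda>n. core_size_prob G H M n k) \<longlonglongrightarrow> p * bol k + (1 - p) * bia k"
        using lim by simp
      have "pmf (embed_pmf bia) j = bia j" for j
        by (rule pmf_embed_pmf_nat)
           (use nG \<rho> D_pos sums_divide[OF D_sums, of D] in \<open>auto simp: bia_def\<close>)
      then show "\<exists>A' :: nat pmf. (\<forall>j. pmf A' j = bia j) \<and>
               pmf (map_pmf (\<lambda>(i, a, a'). of_bool i * a + (1 - of_bool i) * a')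
                      (pair_pmf (bernoulli_pmf p) (pair_pmf (boltzmann_pmf G \<rho>\<^sub>G) A'))) k
                 = p * bol k + (1 - p) * bia k"
        by (intro exI[of _ "embed_pmf bia"]) (simp only: pmf_bernoulli_mixture[OF p] pmf_bol simp_thms)
    qed
  qed

  show ?thesis
    unfolding Let_def \<tau>_def[symmetric] D_def[symmetric] m_def[symmetric] p_def[symmetric]
    using pmf_bol part_a part_b unfolding bol_def bia_def by blast
qed

end
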